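(* Let $\lambda$ be a regular cardinal, let $\mathcal{V}$ be a symmetric monoidal closed category with unit object $I$ which is locally $\lambda$-presentable as a symmetric monoidal closed category, and assume that the functor $\mathcal{V}_0(I,-):\mathcal{V}_0\to\mathbf{Set}$ preserves $\lambda$-presentable objects. Let $\mathcal{T}$ be a $\lambda$-ary $\mathcal{V}$-theory. Then $\mathcal{T}$ is discrete if and only if its induced $\mathcal{V}$-monad $T:\mathcal{V}\to\mathcal{V}$ preserves surjections (i.e. $T(f)$ is a surjection whenever $f$ is a surjection).
   Context: $\mathcal{V}_0$ denotes the underlying category of $\mathcal{V}$. "$\mathcal{V}$ is locally $\lambda$-presentable as a symmetric monoidal closed category" means: $\mathcal{V}_0$ is locally $\lambda$-presentable, the unit $I$ is $\lambda$-presentable, and $X\otimes Y$ is $\lambda$-presentable whenever $X$ and $Y$ are. $\mathcal{V}_\lambda$ denotes the (representative) small full subcategory of $\mathcal{V}$ consisting of $\lambda$-presentable objects, with inclusion $K:\mathcal{V}_\lambda\to\mathcal{V}$. Surjections: a morphism $f:A\to B$ of $\mathcal{V}_0$ is a surjection if the map $\mathcal{V}_0(I,f)$ is surjective. Discrete objects: $\mathcal{V}_0(I,-):\mathcal{V}_0\to\mathbf{Set}$ has a left adjoint sending a set $S$ to the coproduct $S\cdot I$ of $S$ copies of $I$; objects of the form $S\cdot I$ are called discrete. For an object $X$, put $X_0=\mathcal{V}_0(I,X)\cdot I$ and let $\delta_X:X_0\to X$ be the counit of this adjunction. (Under the assumptions, $X_0$ is $\lambda$-presentable whenever $X$ is.)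 Theories: a $\mathcal{V}_\lambda$-pretheory is an identity-on-objects $\mathcal{V}$-functor $J:\mathcal{V}_\lambda\to\mathcal{T}$. A $\mathcal{T}$-algebra is an object $A$ of $\mathcal{V}$ together with a $\mathcal{V}$-functor $\hat A:\mathcal{T}^{\mathrm{op}}\to\mathcal{V}$ whose composite with $J^{\mathrm{op}}$ is $\mathcal{V}(K-,A)$; these form a $\mathcal{V}$-category $\mathbf{Alg}(\mathcal{T})$ (the pullback of $[\mathcal{T}^{\mathrm{op}},\mathcal{V}]\to[\mathcal{V}_\lambda^{\mathrm{op}},\mathcal{V}]$, restriction along $J^{\mathrm{op}}$, along $\mathcal{V}\to[\mathcal{V}_\lambda^{\mathrm{op}},\mathcal{V}]$, $A\mapsto\mathcal{V}(K-,A)$), with forgetful $\mathcal{V}$-functor $U:\mathbf{Alg}(\mathcal{T})\to\mathcal{V}$ that is monadic with left $\mathcal{V}$-adjoint $F$. The induced $\mathcal{V}$-monad is $T=UF$. Conversely, a $\mathcal{V}$-monad $T$ induces the pretheory $J:\mathcal{V}_\lambda\to\mathcal{T}$ where $\mathcal{T}$ is the full subcategory of $\mathbf{Alg}(T)$ on the free algebras on objects of $\mathcal{V}_\lambda$ and $J$ is the domain-codomain restriction of the free algebra functor. A pretheory is a $\mathcal{V}_\lambda$-theory, called a $\lambda$-ary $\mathcal{V}$-theory, if it is (up to isomorphism) the pretheory induced by its induced monad. A $\lambda$-ary $\mathcal{V}$-theory $J:\mathcal{V}_\lambda\to\mathcal{T}$ is discrete if for every $X$ in $\mathcal{V}_\lambda$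 every morphism $JI\to JX$ of $\mathcal{T}$ is a composite $J(\delta_X)f$ for some morphism $f:JI\to JX_0$ of $\mathcal{T}$. *)

theory Defs
  imports Main "HOL-Library.FuncSet"
begin

unbundle cardinal_syntax

section \<open>Categories\<close>

record ('o, 'm) cat =
  Obj :: "'o set"
  Arr :: "'m set"
  Dom :: "'m \<Rightarrow> 'o"
  Cod :: "'m \<Rightarrow> 'o"
  Id :: "'o \<Rightarrow> 'm"
  Comp :: "'m \<Rightarrow> 'm \<Rightarrow> 'm"  (infixr \<open>\<cdot>\<index>\<close> 65)

definition hom :: "('o, 'm, 'z) cat_scheme \<Rightarrow> 'o \<Rightarrow> 'o \<Rightarrow> 'm set" where
  "hom C a b = {f \<in> Arr C. Dom C f = a \<and> Cod C f = b}"

locale category =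
  fixes C :: "('o, 'm, 'z) cat_scheme" (structure)
  assumes dom_obj: "f \<in> Arr C \<Longrightarrow> Dom C f \<in> Obj C"
    and cod_obj: "f \<in> Arr C \<Longrightarrow> Cod C f \<in> Obj C"
    and id_hom: "a \<in> Obj C \<Longrightarrow> Id C a \<in> hom C a a"
    and comp_hom: "f \<in> hom C a b \<Longrightarrow> g \<in> hom C b c \<Longrightarrow> g \<cdot> f \<in> hom C a c"
    and comp_id: "f \<in> hom C a b \<Longrightarrow> f \<cdot> Id C a = f"
    and id_comp: "f \<in> hom C a b \<Longrightarrow> Id C b \<cdot> f = f"
    and comp_assoc: "f \<in> hom C a b \<Longrightarrow> g \<in> hom C b c \<Longrightarrow> h \<in> hom C c d \<Longrightarrow>
      (h \<cdot> g) \<cdot> f = h \<cdot> (g \<cdot> f)"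

definition inverse_pair :: "('o, 'm, 'z) cat_scheme \<Rightarrow> 'm \<Rightarrow> 'm \<Rightarrow> bool" where
  "inverse_pair C f g \<longleftrightarrow> f \<in> Arr C \<and> g \<in> hom C (Cod C f) (Dom C f) \<and>
     g \<cdot> f = Id C (Dom C f) \<and> f \<cdot> g = Id C (Cod C f)"
  for C (structure)

definition is_iso :: "('o, 'm, 'z) cat_scheme \<Rightarrow> 'm \<Rightarrow> bool" where
  "is_iso C f \<longleftrightarrow> (\<exists>g. inverse_pair C f g)"

definition inv_arr :: "('o, 'm, 'z) cat_scheme \<Rightarrow> 'm \<Rightarrow> 'm" where
  "inv_arr C f = (THE g. inverse_pair C f g)"

record ('a, 'f, 'b, 'g) func =
  fObj :: "'a \<Rightarrow> 'b"
  fArr :: "'f \<Rightarrow> 'g"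

definition is_functor ::
  "('a, 'f, 'y) cat_scheme \<Rightarrow> ('b, 'g, 'z) cat_scheme \<Rightarrow> ('a, 'f, 'b, 'g) func \<Rightarrow> bool" where
  "is_functor A B F \<longleftrightarrow>
     (\<forall>a \<in> Obj A. fObj F a \<in> Obj B) \<and>
     (\<forall>f \<in> Arr A. fArr F f \<in> hom B (fObj F (Dom A f)) (fObj F (Cod A f))) \<and>
     (\<forall>a \<in> Obj A. fArr F (Id A a) = Id B (fObj F a)) \<and>
     (\<forall>a b c. \<forall>f \<in> hom A a b. \<forall>g \<in> hom A b c.
        fArr F (g \<cdot>\<^bsub>A\<^esub> f) = fArr F g \<cdot>\<^bsub>B\<^esub> fArr F f)"

definition func_comp ::
  "('b, 'g, 'c, 'h) func \<Rightarrow> ('a, 'f, 'b, 'g) func \<Rightarrow> ('a, 'f, 'c, 'h) func" where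
  "func_comp G F = \<lparr>fObj = fObj G \<circ> fObj F, fArr = fArr G \<circ> fArr F\<rparr>"

definition cocone ::
  "('b, 'g, 'z) cat_scheme \<Rightarrow> ('a, 'f, 'y) cat_scheme \<Rightarrow> ('a, 'f, 'b, 'g) func \<Rightarrow>
   'b \<Rightarrow> ('a \<Rightarrow> 'g) \<Rightarrow> bool" where
  "cocone B A D c u \<longleftrightarrow> c \<in> Obj B \<and> (\<forall>a \<in> Obj A. u a \<in> hom B (fObj D a) c) \<and>
     (\<forall>f \<in> Arr A. u (Cod A f) \<cdot>\<^bsub>B\<^esub> fArr D f = u (Dom A f))"

definition is_colimit ::
  "('b, 'g, 'z) cat_scheme \<Rightarrow> ('a, 'f, 'y) cat_scheme \<Rightarrow> ('a, 'f, 'b, 'g) func \<Rightarrow>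
   'b \<Rightarrow> ('a \<Rightarrow> 'g) \<Rightarrow> bool" where
  "is_colimit B A D c u \<longleftrightarrow> cocone B A D c u \<and>
     (\<forall>d v. cocone B A D d v \<longrightarrow> (\<exists>!h. h \<in> hom B c d \<and> (\<forall>a \<in> Obj A. h \<cdot>\<^bsub>B\<^esub> u a = v a)))"


section \<open>Size, sets, presentability\<close>

text \<open>
  Smallness is relative to a type \<open>'s\<close>: a set is small when it has strictly fewer elements than
  \<open>'s\<close>. If the cardinality of \<open>'s\<close> is inaccessible, this is smallness with respect to a
  Grothendieck universe; the definitions make sense for any \<open>'s\<close>. Every small category is
  isomorphic to one whose objects and arrows are elements of \<open>'s\<close>, so diagrams indexed by
  categories of type \<open>('s, 's) cat\<close> are all the small diagrams. The regular cardinal (called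
  lambda in the literature) is a relation \<open>\<kappa> :: 's rel\<close>, which also determines \<open>'s\<close>.
\<close>

definition small :: "'s itself \<Rightarrow> 'a set \<Rightarrow> bool" where
  "small s A \<longleftrightarrow> |A| <o |UNIV :: 's set|"

definition small_regular_cardinal :: "'s rel \<Rightarrow> bool" where
  "small_regular_cardinal \<kappa> \<longleftrightarrow>
     Card_order \<kappa> \<and> infinite (Field \<kappa>) \<and> regularCard \<kappa> \<and> small TYPE('s) (Field \<kappa>)"

definition small_category :: "('s, 's) cat \<Rightarrow> bool" where
  "small_category A \<longleftrightarrow> category A \<and> small TYPE('s) (Obj A) \<and> small TYPE('s) (Arr A)"

definition filtered :: "'s rel \<Rightarrow> ('s, 's) cat \<Rightarrow> bool" where
  "filtered \<kappa> A \<longleftrightarrow>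
     (\<forall>S E. S \<subseteq> Obj A \<and> |S| <o \<kappa> \<and> E \<subseteq> Arr A \<and> |E| <o \<kappa> \<and>
        (\<forall>f \<in> E. Dom A f \<in> S \<and> Cod A f \<in> S) \<longrightarrow>
        (\<exists>c \<in> Obj A. \<exists>u. (\<forall>a \<in> S. u a \<in> hom A a c) \<and>
           (\<forall>f \<in> E. u (Cod A f) \<cdot>\<^bsub>A\<^esub> f = u (Dom A f))))"

text \<open>
  The category of small sets. Its objects are subsets of \<open>'s + 'm\<close>: the left summand provides
  sets of every small cardinality, the right one contains the hom-sets of any category with
  arrows in \<open>'m\<close>. Up to equivalence the choice of \<open>'m\<close> is immaterial.
\<close>

definition set_cat ::
  "(('s + 'm) set, ('s + 'm) set \<times> ('s + 'm \<Rightarrow> 's + 'm) \<times> ('s + 'm) set) cat" where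
  "set_cat = \<lparr>Obj = {A. small TYPE('s) A},
     Arr = {(A, f, B). small TYPE('s) A \<and> small TYPE('s) B \<and> f \<in> A \<rightarrow>\<^sub>E B},
     Dom = (\<lambda>(A, f, B). A), Cod = (\<lambda>(A, f, B). B),
     Id = (\<lambda>A. (A, restrict id A, A)),
     Comp = (\<lambda>(B, g, C) (A, f, B'). (A, compose A g f, C))\<rparr>"

definition hom_set :: "('o, 'm, 'z) cat_scheme \<Rightarrow> 'o \<Rightarrow> 'o \<Rightarrow> ('s + 'm) set" where
  "hom_set C a b = Inr ` hom C a b"

definition hom_functor ::
  "('o, 'm, 'z) cat_scheme \<Rightarrow> 'o \<Rightarrow>
   ('o, 'm, ('s + 'm) set, ('s + 'm) set \<times> ('s + 'm \<Rightarrow> 's + 'm) \<times> ('s + 'm) set) func" where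
  "hom_functor C a = \<lparr>fObj = hom_set C a,
     fArr = (\<lambda>f. (hom_set C a (Dom C f),
                  \<lambda>x \<in> hom_set C a (Dom C f). Inr (f \<cdot> projr x),
                  hom_set C a (Cod C f)))\<rparr>"
  for C (structure)

definition presentable :: "'s rel \<Rightarrow> ('o, 'm, 'z) cat_scheme \<Rightarrow> 'o \<Rightarrow> bool" where
  "presentable \<kappa> C x \<longleftrightarrow> x \<in> Obj C \<and>
     (\<forall>(A :: ('s, 's) cat) D c u.
        small_category A \<and> filtered \<kappa> A \<and> is_functor A C D \<and> is_colimit C A D c u \<longrightarrow>
        is_colimit (set_cat :: (('s + 'm) set, _) cat) A (func_comp (hom_functor C x) D)
          (fObj (hom_functor C x) c) (\<lambda>a. fArr (hom_functor C x) (u a)))"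

definition locally_small :: "'s itself \<Rightarrow> ('o, 'm, 'z) cat_scheme \<Rightarrow> bool" where
  "locally_small s C \<longleftrightarrow> (\<forall>a \<in> Obj C. \<forall>b \<in> Obj C. small s (hom C a b))"

definition cocomplete :: "'s itself \<Rightarrow> ('o, 'm, 'z) cat_scheme \<Rightarrow> bool" where
  "cocomplete s C \<longleftrightarrow> (\<forall>(A :: ('s, 's) cat) D. small_category A \<and> is_functor A C D \<longrightarrow>
     (\<exists>c u. is_colimit C A D c u))"

definition locally_presentable :: "'s rel \<Rightarrow> ('o, 'm, 'z) cat_scheme \<Rightarrow> bool" where
  "locally_presentable \<kappa> C \<longleftrightarrow> category C \<and> locally_small TYPE('s) C \<and> cocomplete TYPE('s) C \<and>
     (\<exists>G. small TYPE('s) G \<and> (\<forall>g \<in> G. presentable \<kappa> C g) \<and>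
        (\<forall>c \<in> Obj C. \<exists>(A :: ('s, 's) cat) D u.
           small_category A \<and> filtered \<kappa> A \<and> is_functor A C D \<and>
           (\<forall>a \<in> Obj A. fObj D a \<in> G) \<and> is_colimit C A D c u))"


section \<open>Symmetric monoidal closed categories\<close>

record ('o, 'm) smcat = "('o, 'm) cat" +
  Ten :: "'o \<Rightarrow> 'o \<Rightarrow> 'o"  (infixr \<open>\<otimes>\<index>\<close> 70)
  TenA :: "'m \<Rightarrow> 'm \<Rightarrow> 'm"  (infixr \<open>\<odot>\<index>\<close> 70)
  Unit :: "'o"
  Assoc :: "'o \<Rightarrow> 'o \<Rightarrow> 'o \<Rightarrow> 'm"
  Lunit :: "'o \<Rightarrow> 'm"
  Runit :: "'o \<Rightarrow> 'm"
  Symm :: "'o \<Rightarrow> 'o \<Rightarrow> 'm"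
  Ihom :: "'o \<Rightarrow> 'o \<Rightarrow> 'o"
  Ev :: "'o \<Rightarrow> 'o \<Rightarrow> 'm"

locale symmetric_monoidal_closed = category V
  for V :: "('o, 'm, 'z) smcat_scheme" (structure) +
  assumes ten_obj: "x \<in> Obj V \<Longrightarrow> y \<in> Obj V \<Longrightarrow> x \<otimes> y \<in> Obj V"
    and ten_hom: "f \<in> hom V x x' \<Longrightarrow> g \<in> hom V y y' \<Longrightarrow> f \<odot> g \<in> hom V (x \<otimes> y) (x' \<otimes> y')"
    and ten_id: "x \<in> Obj V \<Longrightarrow> y \<in> Obj V \<Longrightarrow> Id V x \<odot> Id V y = Id V (x \<otimes> y)"
    and ten_comp: "f \<in> hom V x x' \<Longrightarrow> f' \<in> hom V x' x'' \<Longrightarrow> g \<in> hom V y y' \<Longrightarrow> g' \<in> hom V y' y'' \<Longrightarrow>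
      (f' \<cdot> f) \<odot> (g' \<cdot> g) = (f' \<odot> g') \<cdot> (f \<odot> g)"
    and unit_obj: "Unit V \<in> Obj V"
    and assoc_hom: "x \<in> Obj V \<Longrightarrow> y \<in> Obj V \<Longrightarrow> z \<in> Obj V \<Longrightarrow>
      Assoc V x y z \<in> hom V ((x \<otimes> y) \<otimes> z) (x \<otimes> (y \<otimes> z))"
    and assoc_iso: "x \<in> Obj V \<Longrightarrow> y \<in> Obj V \<Longrightarrow> z \<in> Obj V \<Longrightarrow> is_iso V (Assoc V x y z)"
    and assoc_nat: "f \<in> hom V x x' \<Longrightarrow> g \<in> hom V y y' \<Longrightarrow> h \<in> hom V z z' \<Longrightarrow>
      Assoc V x' y' z' \<cdot> ((f \<odot> g) \<odot> h) = (f \<odot> (g \<odot> h)) \<cdot> Assoc V x y z"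
    and lunit_hom: "x \<in> Obj V \<Longrightarrow> Lunit V x \<in> hom V (Unit V \<otimes> x) x"
    and lunit_iso: "x \<in> Obj V \<Longrightarrow> is_iso V (Lunit V x)"
    and lunit_nat: "f \<in> hom V x x' \<Longrightarrow> Lunit V x' \<cdot> (Id V (Unit V) \<odot> f) = f \<cdot> Lunit V x"
    and runit_hom: "x \<in> Obj V \<Longrightarrow> Runit V x \<in> hom V (x \<otimes> Unit V) x"
    and runit_iso: "x \<in> Obj V \<Longrightarrow> is_iso V (Runit V x)"
    and runit_nat: "f \<in> hom V x x' \<Longrightarrow> Runit V x' \<cdot> (f \<odot> Id V (Unit V)) = f \<cdot> Runit V x"
    and pentagon: "w \<in> Obj V \<Longrightarrow> x \<in> Obj V \<Longrightarrow> y \<in> Obj V \<Longrightarrow> z \<in> Obj V \<Longrightarrow>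
      Assoc V w x (y \<otimes> z) \<cdot> Assoc V (w \<otimes> x) y z =
      (Id V w \<odot> Assoc V x y z) \<cdot> Assoc V w (x \<otimes> y) z \<cdot> (Assoc V w x y \<odot> Id V z)"
    and triangle: "x \<in> Obj V \<Longrightarrow> y \<in> Obj V \<Longrightarrow>
      (Id V x \<odot> Lunit V y) \<cdot> Assoc V x (Unit V) y = Runit V x \<odot> Id V y"
    and symm_hom: "x \<in> Obj V \<Longrightarrow> y \<in> Obj V \<Longrightarrow> Symm V x y \<in> hom V (x \<otimes> y) (y \<otimes> x)"
    and symm_nat: "f \<in> hom V x x' \<Longrightarrow> g \<in> hom V y y' \<Longrightarrow>
      Symm V x' y' \<cdot> (f \<odot> g) = (g \<odot> f) \<cdot> Symm V x y"
    and symm_symm: "x \<in> Obj V \<Longrightarrow> y \<in> Obj V \<Longrightarrow> Symm V y x \<cdot> Symm V x y = Id V (x \<otimes> y)"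
    and hexagon: "x \<in> Obj V \<Longrightarrow> y \<in> Obj V \<Longrightarrow> z \<in> Obj V \<Longrightarrow>
      Assoc V y z x \<cdot> Symm V x (y \<otimes> z) \<cdot> Assoc V x y z =
      (Id V y \<odot> Symm V x z) \<cdot> Assoc V y x z \<cdot> (Symm V x y \<odot> Id V z)"
    and ihom_obj: "x \<in> Obj V \<Longrightarrow> y \<in> Obj V \<Longrightarrow> Ihom V x y \<in> Obj V"
    and ev_hom: "x \<in> Obj V \<Longrightarrow> y \<in> Obj V \<Longrightarrow> Ev V x y \<in> hom V (Ihom V x y \<otimes> x) y"
    and closed: "x \<in> Obj V \<Longrightarrow> y \<in> Obj V \<Longrightarrow> z \<in> Obj V \<Longrightarrow> f \<in> hom V (z \<otimes> x) y \<Longrightarrow>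
      \<exists>!g. g \<in> hom V z (Ihom V x y) \<and> Ev V x y \<cdot> (g \<odot> Id V x) = f"

definition curry_arr :: "('o, 'm, 'z) smcat_scheme \<Rightarrow> 'o \<Rightarrow> 'o \<Rightarrow> 'o \<Rightarrow> 'm \<Rightarrow> 'm" where
  "curry_arr V z x y f = (THE g. g \<in> hom V z (Ihom V x y) \<and> Ev V x y \<cdot> (g \<odot> Id V x) = f)"
  for V (structure)

text \<open>\<open>name_arr\<close> and \<open>unname_arr\<close> are the two directions of the bijection between arrows
  \<open>x \<rightarrow> y\<close> and arrows \<open>Unit V \<rightarrow> Ihom V x y\<close>.\<close>

definition name_arr :: "('o, 'm, 'z) smcat_scheme \<Rightarrow> 'm \<Rightarrow> 'm" where
  "name_arr V f = curry_arr V (Unit V) (Dom V f) (Cod V f) (f \<cdot> Lunit V (Dom V f))"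
  for V (structure)

definition unname_arr :: "('o, 'm, 'z) smcat_scheme \<Rightarrow> 'o \<Rightarrow> 'o \<Rightarrow> 'm \<Rightarrow> 'm" where
  "unname_arr V x y g = Ev V x y \<cdot> (g \<odot> Id V x) \<cdot> inv_arr V (Lunit V x)"
  for V (structure)

definition locally_presentable_smc :: "'s rel \<Rightarrow> ('o, 'm, 'z) smcat_scheme \<Rightarrow> bool" where
  "locally_presentable_smc \<kappa> V \<longleftrightarrow> symmetric_monoidal_closed V \<and> locally_presentable \<kappa> V \<and>
     presentable \<kappa> V (Unit V) \<and>
     (\<forall>x y. presentable \<kappa> V x \<and> presentable \<kappa> V y \<longrightarrow> presentable \<kappa> V (x \<otimes> y))"
  for V (structure)

definition unit_hom_preserves_presentable :: "'s rel \<Rightarrow> ('o, 'm, 'z) smcat_scheme \<Rightarrow> bool" where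
  "unit_hom_preserves_presentable \<kappa> V \<longleftrightarrow>
     (\<forall>x. presentable \<kappa> V x \<longrightarrow>
        presentable \<kappa> (set_cat :: (('s + 'm) set, _) cat) (fObj (hom_functor V (Unit V)) x))"

definition surjection :: "('o, 'm, 'z) smcat_scheme \<Rightarrow> 'm \<Rightarrow> bool" where
  "surjection V f \<longleftrightarrow> f \<in> Arr V \<and>
     (\<lambda>a. f \<cdot> a) ` hom V (Unit V) (Dom V f) = hom V (Unit V) (Cod V f)"
  for V (structure)

text \<open>\<open>x0\<close> with injections \<open>\<iota> s\<close>, \<open>s \<in> S\<close>, is the coproduct of \<open>S\<close> copies of the unit.\<close>

definition is_unit_copower ::
  "('o, 'm, 'z) smcat_scheme \<Rightarrow> 'a set \<Rightarrow> 'o \<Rightarrow> ('a \<Rightarrow> 'm) \<Rightarrow> bool" where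
  "is_unit_copower V S x0 \<iota> \<longleftrightarrow> x0 \<in> Obj V \<and> (\<forall>s \<in> S. \<iota> s \<in> hom V (Unit V) x0) \<and>
     (\<forall>y \<in> Obj V. \<forall>g. (\<forall>s \<in> S. g s \<in> hom V (Unit V) y) \<longrightarrow>
        (\<exists>!h. h \<in> hom V x0 y \<and> (\<forall>s \<in> S. h \<cdot> \<iota> s = g s)))"
  for V (structure)

text \<open>The counit \<open>\<delta>\<close> at \<open>x\<close> of the adjunction between copowers of the unit and
  \<open>hom V (Unit V) -\<close>: its component at the copy indexed by \<open>s\<close> is \<open>s\<close> itself.\<close>

definition discrete_counit :: "('o, 'm, 'z) smcat_scheme \<Rightarrow> 'o \<Rightarrow> 'o \<Rightarrow> ('m \<Rightarrow> 'm) \<Rightarrow> 'm" where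
  "discrete_counit V x x0 \<iota> =
     (THE d. d \<in> hom V x0 x \<and> (\<forall>s \<in> hom V (Unit V) x. d \<cdot> \<iota> s = s))"
  for V (structure)


section \<open>Enriched categories\<close>

text \<open>Functor categories, pullbacks and Eilenberg-Moore categories are specified by their universal
  properties, hence up to isomorphism, rather than by a choice of limits in \<open>V\<close>.\<close>

text \<open>\<open>vComp C a b c\<close> is the composition \<open>C(b,c) \<otimes> C(a,b) \<rightarrow> C(a,c)\<close>.\<close>

record ('a, 'o, 'm) vcat =
  vObj :: "'a set"
  vHom :: "'a \<Rightarrow> 'a \<Rightarrow> 'o"
  vId :: "'a \<Rightarrow> 'm"
  vComp :: "'a \<Rightarrow> 'a \<Rightarrow> 'a \<Rightarrow> 'm"

definition is_vcat :: "('o, 'm, 'z) smcat_scheme \<Rightarrow> ('a, 'o, 'm) vcat \<Rightarrow> bool" where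
  "is_vcat V C \<longleftrightarrow>
     (\<forall>a \<in> vObj C. \<forall>b \<in> vObj C. vHom C a b \<in> Obj V) \<and>
     (\<forall>a \<in> vObj C. vId C a \<in> hom V (Unit V) (vHom C a a)) \<and>
     (\<forall>a \<in> vObj C. \<forall>b \<in> vObj C. \<forall>c \<in> vObj C.
        vComp C a b c \<in> hom V (vHom C b c \<otimes> vHom C a b) (vHom C a c)) \<and>
     (\<forall>a \<in> vObj C. \<forall>b \<in> vObj C.
        vComp C a a b \<cdot> (Id V (vHom C a b) \<odot> vId C a) = Runit V (vHom C a b) \<and>
        vComp C a b b \<cdot> (vId C b \<odot> Id V (vHom C a b)) = Lunit V (vHom C a b)) \<and>
     (\<forall>a \<in> vObj C. \<forall>b \<in> vObj C. \<forall>c \<in> vObj C. \<forall>d \<in> vObj C.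
        vComp C a b d \<cdot> (vComp C b c d \<odot> Id V (vHom C a b)) =
        vComp C a c d \<cdot> (Id V (vHom C c d) \<odot> vComp C a b c)
          \<cdot> Assoc V (vHom C c d) (vHom C b c) (vHom C a b))"
  for V (structure)

definition vfull :: "('a, 'o, 'm) vcat \<Rightarrow> 'a set \<Rightarrow> ('a, 'o, 'm) vcat" where
  "vfull C P = C\<lparr>vObj := P\<rparr>"

definition vop :: "('o, 'm, 'z) smcat_scheme \<Rightarrow> ('a, 'o, 'm) vcat \<Rightarrow> ('a, 'o, 'm) vcat" where
  "vop V C = \<lparr>vObj = vObj C, vHom = (\<lambda>a b. vHom C b a), vId = vId C,
     vComp = (\<lambda>a b c. vComp C c b a \<cdot> Symm V (vHom C c b) (vHom C b a))\<rparr>"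
  for V (structure)

text \<open>\<open>V\<close> as a category enriched over itself.\<close>

definition vself :: "('o, 'm, 'z) smcat_scheme \<Rightarrow> ('o, 'o, 'm) vcat" where
  "vself V = \<lparr>vObj = Obj V, vHom = Ihom V, vId = (\<lambda>x. curry_arr V (Unit V) x x (Lunit V x)),
     vComp = (\<lambda>x y z. curry_arr V (Ihom V y z \<otimes> Ihom V x y) x z
        (Ev V y z \<cdot> (Id V (Ihom V y z) \<odot> Ev V x y) \<cdot> Assoc V (Ihom V y z) (Ihom V x y) x))\<rparr>"
  for V (structure)

record ('a, 'b, 'm) vfun =
  vO :: "'a \<Rightarrow> 'b"
  vH :: "'a \<Rightarrow> 'a \<Rightarrow> 'm"

definition is_vfunctor ::
  "('o, 'm, 'z) smcat_scheme \<Rightarrow> ('a, 'o, 'm) vcat \<Rightarrow> ('b, 'o, 'm) vcat \<Rightarrow> ('a, 'b, 'm) vfun \<Rightarrow> bool" where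
  "is_vfunctor V C D S \<longleftrightarrow>
     (\<forall>a \<in> vObj C. vO S a \<in> vObj D) \<and>
     (\<forall>a \<in> vObj C. \<forall>b \<in> vObj C. vH S a b \<in> hom V (vHom C a b) (vHom D (vO S a) (vO S b))) \<and>
     (\<forall>a \<in> vObj C. vH S a a \<cdot> vId C a = vId D (vO S a)) \<and>
     (\<forall>a \<in> vObj C. \<forall>b \<in> vObj C. \<forall>c \<in> vObj C.
        vH S a c \<cdot> vComp C a b c =
        vComp D (vO S a) (vO S b) (vO S c) \<cdot> (vH S b c \<odot> vH S a b))"
  for V (structure)

text \<open>Values outside \<open>vObj C\<close> are normalised, so that equality of enriched functors (as objects of
  functor categories) is equality of terms.\<close>

definition vfun_ext :: "('a, 'o, 'm) vcat \<Rightarrow> ('a, 'b, 'm) vfun \<Rightarrow> bool" where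
  "vfun_ext C S \<longleftrightarrow> vO S \<in> extensional (vObj C) \<and> vH S \<in> extensional (vObj C) \<and>
     (\<forall>a \<in> vObj C. vH S a \<in> extensional (vObj C))"

definition vfun_id :: "('o, 'm, 'z) smcat_scheme \<Rightarrow> ('a, 'o, 'm) vcat \<Rightarrow> ('a, 'a, 'm) vfun" where
  "vfun_id V C = \<lparr>vO = (\<lambda>a \<in> vObj C. a), vH = (\<lambda>a \<in> vObj C. \<lambda>b \<in> vObj C. Id V (vHom C a b))\<rparr>"

definition vfun_comp ::
  "('o, 'm, 'z) smcat_scheme \<Rightarrow> ('a, 'o, 'm) vcat \<Rightarrow> ('b, 'c, 'm) vfun \<Rightarrow> ('a, 'b, 'm) vfun \<Rightarrow>
   ('a, 'c, 'm) vfun" where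
  "vfun_comp V C R S = \<lparr>vO = (\<lambda>a \<in> vObj C. vO R (vO S a)),
     vH = (\<lambda>a \<in> vObj C. \<lambda>b \<in> vObj C. vH R (vO S a) (vO S b) \<cdot> vH S a b)\<rparr>"
  for V (structure)

definition vfun_op :: "('a, 'b, 'm) vfun \<Rightarrow> ('a, 'b, 'm) vfun" where
  "vfun_op S = \<lparr>vO = vO S, vH = (\<lambda>a b. vH S b a)\<rparr>"

text \<open>Families \<open>p a : w \<rightarrow> D(S a, R a)\<close> that are enriched-natural in \<open>a\<close>. For \<open>w = Unit V\<close> these are
  the enriched natural transformations; the universal such family is the end of \<open>D(S a, R a)\<close>.\<close>

definition vnatural_family ::
  "('o, 'm, 'z) smcat_scheme \<Rightarrow> ('a, 'o, 'm) vcat \<Rightarrow> ('b, 'o, 'm) vcat \<Rightarrow>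
   ('a, 'b, 'm) vfun \<Rightarrow> ('a, 'b, 'm) vfun \<Rightarrow> 'o \<Rightarrow> ('a \<Rightarrow> 'm) \<Rightarrow> bool" where
  "vnatural_family V C D S R w p \<longleftrightarrow>
     (\<forall>a \<in> vObj C. p a \<in> hom V w (vHom D (vO S a) (vO R a))) \<and>
     (\<forall>a \<in> vObj C. \<forall>b \<in> vObj C.
        vComp D (vO S a) (vO S b) (vO R b) \<cdot> (p b \<odot> vH S a b) =
        vComp D (vO S a) (vO R a) (vO R b) \<cdot> (vH R a b \<odot> p a) \<cdot> Symm V w (vHom C a b))"
  for V (structure)

definition vtransformation ::
  "('o, 'm, 'z) smcat_scheme \<Rightarrow> ('a, 'o, 'm) vcat \<Rightarrow> ('b, 'o, 'm) vcat \<Rightarrow>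
   ('a, 'b, 'm) vfun \<Rightarrow> ('a, 'b, 'm) vfun \<Rightarrow> ('a \<Rightarrow> 'm) \<Rightarrow> bool" where
  "vtransformation V C D S R p \<longleftrightarrow> vnatural_family V C D S R (Unit V) p"

text \<open>Composition in the underlying ordinary category of \<open>C\<close>, whose arrows \<open>a \<rightarrow> b\<close> are the arrows
  \<open>Unit V \<rightarrow> C(a,b)\<close>.\<close>

definition ucomp ::
  "('o, 'm, 'z) smcat_scheme \<Rightarrow> ('a, 'o, 'm) vcat \<Rightarrow> 'a \<Rightarrow> 'a \<Rightarrow> 'a \<Rightarrow> 'm \<Rightarrow> 'm \<Rightarrow> 'm" where
  "ucomp V C a b c g f = vComp C a b c \<cdot> (g \<odot> f) \<cdot> inv_arr V (Lunit V (Unit V))"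
  for V (structure)

definition is_vadjunction ::
  "('o, 'm, 'z) smcat_scheme \<Rightarrow> ('a, 'o, 'm) vcat \<Rightarrow> ('b, 'o, 'm) vcat \<Rightarrow>
   ('a, 'b, 'm) vfun \<Rightarrow> ('b, 'a, 'm) vfun \<Rightarrow> ('a \<Rightarrow> 'm) \<Rightarrow> ('b \<Rightarrow> 'm) \<Rightarrow> bool" where
  "is_vadjunction V C D F U \<eta> \<epsilon> \<longleftrightarrow>
     is_vfunctor V C D F \<and> is_vfunctor V D C U \<and>
     vtransformation V C C (vfun_id V C) (vfun_comp V C U F) \<eta> \<and>
     vtransformation V D D (vfun_comp V D F U) (vfun_id V D) \<epsilon> \<and>
     (\<forall>d \<in> vObj D. ucomp V C (vO U d) (vO U (vO F (vO U d))) (vO U d)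
        (vH U (vO F (vO U d)) d \<cdot> \<epsilon> d) (\<eta> (vO U d)) = vId C (vO U d)) \<and>
     (\<forall>c \<in> vObj C. ucomp V D (vO F c) (vO F (vO U (vO F c))) (vO F c)
        (\<epsilon> (vO F c)) (vH F c (vO U (vO F c)) \<cdot> \<eta> c) = vId D (vO F c))"
  for V (structure)

text \<open>\<open>E\<close>, with the family of evaluations \<open>ev S R a : E(S,R) \<rightarrow> D(S a, R a)\<close>, is the enriched functor
  category \<open>[C,D]\<close>.\<close>

definition is_vfunctor_category ::
  "('o, 'm, 'z) smcat_scheme \<Rightarrow> ('a, 'o, 'm) vcat \<Rightarrow> ('b, 'o, 'm) vcat \<Rightarrow>
   (('a, 'b, 'm) vfun, 'o, 'm) vcat \<Rightarrow>
   (('a, 'b, 'm) vfun \<Rightarrow> ('a, 'b, 'm) vfun \<Rightarrow> 'a \<Rightarrow> 'm) \<Rightarrow> bool" where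
  "is_vfunctor_category V C D E ev \<longleftrightarrow>
     is_vcat V E \<and> vObj E = {S. is_vfunctor V C D S \<and> vfun_ext C S} \<and>
     (\<forall>S \<in> vObj E. \<forall>R \<in> vObj E. vnatural_family V C D S R (vHom E S R) (ev S R) \<and>
        (\<forall>w \<in> Obj V. \<forall>p. vnatural_family V C D S R w p \<longrightarrow>
           (\<exists>!h. h \<in> hom V w (vHom E S R) \<and> (\<forall>a \<in> vObj C. ev S R a \<cdot> h = p a)))) \<and>
     (\<forall>a \<in> vObj C. is_vfunctor V E D \<lparr>vO = (\<lambda>S. vO S a), vH = (\<lambda>S R. ev S R a)\<rparr>)"
  for V (structure)

definition is_pullback :: "('o, 'm, 'z) cat_scheme \<Rightarrow> 'm \<Rightarrow> 'm \<Rightarrow> 'm \<Rightarrow> 'm \<Rightarrow> bool" where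
  "is_pullback C f g p q \<longleftrightarrow>
     p \<in> Arr C \<and> q \<in> Arr C \<and> Dom C p = Dom C q \<and> Cod C p = Dom C f \<and> Cod C q = Dom C g \<and>
     f \<cdot> p = g \<cdot> q \<and>
     (\<forall>w. \<forall>r \<in> hom C w (Dom C f). \<forall>s \<in> hom C w (Dom C g). f \<cdot> r = g \<cdot> s \<longrightarrow>
        (\<exists>!h. h \<in> hom C w (Dom C p) \<and> p \<cdot> h = r \<and> q \<cdot> h = s))"
  for C (structure)

definition is_equalizer :: "('o, 'm, 'z) cat_scheme \<Rightarrow> 'm \<Rightarrow> 'm \<Rightarrow> 'm \<Rightarrow> bool" where
  "is_equalizer C f g e \<longleftrightarrow> e \<in> Arr C \<and> Cod C e = Dom C f \<and> f \<cdot> e = g \<cdot> e \<and>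
     (\<forall>w. \<forall>r \<in> hom C w (Dom C f). f \<cdot> r = g \<cdot> r \<longrightarrow> (\<exists>!h. h \<in> hom C w (Dom C e) \<and> e \<cdot> h = r))"
  for C (structure)

text \<open>\<open>Q\<close> with projections \<open>p\<close>, \<open>q\<close> is the pullback of the enriched functors
  \<open>S : A \<rightarrow> C\<close> and \<open>R : B \<rightarrow> C\<close>.\<close>

definition is_vpullback ::
  "('o, 'm, 'z) smcat_scheme \<Rightarrow> ('a, 'o, 'm) vcat \<Rightarrow> ('b, 'o, 'm) vcat \<Rightarrow>
   ('a, 'c, 'm) vfun \<Rightarrow> ('b, 'c, 'm) vfun \<Rightarrow>
   ('a \<times> 'b, 'o, 'm) vcat \<Rightarrow> ('a \<times> 'b, 'a, 'm) vfun \<Rightarrow> ('a \<times> 'b, 'b, 'm) vfun \<Rightarrow> bool" where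
  "is_vpullback V A B S R Q p q \<longleftrightarrow>
     is_vcat V Q \<and> vObj Q = {(a, b). a \<in> vObj A \<and> b \<in> vObj B \<and> vO S a = vO R b} \<and>
     is_vfunctor V Q A p \<and> is_vfunctor V Q B q \<and>
     (\<forall>x \<in> vObj Q. vO p x = fst x \<and> vO q x = snd x) \<and>
     (\<forall>x \<in> vObj Q. \<forall>y \<in> vObj Q.
        is_pullback V (vH S (fst x) (fst y)) (vH R (snd x) (snd y)) (vH p x y) (vH q x y))"


section \<open>Theories, algebras and monads\<close>

text \<open>\<open>P\<close> is the set of objects of a small full subcategory of representatives of the presentable
  objects. The unit is taken to be its own representative.\<close>

definition presentable_representatives :: "'s rel \<Rightarrow> ('o, 'm, 'z) smcat_scheme \<Rightarrow> 'o set \<Rightarrow> bool" where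
  "presentable_representatives \<kappa> V P \<longleftrightarrow>
     small TYPE('s) P \<and> (\<forall>x \<in> P. presentable \<kappa> V x) \<and> Unit V \<in> P \<and>
     (\<forall>y. presentable \<kappa> V y \<longrightarrow> (\<exists>x \<in> P. \<exists>f \<in> hom V x y. is_iso V f))"

definition is_pretheory ::
  "('o, 'm, 'z) smcat_scheme \<Rightarrow> 'o set \<Rightarrow> ('o, 'o, 'm) vcat \<Rightarrow> ('o, 'o, 'm) vfun \<Rightarrow> bool" where
  "is_pretheory V P T J \<longleftrightarrow> is_vcat V T \<and> vObj T = P \<and>
     is_vfunctor V (vfull (vself V) P) T J \<and> (\<forall>x \<in> P. vO J x = x)"

text \<open>The contravariant functor \<open>V(K-, y)\<close> on the full subcategory on \<open>P\<close>, and the action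
  \<open>V(y, y') \<rightarrow> [V(x, y), V(x, y')]\<close> of the covariant \<open>V(x, -)\<close>.\<close>

definition vrep :: "('o, 'm, 'z) smcat_scheme \<Rightarrow> 'o set \<Rightarrow> 'o \<Rightarrow> ('o, 'o, 'm) vfun" where
  "vrep V P y = \<lparr>vO = (\<lambda>x \<in> P. Ihom V x y),
     vH = (\<lambda>x \<in> P. \<lambda>x' \<in> P. curry_arr V (Ihom V x' x) (Ihom V x y) (Ihom V x' y)
        (vComp (vself V) x' x y \<cdot> Symm V (Ihom V x' x) (Ihom V x y)))\<rparr>"
  for V (structure)

definition vpostcomp :: "('o, 'm, 'z) smcat_scheme \<Rightarrow> 'o \<Rightarrow> 'o \<Rightarrow> 'o \<Rightarrow> 'm" where
  "vpostcomp V x y y' = curry_arr V (Ihom V y y') (Ihom V x y) (Ihom V x y') (vComp (vself V) x y y')"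

definition is_restricted_yoneda ::
  "('o, 'm, 'z) smcat_scheme \<Rightarrow> 'o set \<Rightarrow> (('o, 'o, 'm) vfun, 'o, 'm) vcat \<Rightarrow>
   (('o, 'o, 'm) vfun \<Rightarrow> ('o, 'o, 'm) vfun \<Rightarrow> 'o \<Rightarrow> 'm) \<Rightarrow>
   ('o, ('o, 'o, 'm) vfun, 'm) vfun \<Rightarrow> bool" where
  "is_restricted_yoneda V P E ev N \<longleftrightarrow> is_vfunctor V (vself V) E N \<and>
     (\<forall>y \<in> Obj V. vO N y = vrep V P y) \<and>
     (\<forall>y \<in> Obj V. \<forall>y' \<in> Obj V. \<forall>x \<in> P.
        ev (vO N y) (vO N y') x \<cdot> vH N y y' = vpostcomp V x y y')"
  for V (structure)

definition is_restriction ::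
  "('o, 'm, 'z) smcat_scheme \<Rightarrow> 'o set \<Rightarrow> ('o, 'o, 'm) vfun \<Rightarrow>
   (('o, 'o, 'm) vfun, 'o, 'm) vcat \<Rightarrow> (('o, 'o, 'm) vfun \<Rightarrow> ('o, 'o, 'm) vfun \<Rightarrow> 'o \<Rightarrow> 'm) \<Rightarrow>
   (('o, 'o, 'm) vfun, 'o, 'm) vcat \<Rightarrow> (('o, 'o, 'm) vfun \<Rightarrow> ('o, 'o, 'm) vfun \<Rightarrow> 'o \<Rightarrow> 'm) \<Rightarrow>
   (('o, 'o, 'm) vfun, ('o, 'o, 'm) vfun, 'm) vfun \<Rightarrow> bool" where
  "is_restriction V P J E ev E' ev' R \<longleftrightarrow> is_vfunctor V E E' R \<and>
     (\<forall>S \<in> vObj E. vO R S = vfun_comp V (vop V (vfull (vself V) P)) S (vfun_op J)) \<and>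
     (\<forall>S \<in> vObj E. \<forall>S' \<in> vObj E. \<forall>x \<in> P.
        ev' (vO R S) (vO R S') x \<cdot> vH R S S' = ev S S' (vO J x))"
  for V (structure)

text \<open>\<open>Q\<close> is the enriched category of algebras of the pretheory \<open>J\<close> and \<open>U\<close> the forgetful functor:
  the pullback of restriction along \<open>J\<close> and of \<open>y \<mapsto> V(K-, y)\<close>. Its objects are
  the pairs of an object \<open>y\<close> and an enriched functor \<open>T\<^sup>o\<^sup>p \<rightarrow> V\<close> restricting to \<open>V(K-, y)\<close>.\<close>

definition is_algebra_category ::
  "('o, 'm, 'z) smcat_scheme \<Rightarrow> 'o set \<Rightarrow> ('o, 'o, 'm) vcat \<Rightarrow> ('o, 'o, 'm) vfun \<Rightarrow>
   ('o \<times> ('o, 'o, 'm) vfun, 'o, 'm) vcat \<Rightarrow> ('o \<times> ('o, 'o, 'm) vfun, 'o, 'm) vfun \<Rightarrow> bool" where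
  "is_algebra_category V P T J Q U \<longleftrightarrow>
     (\<exists>E ev E' ev' N R q.
        is_vfunctor_category V (vop V T) (vself V) E ev \<and>
        is_vfunctor_category V (vop V (vfull (vself V) P)) (vself V) E' ev' \<and>
        is_restricted_yoneda V P E' ev' N \<and> is_restriction V P J E ev E' ev' R \<and>
        is_vpullback V (vself V) E N R Q U q)"

record ('o, 'm) vmonad =
  mFun :: "('o, 'o, 'm) vfun"
  mUnit :: "'o \<Rightarrow> 'm"
  mMult :: "'o \<Rightarrow> 'm"

definition is_induced_monad ::
  "('o, 'm, 'z) smcat_scheme \<Rightarrow> 'o set \<Rightarrow> ('o, 'o, 'm) vcat \<Rightarrow> ('o, 'o, 'm) vfun \<Rightarrow>
   ('o, 'm) vmonad \<Rightarrow> bool" where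
  "is_induced_monad V P T J M \<longleftrightarrow>
     (\<exists>Q U F \<eta> \<epsilon>. is_algebra_category V P T J Q U \<and> is_vadjunction V (vself V) Q F U \<eta> \<epsilon> \<and>
        M = \<lparr>mFun = vfun_comp V (vself V) U F, mUnit = \<eta>,
             mMult = (\<lambda>x. vH U (vO F (vO U (vO F x))) (vO F x) \<cdot> \<epsilon> (vO F x))\<rparr>)"
  for V (structure)

definition monad_arr :: "('o, 'm, 'z) smcat_scheme \<Rightarrow> ('o, 'm) vmonad \<Rightarrow> 'm \<Rightarrow> 'm" where
  "monad_arr V M f = unname_arr V (vO (mFun M) (Dom V f)) (vO (mFun M) (Cod V f))
     (vH (mFun M) (Dom V f) (Cod V f) \<cdot> name_arr V f)"
  for V (structure)

definition preserves_surjections :: "('o, 'm, 'z) smcat_scheme \<Rightarrow> ('o, 'm) vmonad \<Rightarrow> bool" where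
  "preserves_surjections V M \<longleftrightarrow> (\<forall>f. surjection V f \<longrightarrow> surjection V (monad_arr V M f))"

text \<open>The unit and multiplication of a monad on \<open>V\<close> as arrows of the underlying category of \<open>V\<close>.\<close>

definition unit_arr :: "('o, 'm, 'z) smcat_scheme \<Rightarrow> ('o, 'm) vmonad \<Rightarrow> 'o \<Rightarrow> 'm" where
  "unit_arr V M x = unname_arr V x (vO (mFun M) x) (mUnit M x)"

definition mult_arr :: "('o, 'm, 'z) smcat_scheme \<Rightarrow> ('o, 'm) vmonad \<Rightarrow> 'o \<Rightarrow> 'm" where
  "mult_arr V M x = unname_arr V (vO (mFun M) (vO (mFun M) x)) (vO (mFun M) x) (mMult M x)"

text \<open>\<open>E\<close> is the enriched Eilenberg-Moore category of \<open>M\<close> and \<open>W\<close> its forgetful functor. The object of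
  homomorphisms from \<open>(x, a)\<close> to \<open>(y, b)\<close> equalizes \<open>[a, y]\<close> and \<open>[M x, b] M\<^sub>x\<^sub>y\<close>,
  both going from \<open>[x, y]\<close> to \<open>[M x, y]\<close>.\<close>

definition is_eilenberg_moore ::
  "('o, 'm, 'z) smcat_scheme \<Rightarrow> ('o, 'm) vmonad \<Rightarrow> ('o \<times> 'm, 'o, 'm) vcat \<Rightarrow>
   ('o \<times> 'm, 'o, 'm) vfun \<Rightarrow> bool" where
  "is_eilenberg_moore V M E W \<longleftrightarrow> is_vcat V E \<and> is_vfunctor V E (vself V) W \<and>
     vObj E = {(x, a). x \<in> Obj V \<and> a \<in> hom V (vO (mFun M) x) x \<and>
                 a \<cdot> unit_arr V M x = Id V x \<and> a \<cdot> mult_arr V M x = a \<cdot> monad_arr V M a} \<and>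
     (\<forall>(x, a) \<in> vObj E. vO W (x, a) = x) \<and>
     (\<forall>(x, a) \<in> vObj E. \<forall>(y, b) \<in> vObj E.
        is_equalizer V
          (curry_arr V (Ihom V x y) (vO (mFun M) x) y (Ev V x y \<cdot> (Id V (Ihom V x y) \<odot> a)))
          (curry_arr V (Ihom V (vO (mFun M) x) (vO (mFun M) y)) (vO (mFun M) x) y
             (b \<cdot> Ev V (vO (mFun M) x) (vO (mFun M) y)) \<cdot> vH (mFun M) x y)
          (vH W (x, a) (y, b)))"
  for V (structure)

definition free_alg :: "('o, 'm, 'z) smcat_scheme \<Rightarrow> ('o, 'm) vmonad \<Rightarrow> 'o \<Rightarrow> 'o \<times> 'm" where
  "free_alg V M x = (vO (mFun M) x, mult_arr V M x)"

text \<open>The pretheory induced by \<open>M\<close>: the full subcategory of the Eilenberg-Moore category on the free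
  algebras on objects of \<open>P\<close>, with objects named by \<open>P\<close>, and the corestricted free algebra functor,
  which is the lift of \<open>M\<close> through the forgetful functor \<open>W\<close>.\<close>

definition induced_theory ::
  "('o, 'm, 'z) smcat_scheme \<Rightarrow> 'o set \<Rightarrow> ('o, 'm) vmonad \<Rightarrow> ('o \<times> 'm, 'o, 'm) vcat \<Rightarrow>
   ('o, 'o, 'm) vcat" where
  "induced_theory V P M E = \<lparr>vObj = P, vHom = (\<lambda>x y. vHom E (free_alg V M x) (free_alg V M y)),
     vId = (\<lambda>x. vId E (free_alg V M x)),
     vComp = (\<lambda>x y z. vComp E (free_alg V M x) (free_alg V M y) (free_alg V M z))\<rparr>"

definition induced_theory_functor ::
  "('o, 'm, 'z) smcat_scheme \<Rightarrow> 'o set \<Rightarrow> ('o, 'm) vmonad \<Rightarrow> ('o \<times> 'm, 'o, 'm) vcat \<Rightarrow>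
   ('o \<times> 'm, 'o, 'm) vfun \<Rightarrow> ('o, 'o, 'm) vfun" where
  "induced_theory_functor V P M E W = \<lparr>vO = (\<lambda>x. x),
     vH = (\<lambda>x y. THE h. h \<in> hom V (Ihom V x y) (vHom E (free_alg V M x) (free_alg V M y)) \<and>
        vH W (free_alg V M x) (free_alg V M y) \<cdot> h = vH (mFun M) x y)\<rparr>"
  for V (structure)

definition isomorphic_pretheories ::
  "('o, 'm, 'z) smcat_scheme \<Rightarrow> 'o set \<Rightarrow> ('o, 'o, 'm) vcat \<Rightarrow> ('o, 'o, 'm) vfun \<Rightarrow>
   ('o, 'o, 'm) vcat \<Rightarrow> ('o, 'o, 'm) vfun \<Rightarrow> bool" where
  "isomorphic_pretheories V P T J T' J' \<longleftrightarrow>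
     (\<exists>\<phi>. is_vfunctor V T T' \<phi> \<and> (\<forall>x \<in> P. vO \<phi> x = x) \<and>
        (\<forall>x \<in> P. \<forall>y \<in> P. is_iso V (vH \<phi> x y) \<and> vH \<phi> x y \<cdot> vH J x y = vH J' x y))"
  for V (structure)

definition is_theory ::
  "('o, 'm, 'z) smcat_scheme \<Rightarrow> 'o set \<Rightarrow> ('o, 'o, 'm) vcat \<Rightarrow> ('o, 'o, 'm) vfun \<Rightarrow> bool" where
  "is_theory V P T J \<longleftrightarrow> is_pretheory V P T J \<and>
     (\<exists>M E W. is_induced_monad V P T J M \<and> is_eilenberg_moore V M E W \<and>
        isomorphic_pretheories V P T J (induced_theory V P M E) (induced_theory_functor V P M E W))"

text \<open>Arrows \<open>J x \<rightarrow> J y\<close> of \<open>T\<close> are arrows \<open>Unit V \<rightarrow> T(J x, J y)\<close>. The discrete object on \<open>x\<close> is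
  determined up to isomorphism only; \<open>x0\<close> ranges over its representatives in \<open>P\<close>.\<close>

definition is_discrete ::
  "('o, 'm, 'z) smcat_scheme \<Rightarrow> 'o set \<Rightarrow> ('o, 'o, 'm) vcat \<Rightarrow> ('o, 'o, 'm) vfun \<Rightarrow> bool" where
  "is_discrete V P T J \<longleftrightarrow>
     (\<forall>x \<in> P. \<forall>x0 \<in> P. \<forall>\<iota>. is_unit_copower V (hom V (Unit V) x) x0 \<iota> \<longrightarrow>
        (\<forall>g \<in> hom V (Unit V) (vHom T (vO J (Unit V)) (vO J x)).
           \<exists>f \<in> hom V (Unit V) (vHom T (vO J (Unit V)) (vO J x0)).
             g = ucomp V T (vO J (Unit V)) (vO J x0) (vO J x)
                   (vH J x0 x \<cdot> name_arr V (discrete_counit V x x0 \<iota>)) f))"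
  for V (structure)

end

theory Submission
  imports Defs
begin

text \<open>
  The theory \<open>T\<close> is recovered from its monad \<open>M\<close> through the free algebras, so global elements of
  \<open>T(I, x)\<close> are global elements of \<open>M x\<close>, and composition with \<open>J \<delta>\<^sub>x\<close> becomes composition with
  \<open>M \<delta>\<^sub>x\<close>. Hence \<open>T\<close> is discrete iff every \<open>M \<delta>\<^sub>x\<close> with \<open>x\<close> presentable is a surjection. As \<open>\<delta>\<^sub>x\<close> is
  itself a surjection, this follows when \<open>M\<close> preserves surjections.

  Conversely, let \<open>f : a \<rightarrow> y\<close> be a surjection and \<open>e : I \<rightarrow> M y\<close>. Write \<open>y\<close> as a filtered colimit of
  presentable objects. Filtered colimits of algebras are computed in \<open>V\<close>, because the arities are
  presentable, so \<open>e\<close> factors through \<open>M x\<close> for some \<open>x \<rightarrow> y\<close> with \<open>x\<close> presentable, and then by discreteness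
  through \<open>M x\<^sub>0\<close> with \<open>x\<^sub>0\<close> a copower of the unit. The map \<open>x\<^sub>0 \<rightarrow> x \<rightarrow> y\<close> lifts through \<open>f\<close>, so \<open>e\<close> lifts
  through \<open>M f\<close>.
\<close>

section \<open>Coherence in symmetric monoidal closed categories\<close>

text \<open>All enriched structure is specified up to isomorphism, so the monad that exhibits
  \<open>T\<close> as a theory need not be the given monad \<open>M\<close>. Discreteness is
  computed with the former and preservation of surjections concerns the latter; the two are linked
  by comparing their free algebras. Both notions concern arrows out of the unit only. Enriched data
  are therefore evaluated at global elements: a global element of a hom object of algebras becomes
  an ordinary arrow commuting with uncurried actions (\<open>ahom\<close>), and the adjunction
  becomes an ordinary free construction. Naturality of the counit in its full enriched form serves
  only to factor arrows through Eilenberg-Moore hom objects, which are equalizers in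
  \<open>V\<close>. The colimit of the free algebras is not shown to be free: it is enough that
  \<open>M y\<close> is a retract of it. The assumption on the hom functor of the unit ensures that
  \<open>P\<close> contains a copower of the unit for each \<open>x\<close>; without one,
  discreteness would say nothing about \<open>x\<close>.\<close>

context category
begin

lemma hom_iff: "f \<in> hom C a b \<longleftrightarrow> f \<in> Arr C \<and> Dom C f = a \<and> Cod C f = b"
  by (simp add: hom_def)

lemma hom_objs: "f \<in> hom C a b \<Longrightarrow> a \<in> Obj C \<and> b \<in> Obj C"
  using dom_obj cod_obj by (auto simp: hom_iff)

lemma comp_simps [simp]:
  assumes "f \<in> Arr C" "g \<in> Arr C" "Dom C g = Cod C f"
  shows "g \<cdot> f \<in> Arr C" "Dom C (g \<cdot> f) = Dom C f" "Cod C (g \<cdot> f) = Cod C g"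
  using comp_hom[of f "Dom C f" "Cod C f" g "Cod C g"] assms by (auto simp: hom_iff)

lemma id_simps [simp]:
  assumes "a \<in> Obj C"
  shows "Id C a \<in> Arr C" "Dom C (Id C a) = a" "Cod C (Id C a) = a"
  using id_hom[OF assms] by (auto simp: hom_iff)

lemma comp_Id [simp]: "f \<in> Arr C \<Longrightarrow> Dom C f = a \<Longrightarrow> f \<cdot> Id C a = f"
  by (rule comp_id) (auto simp: hom_iff)

lemma Id_comp [simp]: "f \<in> Arr C \<Longrightarrow> Cod C f = a \<Longrightarrow> Id C a \<cdot> f = f"
  by (rule id_comp) (auto simp: hom_iff)

lemma assoc [simp]:
  "f \<in> Arr C \<Longrightarrow> g \<in> Arr C \<Longrightarrow> h \<in> Arr C \<Longrightarrow> Dom C g = Cod C f \<Longrightarrow> Dom C h = Cod C g \<Longrightarrow>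
    (h \<cdot> g) \<cdot> f = h \<cdot> (g \<cdot> f)"
  by (rule comp_assoc) (auto simp: hom_iff)

lemma dom_obj' [simp]: "f \<in> Arr C \<Longrightarrow> Dom C f \<in> Obj C"
  and cod_obj' [simp]: "f \<in> Arr C \<Longrightarrow> Cod C f \<in> Obj C"
  by (auto intro: dom_obj cod_obj)

lemma iso_arr: "is_iso C f \<Longrightarrow> f \<in> Arr C"
  by (auto simp: is_iso_def inverse_pair_def)

text \<open>Composites are normalised to the right by \<open>assoc\<close>, so a known equation for
  \<open>g \<cdot> f\<close> no longer matches inside a longer composite. Here it is applied at the
  head of such a composite.\<close>

lemma reassoc:
  assumes "g \<cdot> f = r" "f \<in> Arr C" "g \<in> Arr C" "Dom C g = Cod C f" "k \<in> Arr C" "Cod C k = Dom C f"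
  shows "g \<cdot> (f \<cdot> k) = r \<cdot> k"
  using assms by (simp flip: assoc)

lemma inverse_pair_unique: "inverse_pair C f g \<Longrightarrow> inverse_pair C f h \<Longrightarrow> g = h"
proof -
  assume g: "inverse_pair C f g" and h: "inverse_pair C f h"
  have "g = g \<cdot> (f \<cdot> h)" using g h by (auto simp: inverse_pair_def hom_iff)
  also have "\<dots> = (g \<cdot> f) \<cdot> h" using g h by (subst assoc) (auto simp: inverse_pair_def hom_iff)
  also have "\<dots> = h" using g h by (auto simp: inverse_pair_def hom_iff)
  finally show ?thesis .
qed

lemma inv_arr_inverse_pair: "is_iso C f \<Longrightarrow> inverse_pair C f (inv_arr C f)"
  unfolding is_iso_def inv_arr_def by (metis inverse_pair_unique theI)

lemma iso_simps [simp]: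
  assumes "is_iso C f"
  shows "inv_arr C f \<in> Arr C" "Dom C (inv_arr C f) = Cod C f" "Cod C (inv_arr C f) = Dom C f"
    "inv_arr C f \<cdot> f = Id C (Dom C f)" "f \<cdot> inv_arr C f = Id C (Cod C f)"
  using inv_arr_inverse_pair[OF assms] by (auto simp: inverse_pair_def hom_iff)

lemma iso_reassoc [simp]:
  assumes "is_iso C f" "k \<in> Arr C"
  shows "Cod C k = Dom C f \<Longrightarrow> inv_arr C f \<cdot> (f \<cdot> k) = k"
    "Cod C k = Cod C f \<Longrightarrow> f \<cdot> (inv_arr C f \<cdot> k) = k"
  using assms by (simp_all add: iso_arr reassoc[of _ _ "Id C _"])

lemma iso_monic:
  assumes "is_iso C f" "f \<cdot> g = f \<cdot> h" "g \<in> Arr C" "h \<in> Arr C" "Cod C g = Dom C f" "Cod C h = Dom C f"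
  shows "g = h"
  using arg_cong[OF assms(2), of "\<lambda>k. inv_arr C f \<cdot> k"] assms(1,3-) by (simp add: iso_arr)

lemma iso_epic:
  assumes "is_iso C f" "g \<cdot> f = h \<cdot> f" "g \<in> Arr C" "h \<in> Arr C" "Dom C g = Cod C f" "Dom C h = Cod C f"
  shows "g = h"
  using arg_cong[OF assms(2), of "\<lambda>k. k \<cdot> inv_arr C f"] assms(1,3-) by (simp add: iso_arr)

lemma is_isoI:
  assumes "f \<in> hom C a b" "g \<in> hom C b a" "g \<cdot> f = Id C a" "f \<cdot> g = Id C b"
  shows "is_iso C f"
  using assms unfolding is_iso_def inverse_pair_def by (auto simp: hom_iff)

lemma iso_comp:
  assumes "is_iso C f" "is_iso C g" "Dom C g = Cod C f"
  shows "is_iso C (g \<cdot> f)"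
  by (rule is_isoI[of _ "Dom C f" "Cod C g" "inv_arr C f \<cdot> inv_arr C g"]) (use assms in \<open>auto simp: hom_iff iso_arr\<close>)

end

section \<open>Unit coherence, currying, and internal composition at global elements\<close>

context symmetric_monoidal_closed
begin

abbreviation "\<I> \<equiv> Unit V"
abbreviation "\<alpha> \<equiv> Assoc V"
abbreviation "\<ll> \<equiv> Lunit V"
abbreviation "\<rr> \<equiv> Runit V"
abbreviation "\<ss> \<equiv> Symm V"
abbreviation "\<ee> \<equiv> Id V"
abbreviation "ev \<equiv> Ev V"
abbreviation "ihom \<equiv> Ihom V"
abbreviation "inva \<equiv> inv_arr V"

lemmas [simp] = ten_obj ten_id unit_obj ihom_obj assoc_iso lunit_iso runit_iso

lemma structure_simps [simp]:
  "x \<in> Obj V \<Longrightarrow> y \<in> Obj V \<Longrightarrow> z \<in> Obj V \<Longrightarrow> \<alpha> x y z \<in> Arr V"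
  "x \<in> Obj V \<Longrightarrow> y \<in> Obj V \<Longrightarrow> z \<in> Obj V \<Longrightarrow> Dom V (\<alpha> x y z) = (x \<otimes> y) \<otimes> z"
  "x \<in> Obj V \<Longrightarrow> y \<in> Obj V \<Longrightarrow> z \<in> Obj V \<Longrightarrow> Cod V (\<alpha> x y z) = x \<otimes> (y \<otimes> z)"
  "x \<in> Obj V \<Longrightarrow> \<ll> x \<in> Arr V" "x \<in> Obj V \<Longrightarrow> Dom V (\<ll> x) = \<I> \<otimes> x" "x \<in> Obj V \<Longrightarrow> Cod V (\<ll> x) = x"
  "x \<in> Obj V \<Longrightarrow> \<rr> x \<in> Arr V" "x \<in> Obj V \<Longrightarrow> Dom V (\<rr> x) = x \<otimes> \<I>" "x \<in> Obj V \<Longrightarrow> Cod V (\<rr> x) = x"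
  "x \<in> Obj V \<Longrightarrow> y \<in> Obj V \<Longrightarrow> \<ss> x y \<in> Arr V"
  "x \<in> Obj V \<Longrightarrow> y \<in> Obj V \<Longrightarrow> Dom V (\<ss> x y) = x \<otimes> y"
  "x \<in> Obj V \<Longrightarrow> y \<in> Obj V \<Longrightarrow> Cod V (\<ss> x y) = y \<otimes> x"
  "x \<in> Obj V \<Longrightarrow> y \<in> Obj V \<Longrightarrow> ev x y \<in> Arr V"
  "x \<in> Obj V \<Longrightarrow> y \<in> Obj V \<Longrightarrow> Dom V (ev x y) = ihom x y \<otimes> x"
  "x \<in> Obj V \<Longrightarrow> y \<in> Obj V \<Longrightarrow> Cod V (ev x y) = y"
  using assoc_hom[of x y z] lunit_hom[of x] runit_hom[of x] symm_hom[of x y] ev_hom[of x y] by (auto simp: hom_iff)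

lemma ten_simps [simp]:
  assumes "f \<in> Arr V" "g \<in> Arr V"
  shows "f \<odot> g \<in> Arr V" "Dom V (f \<odot> g) = Dom V f \<otimes> Dom V g" "Cod V (f \<odot> g) = Cod V f \<otimes> Cod V g"
  using ten_hom[of f "Dom V f" "Cod V f" g "Dom V g" "Cod V g"] assms by (auto simp: hom_iff)

lemma ten_fuse [simp]:
  assumes "f \<in> Arr V" "f' \<in> Arr V" "g \<in> Arr V" "g' \<in> Arr V" "Dom V f' = Cod V f" "Dom V g' = Cod V g"
  shows "(f' \<odot> g') \<cdot> (f \<odot> g) = (f' \<cdot> f) \<odot> (g' \<cdot> g)"
  using assms by (intro ten_comp[symmetric]) (auto simp: hom_iff)

lemma ten_fuse_reassoc [simp]:
  assumes "f \<in> Arr V" "f' \<in> Arr V" "g \<in> Arr V" "g' \<in> Arr V" "Dom V f' = Cod V f" "Dom V g' = Cod V g"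
    "k \<in> Arr V" "Cod V k = Dom V f \<otimes> Dom V g"
  shows "(f' \<odot> g') \<cdot> ((f \<odot> g) \<cdot> k) = ((f' \<cdot> f) \<odot> (g' \<cdot> g)) \<cdot> k"
  using assms by (intro reassoc) auto

lemma id_iso [simp]: "x \<in> Obj V \<Longrightarrow> is_iso V (\<ee> x)"
  by (rule is_isoI[of "\<ee> x" x x "\<ee> x"]) (simp_all add: hom_iff)

lemma ten_iso [simp]:
  assumes "is_iso V f" "is_iso V g" shows "is_iso V (f \<odot> g)"
  by (rule is_isoI[of _ "Dom V f \<otimes> Dom V g" "Cod V f \<otimes> Cod V g" "inva f \<odot> inva g"])
    (use assms in \<open>auto simp: hom_iff iso_arr\<close>)

lemma symm_iso [simp]:
  assumes "x \<in> Obj V" "y \<in> Obj V" shows "is_iso V (\<ss> x y)"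
  by (rule is_isoI[of _ "x \<otimes> y" "y \<otimes> x" "\<ss> y x"]) (use assms symm_symm in \<open>auto simp: hom_iff\<close>)

lemma nat_assoc:
  "f \<in> Arr V \<Longrightarrow> g \<in> Arr V \<Longrightarrow> h \<in> Arr V \<Longrightarrow> x = Cod V f \<Longrightarrow> y = Cod V g \<Longrightarrow> z = Cod V h \<Longrightarrow>
    \<alpha> x y z \<cdot> ((f \<odot> g) \<odot> h) = (f \<odot> (g \<odot> h)) \<cdot> \<alpha> (Dom V f) (Dom V g) (Dom V h)"
  using assoc_nat[of f _ _ g _ _ h] by (auto simp: hom_iff)

lemma nat_lunit:
  "f \<in> Arr V \<Longrightarrow> x = Cod V f \<Longrightarrow> \<ll> x \<cdot> (\<ee> \<I> \<odot> f) = f \<cdot> \<ll> (Dom V f)"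
  using lunit_nat[of f] by (auto simp: hom_iff)

lemma nat_runit:
  "f \<in> Arr V \<Longrightarrow> x = Cod V f \<Longrightarrow> \<rr> x \<cdot> (f \<odot> \<ee> \<I>) = f \<cdot> \<rr> (Dom V f)"
  using runit_nat[of f] by (auto simp: hom_iff)

lemma nat_symm:
  "f \<in> Arr V \<Longrightarrow> g \<in> Arr V \<Longrightarrow> x = Cod V f \<Longrightarrow> y = Cod V g \<Longrightarrow>
    \<ss> x y \<cdot> (f \<odot> g) = (g \<odot> f) \<cdot> \<ss> (Dom V f) (Dom V g)"
  using symm_nat[of f _ _ g] by (auto simp: hom_iff)

text \<open>Naturality of the invertible left unitor recovers an arrow from its tensor with the
  unit. Coherence equations may hence be checked after tensoring with the unit, where the pentagon
  and the triangle apply.\<close>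

lemma unit_ten_faithful:
  assumes "\<ee> \<I> \<odot> f = \<ee> \<I> \<odot> g" "f \<in> Arr V" "g \<in> Arr V" "Dom V f = Dom V g" "Cod V f = Cod V g"
  shows "f = g"
proof (rule iso_epic[of "\<ll> (Dom V f)"])
  show "f \<cdot> \<ll> (Dom V f) = g \<cdot> \<ll> (Dom V f)"
    using assms nat_lunit[of f "Cod V f"] nat_lunit[of g "Cod V g"] by auto
qed (use assms in auto)

lemma ten_unit_faithful:
  assumes "f \<odot> \<ee> \<I> = g \<odot> \<ee> \<I>" "f \<in> Arr V" "g \<in> Arr V" "Dom V f = Dom V g" "Cod V f = Cod V g"
  shows "f = g"
proof (rule iso_epic[of "\<rr> (Dom V f)"])
  show "f \<cdot> \<rr> (Dom V f) = g \<cdot> \<rr> (Dom V f)"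
    using assms nat_runit[of f "Cod V f"] nat_runit[of g "Cod V g"] by auto
qed (use assms in auto)

text \<open>Kelly's derivation of this unit law from the axioms: after tensoring with the unit,
  compare the two sides of the pentagon at \<open>I, I, x, y\<close> and remove the inner unit by
  the triangle.\<close>

lemma lunit_ten:
  assumes [simp]: "x \<in> Obj V" "y \<in> Obj V"
  shows "\<ll> (x \<otimes> y) \<cdot> \<alpha> \<I> x y = \<ll> x \<odot> \<ee> y"
proof (rule unit_ten_faithful)
  let ?k = "\<alpha> \<I> (\<I> \<otimes> x) y \<cdot> (\<alpha> \<I> \<I> x \<odot> \<ee> y)"
  show "\<ee> \<I> \<odot> (\<ll> (x \<otimes> y) \<cdot> \<alpha> \<I> x y) = \<ee> \<I> \<odot> (\<ll> x \<odot> \<ee> y)"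
  proof (rule iso_epic[of ?k])
    have "(\<ee> \<I> \<odot> (\<ll> (x \<otimes> y) \<cdot> \<alpha> \<I> x y)) \<cdot> ?k
        = (\<ee> \<I> \<odot> \<ll> (x \<otimes> y)) \<cdot> ((\<ee> \<I> \<odot> \<alpha> \<I> x y) \<cdot> ?k)"
      by simp
    also have "\<dots> = (\<ee> \<I> \<odot> \<ll> (x \<otimes> y)) \<cdot> (\<alpha> \<I> \<I> (x \<otimes> y) \<cdot> \<alpha> (\<I> \<otimes> \<I>) x y)"
      by (simp add: pentagon del: ten_fuse_reassoc)
    also have "\<dots> = (\<rr> \<I> \<odot> \<ee> (x \<otimes> y)) \<cdot> \<alpha> (\<I> \<otimes> \<I>) x y"
      by (rule reassoc) (simp_all add: triangle)
    also have "\<dots> = \<alpha> \<I> x y \<cdot> ((\<rr> \<I> \<odot> \<ee> x) \<odot> \<ee> y)"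
      by (subst nat_assoc) simp_all
    also have "\<dots> = \<alpha> \<I> x y \<cdot> (((\<ee> \<I> \<odot> \<ll> x) \<odot> \<ee> y) \<cdot> (\<alpha> \<I> \<I> x \<odot> \<ee> y))"
      by (simp add: triangle)
    also have "\<dots> = ((\<ee> \<I> \<odot> (\<ll> x \<odot> \<ee> y)) \<cdot> \<alpha> \<I> (\<I> \<otimes> x) y) \<cdot> (\<alpha> \<I> \<I> x \<odot> \<ee> y)"
      by (rule reassoc) (simp_all add: nat_assoc)
    also have "\<dots> = (\<ee> \<I> \<odot> (\<ll> x \<odot> \<ee> y)) \<cdot> ?k" by simp
    finally show "(\<ee> \<I> \<odot> (\<ll> (x \<otimes> y) \<cdot> \<alpha> \<I> x y)) \<cdot> ?k = (\<ee> \<I> \<odot> (\<ll> x \<odot> \<ee> y)) \<cdot> ?k" .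
    show "is_iso V ?k" by (rule iso_comp) simp_all
  qed simp_all
qed simp_all

text \<open>Naturality of the left unitor at itself gives
  \<open>\<ll> (I \<otimes> I) = I \<otimes> \<ll> I\<close>. Then \<open>lunit_ten\<close> and the
  triangle show that both sides have the same tensor with the unit.\<close>

lemma lunit_unit: "\<ll> \<I> = \<rr> \<I>"
proof (rule ten_unit_faithful)
  have "\<ll> (\<I> \<otimes> \<I>) = \<ee> \<I> \<odot> \<ll> \<I>"
    by (rule iso_monic[of "\<ll> \<I>"]) (simp_all add: nat_lunit)
  then show "\<ll> \<I> \<odot> \<ee> \<I> = \<rr> \<I> \<odot> \<ee> \<I>"
    by (simp add: lunit_ten[symmetric] triangle)
qed simp_all

text \<open>The hexagon with two unit arguments, read after tensoring with the unit and composing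
  with the invertible symmetry; \<open>lunit_ten\<close> and naturality absorb the
  associators.\<close>

lemma lunit_symm:
  assumes [simp]: "x \<in> Obj V" shows "\<ll> x \<cdot> \<ss> x \<I> = \<rr> x"
proof (rule ten_unit_faithful)
  show "(\<ll> x \<cdot> \<ss> x \<I>) \<odot> \<ee> \<I> = \<rr> x \<odot> \<ee> \<I>"
  proof (rule iso_monic[of "\<ss> x \<I>"])
    have "\<ss> x \<I> \<cdot> (\<rr> x \<odot> \<ee> \<I>) = \<ss> x \<I> \<cdot> ((\<ee> x \<odot> \<ll> \<I>) \<cdot> \<alpha> x \<I> \<I>)"
      by (simp add: triangle)
    also have "\<dots> = ((\<ll> \<I> \<odot> \<ee> x) \<cdot> \<ss> x (\<I> \<otimes> \<I>)) \<cdot> \<alpha> x \<I> \<I>"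
      by (rule reassoc) (simp_all add: nat_symm)
    also have "\<dots> = (\<ll> (\<I> \<otimes> x) \<cdot> \<alpha> \<I> \<I> x) \<cdot> (\<ss> x (\<I> \<otimes> \<I>) \<cdot> \<alpha> x \<I> \<I>)"
      by (subst lunit_ten) simp_all
    also have "\<dots> = \<ll> (\<I> \<otimes> x) \<cdot> ((\<ee> \<I> \<odot> \<ss> x \<I>) \<cdot> \<alpha> \<I> x \<I> \<cdot> (\<ss> x \<I> \<odot> \<ee> \<I>))"
      by (simp add: hexagon)
    also have "\<dots> = (\<ss> x \<I> \<cdot> \<ll> (x \<otimes> \<I>)) \<cdot> (\<alpha> \<I> x \<I> \<cdot> (\<ss> x \<I> \<odot> \<ee> \<I>))"
      by (rule reassoc) (simp_all add: nat_lunit)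
    also have "\<dots> = \<ss> x \<I> \<cdot> ((\<ll> (x \<otimes> \<I>) \<cdot> \<alpha> \<I> x \<I>) \<cdot> (\<ss> x \<I> \<odot> \<ee> \<I>))" by simp
    also have "\<dots> = \<ss> x \<I> \<cdot> ((\<ll> x \<cdot> \<ss> x \<I>) \<odot> \<ee> \<I>)"
      by (subst lunit_ten) simp_all
    finally show "\<ss> x \<I> \<cdot> ((\<ll> x \<cdot> \<ss> x \<I>) \<odot> \<ee> \<I>) = \<ss> x \<I> \<cdot> (\<rr> x \<odot> \<ee> \<I>)" by (rule sym)
  qed simp_all
qed simp_all

lemma runit_symm:
  assumes [simp]: "x \<in> Obj V" shows "\<rr> x \<cdot> \<ss> \<I> x = \<ll> x"
  by (simp add: lunit_symm[symmetric] symm_symm)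

lemma curry_simps [simp]:
  assumes "x \<in> Obj V" "y \<in> Obj V" "z \<in> Obj V" "f \<in> Arr V" "Dom V f = z \<otimes> x" "Cod V f = y"
  shows "curry_arr V z x y f \<in> Arr V" "Dom V (curry_arr V z x y f) = z"
    "Cod V (curry_arr V z x y f) = ihom x y"
    "ev x y \<cdot> (curry_arr V z x y f \<odot> \<ee> x) = f"
  using theI'[OF closed[OF assms(1-3), of f]] assms unfolding curry_arr_def by (auto simp: hom_iff)

lemma ihom_eqI:
  assumes "ev x y \<cdot> (g \<odot> \<ee> x) = ev x y \<cdot> (h \<odot> \<ee> x)" "g \<in> Arr V" "h \<in> Arr V" "Dom V g = Dom V h"
    "Cod V g = ihom x y" "Cod V h = ihom x y" "x \<in> Obj V" "y \<in> Obj V"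
  shows "g = h"
proof -
  have "ev x y \<cdot> (g \<odot> \<ee> x) \<in> hom V (Dom V g \<otimes> x) y"
    using assms by (auto simp: hom_iff)
  from closed[OF assms(7,8) _ this] show ?thesis
    using assms by (auto simp: hom_iff)
qed

lemma ev_curry [simp]:
  assumes "x \<in> Obj V" "y \<in> Obj V" "z \<in> Obj V" "f \<in> Arr V" "Dom V f = z \<otimes> x" "Cod V f = y"
    "h \<in> Arr V" "Cod V h = x"
  shows "ev x y \<cdot> (curry_arr V z x y f \<odot> h) = f \<cdot> (\<ee> z \<odot> h)"
    "k \<in> Arr V \<Longrightarrow> Cod V k = z \<Longrightarrow> ev x y \<cdot> ((curry_arr V z x y f \<cdot> k) \<odot> h) = f \<cdot> (k \<odot> h)"
proof -
  have *: "ev x y \<cdot> ((curry_arr V z x y f \<cdot> k) \<odot> h) = f \<cdot> (k \<odot> h)" if "k \<in> Arr V" "Cod V k = z" for k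
  proof -
    have "ev x y \<cdot> ((curry_arr V z x y f \<cdot> k) \<odot> h) = ev x y \<cdot> ((curry_arr V z x y f \<odot> \<ee> x) \<cdot> (k \<odot> h))"
      using assms that by simp
    also have "\<dots> = f \<cdot> (k \<odot> h)"
      by (rule reassoc) (use assms that in \<open>simp_all del: ten_fuse\<close>)
    finally show ?thesis .
  qed
  show "ev x y \<cdot> (curry_arr V z x y f \<odot> h) = f \<cdot> (\<ee> z \<odot> h)"
    using *[of "\<ee> z"] assms by simp
  show "k \<in> Arr V \<Longrightarrow> Cod V k = z \<Longrightarrow> ev x y \<cdot> ((curry_arr V z x y f \<cdot> k) \<odot> h) = f \<cdot> (k \<odot> h)"
    by (rule *)
qed

lemma ev_curry_reassoc [simp]:
  assumes "x \<in> Obj V" "y \<in> Obj V" "z \<in> Obj V" "f \<in> Arr V" "Dom V f = z \<otimes> x" "Cod V f = y"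
    "h \<in> Arr V" "Cod V h = x"
  shows "l \<in> Arr V \<Longrightarrow> Cod V l = z \<otimes> Dom V h \<Longrightarrow>
      ev x y \<cdot> ((curry_arr V z x y f \<odot> h) \<cdot> l) = f \<cdot> ((\<ee> z \<odot> h) \<cdot> l)"
    "k \<in> Arr V \<Longrightarrow> Cod V k = z \<Longrightarrow> l \<in> Arr V \<Longrightarrow> Cod V l = Dom V k \<otimes> Dom V h \<Longrightarrow>
      ev x y \<cdot> ((curry_arr V z x y f \<cdot> k) \<odot> h) \<cdot> l = f \<cdot> ((k \<odot> h) \<cdot> l)"
  using assms by (simp_all add: reassoc[OF ev_curry(1)] reassoc[OF ev_curry(2)])

lemma curry_comp:
  assumes "x \<in> Obj V" "y \<in> Obj V" "z \<in> Obj V" "f \<in> Arr V" "Dom V f = z \<otimes> x" "Cod V f = y"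
    "k \<in> Arr V" "Cod V k = z"
  shows "curry_arr V z x y f \<cdot> k = curry_arr V (Dom V k) x y (f \<cdot> (k \<odot> \<ee> x))"
  by (rule ihom_eqI[of x y]) (use assms in simp_all)

lemma curry_inject:
  assumes "curry_arr V z x y f = curry_arr V z x y g"
    "x \<in> Obj V" "y \<in> Obj V" "z \<in> Obj V" "f \<in> Arr V" "Dom V f = z \<otimes> x" "Cod V f = y"
    "g \<in> Arr V" "Dom V g = z \<otimes> x" "Cod V g = y"
  shows "f = g"
  by (metis assms curry_simps(4))

lemma unname_simps [simp]:
  assumes "g \<in> Arr V" "Dom V g = \<I>" "Cod V g = ihom x y" "x \<in> Obj V" "y \<in> Obj V"
  shows "unname_arr V x y g \<in> Arr V" "Dom V (unname_arr V x y g) = x" "Cod V (unname_arr V x y g) = y"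
  using assms by (simp_all add: unname_arr_def)

lemma name_simps [simp]:
  assumes "f \<in> Arr V"
  shows "name_arr V f \<in> Arr V" "Dom V (name_arr V f) = \<I>" "Cod V (name_arr V f) = ihom (Dom V f) (Cod V f)"
  using assms by (simp_all add: name_arr_def)

lemma ev_unname:
  assumes "g \<in> Arr V" "Dom V g = \<I>" "Cod V g = ihom x y" "x \<in> Obj V" "y \<in> Obj V"
  shows "ev x y \<cdot> (g \<odot> \<ee> x) = unname_arr V x y g \<cdot> \<ll> x"
  using assms by (simp add: unname_arr_def)

lemma unname_name [simp]:
  assumes "f \<in> Arr V" "Dom V f = x" "Cod V f = y"
  shows "unname_arr V x y (name_arr V f) = f"
  using assms by (auto simp: unname_arr_def name_arr_def)

lemma name_unname [simp]:
  assumes "g \<in> Arr V" "Dom V g = \<I>" "Cod V g = ihom x y" "x \<in> Obj V" "y \<in> Obj V"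
  shows "name_arr V (unname_arr V x y g) = g"
  by (rule ihom_eqI[of x y]) (use assms in \<open>simp_all add: ev_unname\<close>)

lemma unname_inject:
  assumes "unname_arr V x y g = unname_arr V x y h" "g \<in> hom V \<I> (ihom x y)" "h \<in> hom V \<I> (ihom x y)"
    "x \<in> Obj V" "y \<in> Obj V"
  shows "g = h"
  using arg_cong[OF assms(1), of "name_arr V"] assms(2-) by (simp add: hom_iff)

abbreviation "icomp \<equiv> vComp (vself V)"

lemma vself_simps [simp]:
  "vObj (vself V) = Obj V" "vHom (vself V) = Ihom V"
  "vId (vself V) x = curry_arr V \<I> x x (\<ll> x)"
  by (simp_all add: vself_def)

lemma icomp_simps [simp]:
  assumes "x \<in> Obj V" "y \<in> Obj V" "z \<in> Obj V"
  shows "icomp x y z \<in> Arr V" "Dom V (icomp x y z) = ihom y z \<otimes> ihom x y" "Cod V (icomp x y z) = ihom x z"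
  using assms by (simp_all add: vself_def)

text \<open>The defining equation of internal composition, with \<open>k\<close> and
  \<open>h\<close> precomposed so that it rewrites inside longer composites.\<close>

lemma ev_icomp:
  assumes "x \<in> Obj V" "y \<in> Obj V" "z \<in> Obj V" "k \<in> Arr V" "Cod V k = ihom y z \<otimes> ihom x y"
    "h \<in> Arr V" "Cod V h = x"
  shows "ev x z \<cdot> ((icomp x y z \<cdot> k) \<odot> h)
    = ev y z \<cdot> ((\<ee> (ihom y z) \<odot> ev x y) \<cdot> (\<alpha> (ihom y z) (ihom x y) x \<cdot> (k \<odot> h)))"
  using assms by (simp add: vself_def)

lemma ev_icomp_ten:
  assumes "x \<in> Obj V" "y \<in> Obj V" "z \<in> Obj V" "p \<in> Arr V" "Cod V p = ihom y z"
    "q \<in> Arr V" "Cod V q = ihom x y" "h \<in> Arr V" "Cod V h = x"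
  shows "ev x z \<cdot> ((icomp x y z \<cdot> (p \<odot> q)) \<odot> h)
    = ev y z \<cdot> ((p \<odot> (ev x y \<cdot> (q \<odot> h))) \<cdot> \<alpha> (Dom V p) (Dom V q) (Dom V h))"
  using assms by (simp add: ev_icomp nat_assoc)

text \<open>A global element of \<open>[b,c]\<close> names an ordinary arrow, so internal
  composition with it is postcomposition once a unitor has removed the unit factor. This and the
  mirror image \<open>icomp_right_name\<close> turn enriched equations at global elements into
  equations between arrows of \<open>V\<close>.\<close>

lemma icomp_left_name:
  assumes [simp]: "a \<in> Obj V" "b \<in> Obj V" "c \<in> Obj V" "p \<in> Arr V" "Dom V p = \<I>" "Cod V p = ihom b c"
    "h \<in> Arr V" "Cod V h = ihom a b"
  shows "icomp a b c \<cdot> (p \<odot> h)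
    = curry_arr V (Dom V h) a c (unname_arr V b c p \<cdot> (ev a b \<cdot> (h \<odot> \<ee> a))) \<cdot> \<ll> (Dom V h)"
proof (rule ihom_eqI[of a c])
  let ?u = "ev a b \<cdot> (h \<odot> \<ee> a)"
  have "ev a c \<cdot> ((icomp a b c \<cdot> (p \<odot> h)) \<odot> \<ee> a) = ev b c \<cdot> ((p \<odot> \<ee> b) \<cdot> (\<ee> \<I> \<odot> ?u) \<cdot> \<alpha> \<I> (Dom V h) a)"
    by (simp add: ev_icomp_ten)
  also have "\<dots> = (unname_arr V b c p \<cdot> \<ll> b) \<cdot> ((\<ee> \<I> \<odot> ?u) \<cdot> \<alpha> \<I> (Dom V h) a)"
    by (rule reassoc) (simp_all add: ev_unname)
  also have "\<dots> = unname_arr V b c p \<cdot> (\<ll> b \<cdot> (\<ee> \<I> \<odot> ?u) \<cdot> \<alpha> \<I> (Dom V h) a)"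
    by simp
  also have "\<ll> b \<cdot> (\<ee> \<I> \<odot> ?u) \<cdot> \<alpha> \<I> (Dom V h) a = (?u \<cdot> \<ll> (Dom V h \<otimes> a)) \<cdot> \<alpha> \<I> (Dom V h) a"
    by (rule reassoc) (simp_all add: nat_lunit)
  also have "\<dots> = ?u \<cdot> (\<ll> (Dom V h) \<odot> \<ee> a)"
    by (simp add: lunit_ten)
  finally show "ev a c \<cdot> ((icomp a b c \<cdot> (p \<odot> h)) \<odot> \<ee> a) =
    ev a c \<cdot> ((curry_arr V (Dom V h) a c (unname_arr V b c p \<cdot> ?u) \<cdot> \<ll> (Dom V h)) \<odot> \<ee> a)"
    by simp
qed simp_all

lemma icomp_right_name:
  assumes [simp]: "a \<in> Obj V" "b \<in> Obj V" "c \<in> Obj V" "p \<in> Arr V" "Dom V p = \<I>" "Cod V p = ihom a b"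
    "h \<in> Arr V" "Cod V h = ihom b c"
  shows "icomp a b c \<cdot> (h \<odot> p)
    = curry_arr V (Dom V h) a c (ev b c \<cdot> (h \<odot> unname_arr V a b p)) \<cdot> \<rr> (Dom V h)"
proof (rule ihom_eqI[of a c])
  have "ev a c \<cdot> ((icomp a b c \<cdot> (h \<odot> p)) \<odot> \<ee> a)
      = ev b c \<cdot> ((h \<odot> unname_arr V a b p) \<cdot> (\<ee> (Dom V h) \<odot> \<ll> a) \<cdot> \<alpha> (Dom V h) \<I> a)"
    by (simp add: ev_icomp_ten ev_unname)
  also have "\<dots> = ev b c \<cdot> (h \<odot> unname_arr V a b p) \<cdot> (\<rr> (Dom V h) \<odot> \<ee> a)"
    by (simp only: triangle \<open>a \<in> Obj V\<close> dom_obj[OF \<open>h \<in> Arr V\<close>])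
  finally show "ev a c \<cdot> ((icomp a b c \<cdot> (h \<odot> p)) \<odot> \<ee> a) =
    ev a c \<cdot> ((curry_arr V (Dom V h) a c (ev b c \<cdot> (h \<odot> unname_arr V a b p)) \<cdot> \<rr> (Dom V h)) \<odot> \<ee> a)"
    by simp
qed simp_all

text \<open>The underlying category of \<open>V\<close>, enriched over itself, is \<open>V\<close>
  again.\<close>

lemma unname_ucomp:
  assumes [simp]: "a \<in> Obj V" "b \<in> Obj V" "c \<in> Obj V" "p \<in> Arr V" "Dom V p = \<I>" "Cod V p = ihom b c"
    "h \<in> Arr V" "Dom V h = \<I>" "Cod V h = ihom a b"
  shows "unname_arr V a c (ucomp V (vself V) a b c p h) = unname_arr V b c p \<cdot> unname_arr V a b h"
proof -
  have "ucomp V (vself V) a b c p h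
      = (curry_arr V \<I> a c (unname_arr V b c p \<cdot> unname_arr V a b h \<cdot> \<ll> a) \<cdot> \<ll> \<I>) \<cdot> inva (\<ll> \<I>)"
    unfolding ucomp_def by (subst assoc[symmetric]) (simp_all add: icomp_left_name ev_unname)
  also have "\<dots> = curry_arr V \<I> a c (unname_arr V b c p \<cdot> unname_arr V a b h \<cdot> \<ll> a)"
    by simp
  finally show ?thesis
    by (simp add: unname_arr_def[of V a c])
qed

lemma unname_vId [simp]: "x \<in> Obj V \<Longrightarrow> unname_arr V x x (vId (vself V) x) = \<ee> x"
  by (simp add: unname_arr_def)

section \<open>Enriched functors and transformations evaluated at global elements\<close>

lemma vcatD:
  assumes "is_vcat V C"
  shows "a \<in> vObj C \<Longrightarrow> b \<in> vObj C \<Longrightarrow> vHom C a b \<in> Obj V"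
    "a \<in> vObj C \<Longrightarrow> vId C a \<in> Arr V" "a \<in> vObj C \<Longrightarrow> Dom V (vId C a) = \<I>"
    "a \<in> vObj C \<Longrightarrow> Cod V (vId C a) = vHom C a a"
    "a \<in> vObj C \<Longrightarrow> b \<in> vObj C \<Longrightarrow> c \<in> vObj C \<Longrightarrow> vComp C a b c \<in> Arr V"
    "a \<in> vObj C \<Longrightarrow> b \<in> vObj C \<Longrightarrow> c \<in> vObj C \<Longrightarrow> Dom V (vComp C a b c) = vHom C b c \<otimes> vHom C a b"
    "a \<in> vObj C \<Longrightarrow> b \<in> vObj C \<Longrightarrow> c \<in> vObj C \<Longrightarrow> Cod V (vComp C a b c) = vHom C a c"
  using assms unfolding is_vcat_def by (auto simp: hom_iff)

lemma vcat_unit: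
  assumes "is_vcat V C" "a \<in> vObj C" "b \<in> vObj C"
  shows "vComp C a a b \<cdot> (\<ee> (vHom C a b) \<odot> vId C a) = \<rr> (vHom C a b)"
    "vComp C a b b \<cdot> (vId C b \<odot> \<ee> (vHom C a b)) = \<ll> (vHom C a b)"
  using assms unfolding is_vcat_def by auto

lemma vfunctorD:
  assumes "is_vfunctor V C D S"
  shows "a \<in> vObj C \<Longrightarrow> vO S a \<in> vObj D" 
    "a \<in> vObj C \<Longrightarrow> b \<in> vObj C \<Longrightarrow> vH S a b \<in> Arr V"
    "a \<in> vObj C \<Longrightarrow> b \<in> vObj C \<Longrightarrow> Dom V (vH S a b) = vHom C a b"
    "a \<in> vObj C \<Longrightarrow> b \<in> vObj C \<Longrightarrow> Cod V (vH S a b) = vHom D (vO S a) (vO S b)"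
  using assms unfolding is_vfunctor_def by (auto simp: hom_iff)

lemma vfunctor_id: "is_vfunctor V C D S \<Longrightarrow> a \<in> vObj C \<Longrightarrow> vH S a a \<cdot> vId C a = vId D (vO S a)"
  unfolding is_vfunctor_def by auto

lemma vfunctor_comp:
  "is_vfunctor V C D S \<Longrightarrow> a \<in> vObj C \<Longrightarrow> b \<in> vObj C \<Longrightarrow> c \<in> vObj C \<Longrightarrow>
    vH S a c \<cdot> vComp C a b c = vComp D (vO S a) (vO S b) (vO S c) \<cdot> (vH S b c \<odot> vH S a b)"
  unfolding is_vfunctor_def by auto

lemma ucomp_hom:
  assumes "is_vcat V C" "a \<in> vObj C" "b \<in> vObj C" "c \<in> vObj C"
    "g \<in> hom V \<I> (vHom C b c)" "f \<in> hom V \<I> (vHom C a b)"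
  shows "ucomp V C a b c g f \<in> hom V \<I> (vHom C a c)"
  using assms by (simp add: ucomp_def hom_iff vcatD)

text \<open>The typing of the composition of \<open>D\<close> is assumed at the three objects
  concerned, rather than \<open>D\<close> being a \<open>V\<close>-category, so that
  \<open>induced_theory\<close> can be taken as the target directly.\<close>

lemma vfunctor_ucomp:
  assumes "is_vcat V C" "is_vfunctor V C D S" "a \<in> vObj C" "b \<in> vObj C" "c \<in> vObj C"
    "g \<in> hom V \<I> (vHom C b c)" "f \<in> hom V \<I> (vHom C a b)"
    "vComp D (vO S a) (vO S b) (vO S c) \<in> Arr V"
    "Dom V (vComp D (vO S a) (vO S b) (vO S c)) = vHom D (vO S b) (vO S c) \<otimes> vHom D (vO S a) (vO S b)"
  shows "vH S a c \<cdot> ucomp V C a b c g f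
    = ucomp V D (vO S a) (vO S b) (vO S c) (vH S b c \<cdot> g) (vH S a b \<cdot> f)"
proof -
  note [simp] = vcatD[OF assms(1)] vfunctorD[OF assms(2)] assms(3-5,8,9)
  have [simp]: "g \<in> Arr V" "Dom V g = \<I>" "Cod V g = vHom C b c"
    "f \<in> Arr V" "Dom V f = \<I>" "Cod V f = vHom C a b" using assms by (auto simp: hom_iff)
  have "vH S a c \<cdot> ucomp V C a b c g f = (vH S a c \<cdot> vComp C a b c) \<cdot> (g \<odot> f) \<cdot> inva (\<ll> \<I>)"
    unfolding ucomp_def by simp
  then show ?thesis
    by (simp add: ucomp_def vfunctor_comp[OF assms(2)])
qed

lemma vfunctor_ucomp_self:
  assumes "is_vcat V C" "is_vfunctor V C (vself V) S" "a \<in> vObj C" "b \<in> vObj C" "c \<in> vObj C"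
    "g \<in> hom V \<I> (vHom C b c)" "f \<in> hom V \<I> (vHom C a b)"
  shows "unname_arr V (vO S a) (vO S c) (vH S a c \<cdot> ucomp V C a b c g f)
    = unname_arr V (vO S b) (vO S c) (vH S b c \<cdot> g) \<cdot> unname_arr V (vO S a) (vO S b) (vH S a b \<cdot> f)"
proof -
  note [simp] = vcatD[OF assms(1)] vfunctorD[OF assms(2)] vfunctorD(1)[OF assms(2), simplified] assms(3-5)
  show ?thesis
    using assms(6,7) by (subst vfunctor_ucomp[OF assms]) (simp_all add: unname_ucomp hom_iff)
qed

lemma symm_unit_unit: "\<ss> \<I> \<I> = \<ee> (\<I> \<otimes> \<I>)"
  by (rule iso_monic[of "\<rr> \<I>"]) (simp_all add: runit_symm lunit_unit)

text \<open>Precomposing the enriched naturality square with a global element gives ordinary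
  naturality: the symmetry slides past the element and becomes the symmetry of the unit with itself,
  which is the identity.\<close>

lemma vtransformation_ucomp:
  assumes "is_vcat V C" "is_vcat V D" "is_vfunctor V C D S" "is_vfunctor V C D R"
    and "vtransformation V C D S R p" "a \<in> vObj C" "b \<in> vObj C" "g \<in> hom V \<I> (vHom C a b)"
  shows "ucomp V D (vO S a) (vO S b) (vO R b) (p b) (vH S a b \<cdot> g)
    = ucomp V D (vO S a) (vO R a) (vO R b) (vH R a b \<cdot> g) (p a)"
proof -
  note [simp] = vcatD[OF assms(1)] vcatD[OF assms(2)] vfunctorD[OF assms(3)] vfunctorD[OF assms(4)] assms(6,7)
  have [simp]: "p c \<in> Arr V" "Dom V (p c) = \<I>" "Cod V (p c) = vHom D (vO S c) (vO R c)" if "c \<in> vObj C" for c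
    using assms(5) that by (auto simp: vtransformation_def vnatural_family_def hom_iff)
  have [simp]: "g \<in> Arr V" "Dom V g = \<I>" "Cod V g = vHom C a b" using assms by (auto simp: hom_iff)
  have nat: "vComp D (vO S a) (vO S b) (vO R b) \<cdot> (p b \<odot> vH S a b) =
      vComp D (vO S a) (vO R a) (vO R b) \<cdot> (vH R a b \<odot> p a) \<cdot> \<ss> \<I> (vHom C a b)"
    using assms(5-7) by (auto simp: vtransformation_def vnatural_family_def)
  have "ucomp V D (vO S a) (vO S b) (vO R b) (p b) (vH S a b \<cdot> g)
      = vComp D (vO S a) (vO S b) (vO R b) \<cdot> (p b \<odot> vH S a b) \<cdot> (\<ee> \<I> \<odot> g) \<cdot> inva (\<ll> \<I>)"
    by (simp add: ucomp_def)
  also have "\<dots> = (vComp D (vO S a) (vO R a) (vO R b) \<cdot> (vH R a b \<odot> p a) \<cdot> \<ss> \<I> (vHom C a b)) \<cdot> (\<ee> \<I> \<odot> g) \<cdot> inva (\<ll> \<I>)"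
    by (rule reassoc[OF nat]) simp_all
  also have "\<dots> = vComp D (vO S a) (vO R a) (vO R b) \<cdot> (vH R a b \<odot> p a) \<cdot> (\<ss> \<I> (vHom C a b) \<cdot> (\<ee> \<I> \<odot> g) \<cdot> inva (\<ll> \<I>))"
    by simp
  also have "\<ss> \<I> (vHom C a b) \<cdot> (\<ee> \<I> \<odot> g) \<cdot> inva (\<ll> \<I>) = ((g \<odot> \<ee> \<I>) \<cdot> \<ss> \<I> \<I>) \<cdot> inva (\<ll> \<I>)"
    by (rule reassoc) (simp_all add: nat_symm)
  finally show ?thesis by (simp add: ucomp_def symm_unit_unit)
qed

text \<open>The action on arrows of the functor \<open>[x,-]\<close>.\<close>

definition post :: "'o \<Rightarrow> 'm \<Rightarrow> 'm" where
  "post x f = curry_arr V (ihom x (Dom V f)) x (Cod V f) (f \<cdot> ev x (Dom V f))"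

lemma post_simps [simp]:
  assumes "x \<in> Obj V" "f \<in> Arr V"
  shows "post x f \<in> Arr V" "Dom V (post x f) = ihom x (Dom V f)" "Cod V (post x f) = ihom x (Cod V f)"
  using assms by (simp_all add: post_def)

lemma ev_post:
  assumes "x \<in> Obj V" "f \<in> Arr V" "k \<in> Arr V" "Cod V k = ihom x (Dom V f)" "h \<in> Arr V" "Cod V h = x" "y = Cod V f"
  shows "ev x y \<cdot> ((post x f \<cdot> k) \<odot> h) = f \<cdot> (ev x (Dom V f) \<cdot> (k \<odot> h))"
  using assms by (simp add: post_def)

lemma post_comp:
  assumes "x \<in> Obj V" "f \<in> Arr V" "g \<in> Arr V" "Dom V g = Cod V f"
  shows "post x g \<cdot> post x f = post x (g \<cdot> f)"
  by (rule ihom_eqI[of x "Cod V g"]) (use assms in \<open>simp_all add: post_def\<close>)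

lemma post_id: "x \<in> Obj V \<Longrightarrow> a \<in> Obj V \<Longrightarrow> post x (\<ee> a) = \<ee> (ihom x a)"
  by (rule ihom_eqI[of x a]) (simp_all add: post_def)

lemma vpostcomp_simps [simp]:
  assumes "x \<in> Obj V" "a \<in> Obj V" "b \<in> Obj V"
  shows "vpostcomp V x a b \<in> Arr V" "Dom V (vpostcomp V x a b) = ihom a b"
    "Cod V (vpostcomp V x a b) = ihom (ihom x a) (ihom x b)"
  using assms by (simp_all add: vpostcomp_def)

text \<open>Links the restricted Yoneda functor, which is specified through
  \<open>vpostcomp\<close>, to the ordinary arrow \<open>post\<close> by evaluating at a global
  element.\<close>

lemma unname_vpostcomp:
  assumes [simp]: "x \<in> Obj V" "a \<in> Obj V" "b \<in> Obj V" "g \<in> Arr V" "Dom V g = \<I>" "Cod V g = ihom a b"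
  shows "unname_arr V (ihom x a) (ihom x b) (vpostcomp V x a b \<cdot> g) = post x (unname_arr V a b g)"
proof -
  have "unname_arr V (ihom x a) (ihom x b) (vpostcomp V x a b \<cdot> g)
      = (icomp x a b \<cdot> (g \<odot> \<ee> (ihom x a))) \<cdot> inva (\<ll> (ihom x a))"
    by (simp add: unname_arr_def vpostcomp_def)
  also have "\<dots> = post x (unname_arr V a b g)"
    by (subst icomp_left_name) (simp_all add: post_def)
  finally show ?thesis .
qed

lemma vfunctor_selfD:
  assumes "is_vfunctor V C (vself V) S"
  shows "a \<in> vObj C \<Longrightarrow> vO S a \<in> Obj V"
    "a \<in> vObj C \<Longrightarrow> b \<in> vObj C \<Longrightarrow> vH S a b \<in> Arr V"
    "a \<in> vObj C \<Longrightarrow> b \<in> vObj C \<Longrightarrow> Dom V (vH S a b) = vHom C a b"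
    "a \<in> vObj C \<Longrightarrow> b \<in> vObj C \<Longrightarrow> Cod V (vH S a b) = ihom (vO S a) (vO S b)"
    "a \<in> vObj C \<Longrightarrow> b \<in> vObj C \<Longrightarrow> vHom C a b \<in> Obj V"
  using vfunctorD[OF assms] dom_obj[of "vH S a b"] by auto

text \<open>Used with a global element \<open>k\<close> of a hom object of a functor category:
  composing the universal family with it gives the transformation that it represents.\<close>

lemma vnatural_precomp:
  assumes S: "is_vfunctor V C (vself V) S" and R: "is_vfunctor V C (vself V) R"
    and p: "vnatural_family V C (vself V) S R w p" and k: "k \<in> hom V w' w"
  shows "vnatural_family V C (vself V) S R w' (\<lambda>a. p a \<cdot> k)"
  unfolding vnatural_family_def
proof safe
  note [simp] = vfunctor_selfD[OF S] vfunctor_selfD[OF R]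
  have k' [simp]: "k \<in> Arr V" "Dom V k = w'" "Cod V k = w" using k by (auto simp: hom_iff)
  have w [simp]: "w \<in> Obj V" "w' \<in> Obj V" using hom_objs[OF k] by auto
  have p' [simp]: "p a \<in> Arr V" "Dom V (p a) = w" "Cod V (p a) = ihom (vO S a) (vO R a)" if "a \<in> vObj C" for a
    using p that by (auto simp: vnatural_family_def hom_iff)
  show "p a \<cdot> k \<in> hom V w' (vHom (vself V) (vO S a) (vO R a))" if "a \<in> vObj C" for a
    using that by (simp add: hom_iff)
  fix a b assume [simp]: "a \<in> vObj C" "b \<in> vObj C"
  have nat: "icomp (vO S a) (vO S b) (vO R b) \<cdot> (p b \<odot> vH S a b)
      = icomp (vO S a) (vO R a) (vO R b) \<cdot> (vH R a b \<odot> p a) \<cdot> \<ss> w (vHom C a b)"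
    using p by (auto simp: vnatural_family_def)
  have "icomp (vO S a) (vO S b) (vO R b) \<cdot> ((p b \<cdot> k) \<odot> vH S a b)
      = icomp (vO S a) (vO S b) (vO R b) \<cdot> ((p b \<odot> vH S a b) \<cdot> (k \<odot> \<ee> (vHom C a b)))"
    by simp
  also have "\<dots> = (icomp (vO S a) (vO R a) (vO R b) \<cdot> (vH R a b \<odot> p a) \<cdot> \<ss> w (vHom C a b)) \<cdot> (k \<odot> \<ee> (vHom C a b))"
    by (rule reassoc[OF nat]) simp_all
  also have "\<dots> = icomp (vO S a) (vO R a) (vO R b) \<cdot> (vH R a b \<odot> (p a \<cdot> k)) \<cdot> \<ss> w' (vHom C a b)"
    by (simp add: nat_symm)
  finally show "icomp (vO S a) (vO S b) (vO R b) \<cdot> ((p b \<cdot> k) \<odot> vH S a b)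
      = icomp (vO S a) (vO R a) (vO R b) \<cdot> (vH R a b \<odot> (p a \<cdot> k)) \<cdot> \<ss> w' (vHom C a b)" .
qed

lemma vnatural_cong:
  "(\<And>a. a \<in> vObj C \<Longrightarrow> p a = p' a) \<Longrightarrow> vnatural_family V C D S R w p \<longleftrightarrow> vnatural_family V C D S R w p'"
  unfolding vnatural_family_def by auto

end

section \<open>Algebras of a pretheory\<close>

locale pretheory = symmetric_monoidal_closed V
  for V :: "('o, 'm, 'z) smcat_scheme" (structure) +
  fixes P :: "'o set" and T :: "('o, 'o, 'm) vcat" and J :: "('o, 'o, 'm) vfun"
  assumes pretheory: "is_pretheory V P T J" and P_obj: "x \<in> P \<Longrightarrow> x \<in> Obj V"
begin

declare P_obj [simp]

lemma pretheoryD: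
  shows T_vcat: "is_vcat V T" and vObj_T [simp]: "vObj T = P"
    and J_vfunctor: "is_vfunctor V (vfull (vself V) P) T J" and vO_J [simp]: "x \<in> P \<Longrightarrow> vO J x = x"
  using pretheory unfolding is_pretheory_def by auto

lemma T_simps [simp]:
  "a \<in> P \<Longrightarrow> b \<in> P \<Longrightarrow> vHom T a b \<in> Obj V"
  "a \<in> P \<Longrightarrow> vId T a \<in> Arr V" "a \<in> P \<Longrightarrow> Dom V (vId T a) = \<I>" "a \<in> P \<Longrightarrow> Cod V (vId T a) = vHom T a a"
  "a \<in> P \<Longrightarrow> b \<in> P \<Longrightarrow> c \<in> P \<Longrightarrow> vComp T a b c \<in> Arr V"
  "a \<in> P \<Longrightarrow> b \<in> P \<Longrightarrow> c \<in> P \<Longrightarrow> Dom V (vComp T a b c) = vHom T b c \<otimes> vHom T a b"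
  "a \<in> P \<Longrightarrow> b \<in> P \<Longrightarrow> c \<in> P \<Longrightarrow> Cod V (vComp T a b c) = vHom T a c"
  using vcatD[OF T_vcat] by auto

lemma J_simps [simp]:
  "a \<in> P \<Longrightarrow> b \<in> P \<Longrightarrow> vH J a b \<in> Arr V"
  "a \<in> P \<Longrightarrow> b \<in> P \<Longrightarrow> Dom V (vH J a b) = ihom a b"
  "a \<in> P \<Longrightarrow> b \<in> P \<Longrightarrow> Cod V (vH J a b) = vHom T a b"
  using vfunctorD[OF J_vfunctor] by (auto simp: vfull_def)

lemma vop_simps [simp]:
  "vObj (vop V T) = P" "vHom (vop V T) a b = vHom T b a"
  "vObj (vop V (vfull (vself V) P)) = P" "vHom (vop V (vfull (vself V) P)) a b = ihom b a"
  by (simp_all add: vop_def vfull_def)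

definition algs :: "('o \<times> ('o, 'o, 'm) vfun) set" where
  "algs = {(a, S). a \<in> Obj V \<and> is_vfunctor V (vop V T) (vself V) S \<and> vfun_ext (vop V T) S \<and>
     vrep V P a = vfun_comp V (vop V (vfull (vself V) P)) S (vfun_op J)}"

text \<open>The uncurried action of the functor \<open>snd A\<close> on hom objects: an arrow
  \<open>x -> z\<close> of \<open>T\<close> is an operation taking maps \<open>z -> fst A\<close> to
  maps \<open>x -> fst A\<close>. In this form homomorphisms are described by tensor products and
  \<open>post\<close> alone.\<close>

definition act :: "'o \<times> ('o, 'o, 'm) vfun \<Rightarrow> 'o \<Rightarrow> 'o \<Rightarrow> 'm" where
  "act A z x = ev (ihom z (fst A)) (ihom x (fst A)) \<cdot> (vH (snd A) z x \<odot> \<ee> (ihom z (fst A)))"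

text \<open>The components are of the form \<open>post x f\<close> because an algebra map restricts
  along \<open>J\<close> to a map of representables, which in the pullback comes from an arrow
  \<open>f\<close> of the carriers.\<close>

definition ahom :: "'o \<times> ('o, 'o, 'm) vfun \<Rightarrow> 'o \<times> ('o, 'o, 'm) vfun \<Rightarrow> 'm \<Rightarrow> bool" where
  "ahom A B f \<longleftrightarrow> f \<in> hom V (fst A) (fst B) \<and>
     (\<forall>z \<in> P. \<forall>x \<in> P. post x f \<cdot> act A z x = act B z x \<cdot> (\<ee> (vHom T x z) \<odot> post z f))"

lemma alg_vO: "(a, S) \<in> algs \<Longrightarrow> x \<in> P \<Longrightarrow> vO S x = ihom x a"
proof -
  assume "(a, S) \<in> algs" "x \<in> P"
  then have "vO (vrep V P a) x = vO (vfun_comp V (vop V (vfull (vself V) P)) S (vfun_op J)) x"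
    unfolding algs_def by auto
  then show ?thesis
    using \<open>x \<in> P\<close> by (simp add: vrep_def vfun_comp_def vfun_op_def)
qed

lemma alg_vH:
  assumes "(a, S) \<in> algs" "x \<in> P" "z \<in> P"
  shows "vH S z x \<in> Arr V" "Dom V (vH S z x) = vHom T x z" "Cod V (vH S z x) = ihom (ihom z a) (ihom x a)"
  using assms vfunctorD[of "vop V T" "vself V" S] alg_vO[OF assms(1)] by (auto simp: algs_def)

lemma alg_obj: "A \<in> algs \<Longrightarrow> fst A \<in> Obj V"
  by (auto simp: algs_def)

lemma act_simps:
  assumes "A \<in> algs" "x \<in> P" "z \<in> P"
  shows "act A z x \<in> Arr V" "Dom V (act A z x) = vHom T x z \<otimes> ihom z (fst A)"
    "Cod V (act A z x) = ihom x (fst A)"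
  using assms alg_vH[of "fst A" "snd A"] alg_obj[of A] by (simp_all add: act_def)

text \<open>Each side of the naturality square has a named arrow as one factor, so
  \<open>icomp_left_name\<close> and \<open>icomp_right_name\<close> present the sides as transposes
  of the two composites in \<open>ahom\<close>, followed by the same left unitor. Transposition is
  injective and the unitor is invertible.\<close>

lemma vnatural_iff_ahom:
  assumes A: "(a, S) \<in> algs" and B: "(b, R) \<in> algs" and g: "g \<in> hom V \<I> (ihom a b)"
  shows "vnatural_family V (vop V T) (vself V) S R \<I> (\<lambda>x. vpostcomp V x a b \<cdot> g)
    \<longleftrightarrow> ahom (a, S) (b, R) (unname_arr V a b g)"
proof -
  note [simp] = alg_vH[OF A] alg_vH[OF B] alg_vO[OF A] alg_vO[OF B]
  have [simp]: "a \<in> Obj V" "b \<in> Obj V" using alg_obj[OF A] alg_obj[OF B] by auto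
  have [simp]: "g \<in> Arr V" "Dom V g = \<I>" "Cod V g = ihom a b" using g by (auto simp: hom_iff)
  let ?f = "unname_arr V a b g" and ?p = "\<lambda>x. vpostcomp V x a b \<cdot> g"
  have "icomp (vO S z) (vO S x) (vO R x) \<cdot> (?p x \<odot> vH S z x) =
        icomp (vO S z) (vO R z) (vO R x) \<cdot> (vH R z x \<odot> ?p z) \<cdot> \<ss> \<I> (vHom T x z)
    \<longleftrightarrow> post x ?f \<cdot> act (a, S) z x = act (b, R) z x \<cdot> (\<ee> (vHom T x z) \<odot> post z ?f)"
    if [simp]: "z \<in> P" "x \<in> P" for z x
  proof -
    let ?H = "vHom T x z"
    let ?l = "post x ?f \<cdot> act (a, S) z x" and ?r = "act (b, R) z x \<cdot> (\<ee> ?H \<odot> post z ?f)"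
    note [simp] = act_simps[OF A] act_simps[OF B]
    have l: "icomp (vO S z) (vO S x) (vO R x) \<cdot> (?p x \<odot> vH S z x)
        = curry_arr V ?H (ihom z a) (ihom x b) ?l \<cdot> \<ll> ?H"
      by (simp add: icomp_left_name unname_vpostcomp) (simp add: act_def)
    have "icomp (vO S z) (vO R z) (vO R x) \<cdot> (vH R z x \<odot> ?p z) \<cdot> \<ss> \<I> ?H
        = (icomp (vO S z) (vO R z) (vO R x) \<cdot> (vH R z x \<odot> ?p z)) \<cdot> \<ss> \<I> ?H"
      by simp
    also have "\<dots> = (curry_arr V ?H (ihom z a) (ihom x b) ?r \<cdot> \<rr> ?H) \<cdot> \<ss> \<I> ?H"
      by (simp add: icomp_right_name unname_vpostcomp del: assoc) (simp add: act_def)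
    also have "\<dots> = curry_arr V ?H (ihom z a) (ihom x b) ?r \<cdot> \<ll> ?H"
      by (simp add: runit_symm)
    finally have r: "icomp (vO S z) (vO R z) (vO R x) \<cdot> (vH R z x \<odot> ?p z) \<cdot> \<ss> \<I> ?H = \<dots>" .
    show ?thesis
      unfolding l r
    proof
      assume "curry_arr V ?H (ihom z a) (ihom x b) ?l \<cdot> \<ll> ?H = curry_arr V ?H (ihom z a) (ihom x b) ?r \<cdot> \<ll> ?H"
      then have "curry_arr V ?H (ihom z a) (ihom x b) ?l = curry_arr V ?H (ihom z a) (ihom x b) ?r"
        by (rule iso_epic[rotated]) simp_all
      then show "?l = ?r" by (rule curry_inject) simp_all
    qed simp
  qed
  then show ?thesis
    by (auto simp: vnatural_family_def ahom_def hom_iff)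
qed

end

section \<open>Algebra homomorphisms as global elements of hom objects\<close>

locale algebra_category = pretheory V P T J
  for V :: "('o, 'm, 'z) smcat_scheme" (structure) and P T J +
  fixes Q :: "('o \<times> ('o, 'o, 'm) vfun, 'o, 'm) vcat" and U :: "('o \<times> ('o, 'o, 'm) vfun, 'o, 'm) vfun"
  assumes alg_cat: "is_algebra_category V P T J Q U"
begin

lemma Q_vcat: "is_vcat V Q" and U_vfunctor: "is_vfunctor V Q (vself V) U" and vObj_Q: "vObj Q = algs"
  and vO_U: "A \<in> algs \<Longrightarrow> vO U A = fst A"
proof -
  obtain E ev E' ev' N R q where *:
    "is_vfunctor_category V (vop V T) (vself V) E ev"
    "is_restricted_yoneda V P E' ev' N" "is_restriction V P J E ev E' ev' R"
    "is_vpullback V (vself V) E N R Q U q"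
    using alg_cat unfolding is_algebra_category_def by blast
  show "is_vcat V Q" "is_vfunctor V Q (vself V) U" "vObj Q = algs"
    using * unfolding is_vpullback_def is_vfunctor_category_def is_restricted_yoneda_def is_restriction_def algs_def
    by auto
  then show "A \<in> algs \<Longrightarrow> vO U A = fst A"
    using * unfolding is_vpullback_def by auto
qed

text \<open>By the pullback, a global element of \<open>Q(A,B)\<close> is a named arrow together
  with a transformation of functors on \<open>T\<close> that agrees with it after restriction along
  \<open>J\<close>. Agreement forces the components to be \<open>vpostcomp\<close> applied to the
  name, and such a family is natural exactly when the arrow is an \<open>ahom\<close>.\<close>

lemma underlying_ahom_iff:
  assumes A: "A \<in> algs" and B: "B \<in> algs"
  shows underlying_ahom:
      "h \<in> hom V \<I> (vHom Q A B) \<Longrightarrow> ahom A B (unname_arr V (fst A) (fst B) (vH U A B \<cdot> h))"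
    and underlying_full: "ahom A B f \<Longrightarrow> \<exists>h \<in> hom V \<I> (vHom Q A B). vH U A B \<cdot> h = name_arr V f"
proof -
  obtain a S b S' where AB: "A = (a, S)" "B = (b, S')" by (cases A, cases B)
  obtain E ee E' ee' N R q where
    E: "is_vfunctor_category V (vop V T) (vself V) E ee" and
    E': "is_vfunctor_category V (vop V (vfull (vself V) P)) (vself V) E' ee'" and
    N: "is_restricted_yoneda V P E' ee' N" and R: "is_restriction V P J E ee E' ee' R" and
    pb: "is_vpullback V (vself V) E N R Q U q"
    using alg_cat unfolding is_algebra_category_def by blast
  have ab [simp]: "a \<in> Obj V" "b \<in> Obj V" and S: "is_vfunctor V (vop V T) (vself V) S" "is_vfunctor V (vop V T) (vself V) S'"
    using A B by (auto simp: algs_def AB)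
  have SE: "S \<in> vObj E" "S' \<in> vObj E" and eq: "vO N a = vO R S" "vO N b = vO R S'"
    using A B pb vObj_Q unfolding is_vpullback_def AB by auto
  have vN: "is_vfunctor V (vself V) E' N" and vR: "is_vfunctor V E E' R"
    using N R unfolding is_restricted_yoneda_def is_restriction_def by auto
  have EE: "vO N a \<in> vObj E'" "vO N b \<in> vObj E'" using vfunctorD(1)[OF vN] by auto
  have F: "is_vfunctor V (vop V (vfull (vself V) P)) (vself V) (vO N a)"
    "is_vfunctor V (vop V (vfull (vself V) P)) (vself V) (vO N b)"
    using E' EE unfolding is_vfunctor_category_def by auto
  have pull: "is_pullback V (vH N a b) (vH R S S') (vH U A B) (vH q A B)"
    using pb A B vObj_Q unfolding is_vpullback_def AB by auto
  have UA: "vH U A B \<in> Arr V" "Dom V (vH U A B) = vHom Q A B" "Cod V (vH U A B) = ihom a b"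
    using vfunctorD[OF U_vfunctor] A B vObj_Q vO_U by (auto simp: AB)
  have qA: "vH q A B \<in> Arr V" "Dom V (vH q A B) = vHom Q A B" "Cod V (vH q A B) = vHom E S S'"
    using pb A B vObj_Q vfunctorD[of Q E q] unfolding is_vpullback_def by (auto simp: AB)
  have NA: "vH N a b \<in> Arr V" "Dom V (vH N a b) = ihom a b" "Cod V (vH N a b) = vHom E' (vO N a) (vO N b)"
    using vfunctorD[OF vN] by auto
  have RA: "vH R S S' \<in> Arr V" "Dom V (vH R S S') = vHom E S S'" "Cod V (vH R S S') = vHom E' (vO N a) (vO N b)"
    using vfunctorD[OF vR] SE by (auto simp: eq)
  have sq: "vH N a b \<cdot> vH U A B = vH R S S' \<cdot> vH q A B"
    using pull unfolding is_pullback_def by auto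
  have [simp]: "vHom E S S' \<in> Obj V" "vHom E' (vO N a) (vO N b) \<in> Obj V"
    using cod_obj[OF qA(1)] cod_obj[OF NA(1)] qA NA by auto
  have eeN: "vnatural_family V (vop V T) (vself V) S S' (vHom E S S') (ee S S')"
    using E SE unfolding is_vfunctor_category_def by auto
  have eeN': "vnatural_family V (vop V (vfull (vself V) P)) (vself V) (vO N a) (vO N b) (vHom E' (vO N a) (vO N b)) (ee' (vO N a) (vO N b))"
    using E' EE unfolding is_vfunctor_category_def by auto
  have eeA: "ee S S' x \<in> Arr V" "Dom V (ee S S' x) = vHom E S S'" if "x \<in> P" for x
    using eeN that unfolding vnatural_family_def by (auto simp: hom_iff)
  have eeA': "ee' (vO N a) (vO N b) x \<in> Arr V" "Dom V (ee' (vO N a) (vO N b) x) = vHom E' (vO N a) (vO N b)" if "x \<in> P" for x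
    using eeN' that unfolding vnatural_family_def by (auto simp: hom_iff)
  \<comment> \<open>The evaluations of a functor category are jointly monic on global elements, by
    the uniqueness clause of its universal property.\<close>
  have eeM': "k = k'" if "k \<in> hom V \<I> (vHom E' (vO N a) (vO N b))" "k' \<in> hom V \<I> (vHom E' (vO N a) (vO N b))"
    "\<And>x. x \<in> P \<Longrightarrow> ee' (vO N a) (vO N b) x \<cdot> k = ee' (vO N a) (vO N b) x \<cdot> k'" for k k'
  proof -
    have "vnatural_family V (vop V (vfull (vself V) P)) (vself V) (vO N a) (vO N b) \<I> (\<lambda>x. ee' (vO N a) (vO N b) x \<cdot> k)"
      by (rule vnatural_precomp[OF F eeN' that(1)])
    then have "\<exists>!h. h \<in> hom V \<I> (vHom E' (vO N a) (vO N b)) \<and>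
        (\<forall>x \<in> P. ee' (vO N a) (vO N b) x \<cdot> h = ee' (vO N a) (vO N b) x \<cdot> k)"
      using E' EE unit_obj unfolding is_vfunctor_category_def vop_simps by blast
    then show ?thesis using that by metis
  qed
  have evN: "ee' (vO N a) (vO N b) x \<cdot> (vH N a b \<cdot> g) = vpostcomp V x a b \<cdot> g"
    if "x \<in> P" "g \<in> hom V \<I> (ihom a b)" for x g
    by (rule reassoc) (use N that NA eeA' in \<open>auto simp: is_restricted_yoneda_def hom_iff\<close>)
  have evR: "ee' (vO N a) (vO N b) x \<cdot> (vH R S S' \<cdot> s) = ee S S' x \<cdot> s"
    if "x \<in> P" "s \<in> hom V \<I> (vHom E S S')" for x s
    by (rule reassoc) (use R SE that RA eeA' in \<open>auto simp: is_restriction_def eq hom_iff\<close>)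
  \<comment> \<open>Following both projections of the pullback into the restricted functor category
    and evaluating at \<open>x\<close> shows that the transformation part of \<open>h\<close> is
    determined by its arrow part.\<close>
  have key: "ee S S' x \<cdot> (vH q A B \<cdot> h) = vpostcomp V x a b \<cdot> (vH U A B \<cdot> h)"
    if "x \<in> P" "h \<in> hom V \<I> (vHom Q A B)" for x h
  proof -
    have "vH R S S' \<cdot> (vH q A B \<cdot> h) = vH N a b \<cdot> (vH U A B \<cdot> h)"
      using that UA qA NA RA sq[symmetric] by (simp add: hom_iff flip: assoc)
    then show ?thesis
      using evR[OF that(1), of "vH q A B \<cdot> h"] evN[OF that(1), of "vH U A B \<cdot> h"] that UA qA
      by (simp add: hom_iff)
  qed
  show "ahom A B (unname_arr V (fst A) (fst B) (vH U A B \<cdot> h))" if h: "h \<in> hom V \<I> (vHom Q A B)" for h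
  proof -
    have qh: "vH q A B \<cdot> h \<in> hom V \<I> (vHom E S S')" using h qA by (auto simp: hom_iff)
    have Uh: "vH U A B \<cdot> h \<in> hom V \<I> (ihom a b)" using h UA by (auto simp: hom_iff)
    have "vnatural_family V (vop V T) (vself V) S S' \<I> (\<lambda>x. vpostcomp V x a b \<cdot> (vH U A B \<cdot> h))"
      using vnatural_precomp[OF S eeN qh] by (subst vnatural_cong) (auto simp: key[OF _ h])
    then show ?thesis
      using vnatural_iff_ahom[OF A[unfolded AB] B[unfolded AB] Uh[unfolded AB]] by (simp add: AB)
  qed
  show "\<exists>h \<in> hom V \<I> (vHom Q A B). vH U A B \<cdot> h = name_arr V f" if f: "ahom A B f"
  proof -
    have f': "f \<in> Arr V" "Dom V f = a" "Cod V f = b" using f by (auto simp: ahom_def AB hom_iff)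
    have g: "name_arr V f \<in> hom V \<I> (ihom a b)" using f' by (auto simp: hom_iff)
    have "vnatural_family V (vop V T) (vself V) S S' \<I> (\<lambda>x. vpostcomp V x a b \<cdot> name_arr V f)"
      using f vnatural_iff_ahom[OF A[unfolded AB] B[unfolded AB] g] f' by (simp add: AB)
    \<comment> \<open>The natural family given by \<open>f\<close> is represented by some
      \<open>s\<close>. It agrees with the name of \<open>f\<close> after restriction along
      \<open>J\<close>, so the pair lifts to the pullback.\<close>
    then have "\<exists>s. s \<in> hom V \<I> (vHom E S S') \<and> (\<forall>x \<in> P. ee S S' x \<cdot> s = vpostcomp V x a b \<cdot> name_arr V f)"
      using E SE unit_obj unfolding is_vfunctor_category_def vop_simps by blast
    then obtain s where s: "s \<in> hom V \<I> (vHom E S S')"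
      and es: "\<And>x. x \<in> P \<Longrightarrow> ee S S' x \<cdot> s = vpostcomp V x a b \<cdot> name_arr V f" by blast
    have "vH N a b \<cdot> name_arr V f = vH R S S' \<cdot> s"
      by (rule eeM') (use g s NA RA in \<open>auto simp: evN[OF _ g] evR[OF _ s] es hom_iff\<close>)
    moreover have "name_arr V f \<in> hom V \<I> (Dom V (vH N a b))" "s \<in> hom V \<I> (Dom V (vH R S S'))"
      using g s NA RA by (auto simp: hom_iff)
    ultimately show ?thesis using pull UA unfolding is_pullback_def by metis
  qed
qed

end

section \<open>V as a V-category, and composition of enriched functors\<close>

context symmetric_monoidal_closed
begin

text \<open>The unit laws are internal composition with the name of an identity. Associativity is
  checked after evaluation, where it becomes naturality of the associator together with the
  pentagon.\<close>

lemma vself_vcat: "is_vcat V (vself V)"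
  unfolding is_vcat_def
proof (intro conjI ballI, goal_cases)
  case (3 a b c)
  then show ?case by (simp add: hom_iff)
next
  case (4 a b)
  have [simp]: "curry_arr V (ihom a b) a b (ev a b) = \<ee> (ihom a b)"
    by (rule ihom_eqI[of a b]) (use 4 in simp_all)
  have "unname_arr V x x (curry_arr V \<I> x x (\<ll> x)) = \<ee> x" if "x \<in> Obj V" for x
    using unname_vId[OF that] by simp
  then show ?case using 4 by (simp add: icomp_right_name)
next
  case (5 a b)
  have [simp]: "curry_arr V (ihom a b) a b (ev a b) = \<ee> (ihom a b)"
    by (rule ihom_eqI[of a b]) (use 5 in simp_all)
  have "unname_arr V x x (curry_arr V \<I> x x (\<ll> x)) = \<ee> x" if "x \<in> Obj V" for x
    using unname_vId[OF that] by simp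
  then show ?case using 5 by (simp add: icomp_left_name)
next
  case (6 a b c d)
  then have [simp]: "a \<in> Obj V" "b \<in> Obj V" "c \<in> Obj V" "d \<in> Obj V" by auto
  let ?A = "ihom c d" and ?B = "ihom b c" and ?C = "ihom a b"
  have "icomp a b d \<cdot> (icomp b c d \<odot> \<ee> ?C) = icomp a c d \<cdot> (\<ee> ?A \<odot> icomp a b c) \<cdot> \<alpha> ?A ?B ?C"
  proof (rule ihom_eqI[of a d])
    have "ev a d \<cdot> ((icomp a b d \<cdot> (icomp b c d \<odot> \<ee> ?C)) \<odot> \<ee> a)
        = ev b d \<cdot> ((icomp b c d \<odot> \<ee> b) \<cdot> (\<ee> (?A \<otimes> ?B) \<odot> ev a b)) \<cdot> \<alpha> (?A \<otimes> ?B) ?C a"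
      by (simp add: ev_icomp_ten)
    also have "\<dots> = (ev b d \<cdot> (icomp b c d \<odot> \<ee> b)) \<cdot> (\<ee> (?A \<otimes> ?B) \<odot> ev a b) \<cdot> \<alpha> (?A \<otimes> ?B) ?C a"
      by simp
    also have "ev b d \<cdot> (icomp b c d \<odot> \<ee> b) = ev c d \<cdot> (\<ee> ?A \<odot> ev b c) \<cdot> \<alpha> ?A ?B b"
      using ev_icomp[of b c d "\<ee> (?A \<otimes> ?B)" "\<ee> b"] by simp
    also have "(ev c d \<cdot> (\<ee> ?A \<odot> ev b c) \<cdot> \<alpha> ?A ?B b) \<cdot> (\<ee> (?A \<otimes> ?B) \<odot> ev a b) \<cdot> \<alpha> (?A \<otimes> ?B) ?C a
        = ev c d \<cdot> (\<ee> ?A \<odot> ev b c) \<cdot> (\<alpha> ?A ?B b \<cdot> ((\<ee> ?A \<odot> \<ee> ?B) \<odot> ev a b) \<cdot> \<alpha> (?A \<otimes> ?B) ?C a)"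
      by simp
    also have "\<alpha> ?A ?B b \<cdot> ((\<ee> ?A \<odot> \<ee> ?B) \<odot> ev a b) \<cdot> \<alpha> (?A \<otimes> ?B) ?C a
        = ((\<ee> ?A \<odot> (\<ee> ?B \<odot> ev a b)) \<cdot> \<alpha> ?A ?B (?C \<otimes> a)) \<cdot> \<alpha> (?A \<otimes> ?B) ?C a"
      by (rule reassoc) (simp_all add: nat_assoc del: ten_id)
    also have "\<dots> = (\<ee> ?A \<odot> (\<ee> ?B \<odot> ev a b)) \<cdot> ((\<ee> ?A \<odot> \<alpha> ?B ?C a) \<cdot> \<alpha> ?A (?B \<otimes> ?C) a \<cdot> (\<alpha> ?A ?B ?C \<odot> \<ee> a))"
      by (simp add: pentagon del: ten_fuse_reassoc)
    also have "ev c d \<cdot> (\<ee> ?A \<odot> ev b c) \<cdot> \<dots>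
        = ev c d \<cdot> (\<ee> ?A \<odot> (ev b c \<cdot> (\<ee> ?B \<odot> ev a b) \<cdot> \<alpha> ?B ?C a)) \<cdot> \<alpha> ?A (?B \<otimes> ?C) a \<cdot> (\<alpha> ?A ?B ?C \<odot> \<ee> a)"
      by simp
    also have "ev b c \<cdot> (\<ee> ?B \<odot> ev a b) \<cdot> \<alpha> ?B ?C a = ev a c \<cdot> (icomp a b c \<odot> \<ee> a)"
      using ev_icomp[of a b c "\<ee> (?B \<otimes> ?C)" "\<ee> a"] by simp
    also have "ev c d \<cdot> (\<ee> ?A \<odot> (ev a c \<cdot> (icomp a b c \<odot> \<ee> a))) \<cdot> \<alpha> ?A (?B \<otimes> ?C) a \<cdot> (\<alpha> ?A ?B ?C \<odot> \<ee> a)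
        = ev c d \<cdot> (\<ee> ?A \<odot> ev a c) \<cdot> ((\<ee> ?A \<odot> (icomp a b c \<odot> \<ee> a)) \<cdot> \<alpha> ?A (?B \<otimes> ?C) a) \<cdot> (\<alpha> ?A ?B ?C \<odot> \<ee> a)"
      by simp
    also have "(\<ee> ?A \<odot> (icomp a b c \<odot> \<ee> a)) \<cdot> \<alpha> ?A (?B \<otimes> ?C) a = \<alpha> ?A (ihom a c) a \<cdot> ((\<ee> ?A \<odot> icomp a b c) \<odot> \<ee> a)"
      by (simp add: nat_assoc)
    also have "ev c d \<cdot> (\<ee> ?A \<odot> ev a c) \<cdot> (\<alpha> ?A (ihom a c) a \<cdot> ((\<ee> ?A \<odot> icomp a b c) \<odot> \<ee> a)) \<cdot> (\<alpha> ?A ?B ?C \<odot> \<ee> a)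
        = ev a d \<cdot> ((icomp a c d \<cdot> (\<ee> ?A \<odot> icomp a b c) \<cdot> \<alpha> ?A ?B ?C) \<odot> \<ee> a)"
      by (simp add: ev_icomp)
    finally show "ev a d \<cdot> ((icomp a b d \<cdot> (icomp b c d \<odot> \<ee> ?C)) \<odot> \<ee> a)
        = ev a d \<cdot> ((icomp a c d \<cdot> (\<ee> ?A \<odot> icomp a b c) \<cdot> \<alpha> ?A ?B ?C) \<odot> \<ee> a)" .
  qed simp_all
  then show ?case by simp
qed (simp_all add: hom_iff)

lemma vfun_comp_vfunctor:
  assumes C: "is_vcat V C" and D: "is_vcat V D" and E: "is_vcat V E"
    and S: "is_vfunctor V C D S" and R: "is_vfunctor V D E R"
  shows "is_vfunctor V C E (vfun_comp V C R S)"
proof -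
  note [simp] = vcatD[OF C] vcatD[OF D] vcatD[OF E] vfunctorD[OF S] vfunctorD[OF R]
  have id: "vH R (vO S a) (vO S a) \<cdot> (vH S a a \<cdot> vId C a) = vId E (vO R (vO S a))" if "a \<in> vObj C" for a
    using that by (simp add: vfunctor_id[OF S] vfunctor_id[OF R])
  have comp: "vH R (vO S a) (vO S c) \<cdot> (vH S a c \<cdot> vComp C a b c)
      = vComp E (vO R (vO S a)) (vO R (vO S b)) (vO R (vO S c)) \<cdot>
        ((vH R (vO S b) (vO S c) \<cdot> vH S b c) \<odot> (vH R (vO S a) (vO S b) \<cdot> vH S a b))"
    if [simp]: "a \<in> vObj C" "b \<in> vObj C" "c \<in> vObj C" for a b c
  proof -
    have "vH R (vO S a) (vO S c) \<cdot> (vH S a c \<cdot> vComp C a b c)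
        = vH R (vO S a) (vO S c) \<cdot> (vComp D (vO S a) (vO S b) (vO S c) \<cdot> (vH S b c \<odot> vH S a b))"
      by (simp add: vfunctor_comp[OF S])
    also have "\<dots> = (vComp E (vO R (vO S a)) (vO R (vO S b)) (vO R (vO S c)) \<cdot>
        (vH R (vO S b) (vO S c) \<odot> vH R (vO S a) (vO S b))) \<cdot> (vH S b c \<odot> vH S a b)"
      by (rule reassoc) (simp_all add: vfunctor_comp[OF R])
    finally show ?thesis by simp
  qed
  show ?thesis
    unfolding is_vfunctor_def vfun_comp_def
    by (simp add: hom_iff id comp)
qed

lemma vfun_id_vfunctor: "is_vcat V C \<Longrightarrow> is_vfunctor V C C (vfun_id V C)"
  using vcatD[of C] by (simp add: is_vfunctor_def vfun_id_def hom_iff)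

end

context pretheory
begin

lemma ahom_hom: "ahom A B f \<Longrightarrow> f \<in> hom V (fst A) (fst B)"
  by (simp add: ahom_def)

lemma ahom_comp:
  assumes "ahom A B f" "ahom B C g" "A \<in> algs" "B \<in> algs" "C \<in> algs"
  shows "ahom A C (g \<cdot> f)"
proof -
  have [simp]: "f \<in> Arr V" "Dom V f = fst A" "Cod V f = fst B" "g \<in> Arr V" "Dom V g = fst B" "Cod V g = fst C"
    using assms by (auto simp: ahom_def hom_iff)
  have "post x (g \<cdot> f) \<cdot> act A z x = act C z x \<cdot> (\<ee> (vHom T x z) \<odot> post z (g \<cdot> f))"
    if [simp]: "x \<in> P" "z \<in> P" for x z
  proof -
    note [simp] = act_simps[OF assms(3)] act_simps[OF assms(4)] act_simps[OF assms(5)]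
    have "post x (g \<cdot> f) \<cdot> act A z x = post x g \<cdot> (post x f \<cdot> act A z x)"
      by (simp add: post_comp[symmetric])
    also have "\<dots> = post x g \<cdot> act B z x \<cdot> (\<ee> (vHom T x z) \<odot> post z f)"
      using assms(1) that by (simp add: ahom_def)
    also have "\<dots> = (act C z x \<cdot> (\<ee> (vHom T x z) \<odot> post z g)) \<cdot> (\<ee> (vHom T x z) \<odot> post z f)"
      by (rule reassoc) (use assms(2) that in \<open>simp_all add: ahom_def\<close>)
    finally show ?thesis by (simp add: post_comp)
  qed
  then show ?thesis by (simp add: ahom_def hom_iff)
qed

lemma ahom_id: "A \<in> algs \<Longrightarrow> ahom A A (\<ee> (fst A))"
  by (simp add: ahom_def alg_obj hom_iff post_id act_simps)

end

section \<open>Free algebras and the induced monad\<close>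

text \<open>The ordinary universal property of free algebras, freed from the enriched adjunction.
  The colimit argument and the comparison of two monads rest on this interface; every
  \<open>induced_monad\<close> is an instance of it.\<close>

locale free_algebra_monad = pretheory V P T J
  for V :: "('o, 'm, 'z) smcat_scheme" (structure) and P T J +
  fixes M :: "('o, 'm) vmonad" and free :: "'o \<Rightarrow> 'o \<times> ('o, 'o, 'm) vfun"
  assumes free_alg: "c \<in> Obj V \<Longrightarrow> free c \<in> algs"
    and fst_free: "c \<in> Obj V \<Longrightarrow> fst (free c) = vO (mFun M) c"
    and unit_hom: "c \<in> Obj V \<Longrightarrow> unit_arr V M c \<in> hom V c (vO (mFun M) c)"
    and monad_arr_ahom: "f \<in> hom V a b \<Longrightarrow> ahom (free a) (free b) (monad_arr V M f)"
    and monad_arr_unit: "f \<in> hom V a b \<Longrightarrow> monad_arr V M f \<cdot> unit_arr V M a = unit_arr V M b \<cdot> f"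
    and free_ext: "c \<in> Obj V \<Longrightarrow> A \<in> algs \<Longrightarrow> f \<in> hom V c (fst A) \<Longrightarrow> \<exists>g. ahom (free c) A g \<and> g \<cdot> unit_arr V M c = f"
    and free_unique: "c \<in> Obj V \<Longrightarrow> A \<in> algs \<Longrightarrow> ahom (free c) A g \<Longrightarrow> ahom (free c) A g' \<Longrightarrow>
      g \<cdot> unit_arr V M c = g' \<cdot> unit_arr V M c \<Longrightarrow> g = g'"
begin

abbreviation "Mo \<equiv> vO (mFun M)"
abbreviation "Ma \<equiv> monad_arr V M"
abbreviation "unit \<equiv> unit_arr V M"

lemma Mo_obj [simp]: "c \<in> Obj V \<Longrightarrow> Mo c \<in> Obj V"
  using alg_obj[OF free_alg] fst_free by force

lemma unit_simps [simp]:
  "c \<in> Obj V \<Longrightarrow> unit c \<in> Arr V" "c \<in> Obj V \<Longrightarrow> Dom V (unit c) = c" "c \<in> Obj V \<Longrightarrow> Cod V (unit c) = Mo c"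
  using unit_hom[of c] by (auto simp: hom_iff)

lemma Ma_hom: "f \<in> hom V a b \<Longrightarrow> Ma f \<in> hom V (Mo a) (Mo b)"
  using ahom_hom[OF monad_arr_ahom] hom_objs by (metis fst_free)

lemma Ma_simps [simp]:
  "f \<in> Arr V \<Longrightarrow> Ma f \<in> Arr V" "f \<in> Arr V \<Longrightarrow> Dom V (Ma f) = Mo (Dom V f)" "f \<in> Arr V \<Longrightarrow> Cod V (Ma f) = Mo (Cod V f)"
  using Ma_hom[of f "Dom V f" "Cod V f"] by (auto simp: hom_iff)

text \<open>Functoriality, here and in \<open>Ma_comp\<close>, is derived from uniqueness of
  extensions: both sides are homomorphisms out of a free algebra with the same restriction along the
  unit of the monad.\<close>

lemma Ma_id: "a \<in> Obj V \<Longrightarrow> Ma (\<ee> a) = \<ee> (Mo a)"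
proof (rule free_unique)
  assume a: "a \<in> Obj V"
  then show "ahom (free a) (free a) (\<ee> (Mo a))"
    using ahom_id[OF free_alg] by (simp add: fst_free)
  show "ahom (free a) (free a) (Ma (\<ee> a))" "Ma (\<ee> a) \<cdot> unit a = \<ee> (Mo a) \<cdot> unit a"
    using a monad_arr_ahom[OF id_hom] monad_arr_unit[OF id_hom] by auto
qed (auto simp: free_alg)

lemma Ma_comp:
  assumes "f \<in> hom V a b" "g \<in> hom V b c"
  shows "Ma (g \<cdot> f) = Ma g \<cdot> Ma f"
proof (rule free_unique)
  have o: "a \<in> Obj V" "b \<in> Obj V" "c \<in> Obj V" using assms hom_objs by auto
  then show "a \<in> Obj V" "free c \<in> algs" by (auto simp: free_alg)
  have "g \<cdot> f \<in> hom V a c" by (rule comp_hom[OF assms])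
  then show "ahom (free a) (free c) (Ma (g \<cdot> f))" by (rule monad_arr_ahom)
  show "ahom (free a) (free c) (Ma g \<cdot> Ma f)"
    using assms o by (intro ahom_comp[of _ "free b"] monad_arr_ahom free_alg)
  have "Ma g \<cdot> Ma f \<cdot> unit a = Ma g \<cdot> unit b \<cdot> f"
    using monad_arr_unit[OF assms(1)] by simp
  also have "\<dots> = (unit c \<cdot> g) \<cdot> f"
    by (rule reassoc) (use monad_arr_unit[OF assms(2)] assms o in \<open>simp_all add: hom_iff\<close>)
  finally show "Ma (g \<cdot> f) \<cdot> unit a = (Ma g \<cdot> Ma f) \<cdot> unit a"
    using monad_arr_unit[OF \<open>g \<cdot> f \<in> hom V a c\<close>] assms o by (simp add: hom_iff)
qed

end

locale induced_monad = algebra_category V P T J Q U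
  for V :: "('o, 'm, 'z) smcat_scheme" (structure) and P T J Q U +
  fixes F :: "('o, 'o \<times> ('o, 'o, 'm) vfun, 'm) vfun" and \<eta> :: "'o \<Rightarrow> 'm"
    and \<epsilon> :: "'o \<times> ('o, 'o, 'm) vfun \<Rightarrow> 'm" and M :: "('o, 'm) vmonad"
  assumes adj: "is_vadjunction V (vself V) Q F U \<eta> \<epsilon>"
    and M_eq: "M = \<lparr>mFun = vfun_comp V (vself V) U F, mUnit = \<eta>,
      mMult = (\<lambda>x. vH U (vO F (vO U (vO F x))) (vO F x) \<cdot> \<epsilon> (vO F x))\<rparr>"
begin

lemmas Q_simps [simp] = vcatD[OF Q_vcat, unfolded vObj_Q]

lemma F_vfunctor: "is_vfunctor V (vself V) Q F"
  and \<eta>_nat: "vtransformation V (vself V) (vself V) (vfun_id V (vself V)) (vfun_comp V (vself V) U F) \<eta>"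
  and \<epsilon>_nat: "vtransformation V Q Q (vfun_comp V Q F U) (vfun_id V Q) \<epsilon>"
  using adj unfolding is_vadjunction_def by auto

lemma F_simps [simp]:
  "c \<in> Obj V \<Longrightarrow> vO F c \<in> algs"
  "a \<in> Obj V \<Longrightarrow> b \<in> Obj V \<Longrightarrow> vH F a b \<in> Arr V"
  "a \<in> Obj V \<Longrightarrow> b \<in> Obj V \<Longrightarrow> Dom V (vH F a b) = ihom a b"
  "a \<in> Obj V \<Longrightarrow> b \<in> Obj V \<Longrightarrow> Cod V (vH F a b) = vHom Q (vO F a) (vO F b)"
  using vfunctorD[OF F_vfunctor] by (auto simp: vObj_Q)

lemma U_simps [simp]:
  "A \<in> algs \<Longrightarrow> B \<in> algs \<Longrightarrow> vH U A B \<in> Arr V"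
  "A \<in> algs \<Longrightarrow> B \<in> algs \<Longrightarrow> Dom V (vH U A B) = vHom Q A B"
  "A \<in> algs \<Longrightarrow> B \<in> algs \<Longrightarrow> Cod V (vH U A B) = ihom (fst A) (fst B)"
  "A \<in> algs \<Longrightarrow> fst A \<in> Obj V"
  using vfunctorD[OF U_vfunctor] by (auto simp: vObj_Q vO_U alg_obj)

lemma M_simps [simp]:
  "c \<in> Obj V \<Longrightarrow> vO (mFun M) c = fst (vO F c)"
  "a \<in> Obj V \<Longrightarrow> b \<in> Obj V \<Longrightarrow> vH (mFun M) a b = vH U (vO F a) (vO F b) \<cdot> vH F a b"
  by (simp_all add: M_eq vfun_comp_def vO_U)

lemma \<eta>_simps [simp]:
  "c \<in> Obj V \<Longrightarrow> \<eta> c \<in> Arr V" "c \<in> Obj V \<Longrightarrow> Dom V (\<eta> c) = \<I>"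
  "c \<in> Obj V \<Longrightarrow> Cod V (\<eta> c) = ihom c (fst (vO F c))"
  using \<eta>_nat by (auto simp: vtransformation_def vnatural_family_def vfun_id_def vfun_comp_def hom_iff vO_U)

lemma \<epsilon>_simps [simp]:
  "A \<in> algs \<Longrightarrow> \<epsilon> A \<in> Arr V" "A \<in> algs \<Longrightarrow> Dom V (\<epsilon> A) = \<I>"
  "A \<in> algs \<Longrightarrow> Cod V (\<epsilon> A) = vHom Q (vO F (fst A)) A"
  using \<epsilon>_nat by (auto simp: vtransformation_def vnatural_family_def vfun_id_def vfun_comp_def hom_iff vO_U vObj_Q)

definition und :: "'o \<times> ('o, 'o, 'm) vfun \<Rightarrow> 'o \<times> ('o, 'o, 'm) vfun \<Rightarrow> 'm \<Rightarrow> 'm" where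
  "und A B h = unname_arr V (fst A) (fst B) (vH U A B \<cdot> h)"

lemma und_ucomp:
  assumes "A \<in> algs" "B \<in> algs" "C \<in> algs" "g \<in> hom V \<I> (vHom Q B C)" "f \<in> hom V \<I> (vHom Q A B)"
  shows "und A C (ucomp V Q A B C g f) = und B C g \<cdot> und A B f"
  using vfunctor_ucomp_self[OF Q_vcat U_vfunctor, of A B C g f] assms by (simp add: und_def vO_U vObj_Q)

lemma und_id: "A \<in> algs \<Longrightarrow> und A A (vId Q A) = \<ee> (fst A)"
  using vfunctor_id[OF U_vfunctor, of A] unname_vId[of "fst A"] by (simp add: und_def vO_U vObj_Q)

lemma und_hom: "A \<in> algs \<Longrightarrow> B \<in> algs \<Longrightarrow> h \<in> hom V \<I> (vHom Q A B) \<Longrightarrow> und A B h \<in> hom V (fst A) (fst B)"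
  by (simp add: und_def hom_iff)

lemma und_F:
  assumes "f \<in> hom V a b"
  shows "und (vO F a) (vO F b) (vH F a b \<cdot> name_arr V f) = monad_arr V M f"
  using assms hom_objs[OF assms] by (simp add: und_def monad_arr_def hom_iff)

lemma F_hom: "f \<in> hom V a b \<Longrightarrow> vH F a b \<cdot> name_arr V f \<in> hom V \<I> (vHom Q (vO F a) (vO F b))"
  using hom_objs[of f a b] by (simp add: hom_iff)

lemma monad_arr_hom: "f \<in> hom V a b \<Longrightarrow> monad_arr V M f \<in> hom V (fst (vO F a)) (fst (vO F b))"
  using und_hom[OF _ _ F_hom] hom_objs by (metis und_F F_simps(1))

lemma monad_arr_comp:
  assumes "f \<in> hom V a b" "g \<in> hom V b c"
  shows "monad_arr V M (g \<cdot> f) = monad_arr V M g \<cdot> monad_arr V M f"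
proof -
  have o [simp]: "a \<in> Obj V" "b \<in> Obj V" "c \<in> Obj V" using assms hom_objs by auto
  have gf: "g \<cdot> f \<in> hom V a c" by (rule comp_hom[OF assms])
  have n: "name_arr V (g \<cdot> f) = ucomp V (vself V) a b c (name_arr V g) (name_arr V f)"
    by (rule unname_inject[of a c])
      (use assms gf ucomp_hom[OF vself_vcat, of a b c "name_arr V g" "name_arr V f"] in
        \<open>simp_all add: unname_ucomp hom_iff\<close>)
  have "vH F a c \<cdot> name_arr V (g \<cdot> f)
      = ucomp V Q (vO F a) (vO F b) (vO F c) (vH F b c \<cdot> name_arr V g) (vH F a b \<cdot> name_arr V f)"
    unfolding n by (rule vfunctor_ucomp[OF vself_vcat F_vfunctor]) (use assms in \<open>simp_all add: hom_iff\<close>)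
  then show ?thesis
    using und_F[OF gf] und_ucomp[OF _ _ _ F_hom[OF assms(2)] F_hom[OF assms(1)]] und_F[OF assms(1)] und_F[OF assms(2)]
    by simp
qed

text \<open>The structure map of \<open>A\<close> as an Eilenberg-Moore algebra of the monad; at a
  free algebra it is the multiplication.\<close>

definition counit :: "'o \<times> ('o, 'o, 'm) vfun \<Rightarrow> 'm" where
  "counit A = und (vO F (fst A)) A (\<epsilon> A)"

lemma mult_arr_counit: "c \<in> Obj V \<Longrightarrow> mult_arr V M c = counit (vO F c)"
  by (simp add: mult_arr_def counit_def und_def M_eq vfun_comp_def vO_U)

lemma \<epsilon>_hom: "A \<in> algs \<Longrightarrow> \<epsilon> A \<in> hom V \<I> (vHom Q (vO F (fst A)) A)"
  by (simp add: hom_iff)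

lemma counit_ahom: "A \<in> algs \<Longrightarrow> ahom (vO F (fst A)) A (counit A)"
  unfolding counit_def und_def by (intro underlying_ahom \<epsilon>_hom) simp_all

lemma counit_hom: "A \<in> algs \<Longrightarrow> counit A \<in> hom V (fst (vO F (fst A))) (fst A)"
  unfolding counit_def by (intro und_hom \<epsilon>_hom) simp_all

lemma unit_arr_hom: "c \<in> Obj V \<Longrightarrow> unit_arr V M c \<in> hom V c (fst (vO F c))"
  by (simp add: unit_arr_def hom_iff M_eq vfun_comp_def vO_U)

lemma name_unit_arr: "c \<in> Obj V \<Longrightarrow> name_arr V (unit_arr V M c) = \<eta> c"
  by (simp add: unit_arr_def M_eq vfun_comp_def vO_U)

lemma counit_unit:
  assumes "A \<in> algs"
  shows "counit A \<cdot> unit_arr V M (fst A) = \<ee> (fst A)"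
proof -
  let ?a = "fst A"
  have "ucomp V (vself V) ?a (fst (vO F ?a)) ?a (vH U (vO F ?a) A \<cdot> \<epsilon> A) (\<eta> ?a) = vId (vself V) ?a"
    using adj assms by (auto simp: is_vadjunction_def vObj_Q vO_U simp del: vself_simps)
  then have "unname_arr V ?a ?a (ucomp V (vself V) ?a (fst (vO F ?a)) ?a (vH U (vO F ?a) A \<cdot> \<epsilon> A) (\<eta> ?a)) = \<ee> ?a"
    using unname_vId[of ?a] assms by (simp del: vself_simps)
  then show ?thesis
    using assms by (simp add: unname_ucomp counit_def und_def unit_arr_def M_eq vfun_comp_def vO_U)
qed

text \<open>The triangle identity at \<open>F c\<close>, read in \<open>V\<close> through
  \<open>und\<close>; it is the unit law of the monad in which \<open>M\<close> is applied to the
  unit.\<close>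

lemma mult_unit:
  assumes "c \<in> Obj V"
  shows "counit (vO F c) \<cdot> monad_arr V M (unit_arr V M c) = \<ee> (fst (vO F c))"
proof -
  let ?A = "vO F c" let ?B = "vO F (fst ?A)"
  have "ucomp V Q ?A ?B ?A (\<epsilon> ?A) (vH F c (fst ?A) \<cdot> \<eta> c) = vId Q ?A"
    using adj assms by (auto simp: is_vadjunction_def vO_U)
  moreover have "und ?A ?B (vH F c (fst ?A) \<cdot> \<eta> c) = monad_arr V M (unit_arr V M c)"
    using und_F[OF unit_arr_hom[OF assms]] name_unit_arr[OF assms] by simp
  moreover have "vH F c (fst ?A) \<cdot> \<eta> c \<in> hom V \<I> (vHom Q ?A ?B)"
    using assms by (simp add: hom_iff)
  ultimately show ?thesis
    using und_ucomp[of ?A ?B ?A "\<epsilon> ?A" "vH F c (fst ?A) \<cdot> \<eta> c"] und_id[of ?A] assms \<epsilon>_hom[of ?A]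
    by (simp add: counit_def)
qed

text \<open>Fullness (\<open>underlying_full\<close>) lifts \<open>g\<close> to a global element of
  \<open>Q(A,B)\<close>, at which enriched naturality of the counit can be evaluated.\<close>

lemma counit_natural:
  assumes "A \<in> algs" "B \<in> algs" "ahom A B g"
  shows "counit B \<cdot> monad_arr V M g = g \<cdot> counit A"
proof -
  obtain h where h: "h \<in> hom V \<I> (vHom Q A B)" and Uh: "vH U A B \<cdot> h = name_arr V g"
    using underlying_full[OF assms] by blast
  have g: "g \<in> hom V (fst A) (fst B)" by (rule ahom_hom[OF assms(3)])
  have "ucomp V Q (vO F (fst A)) (vO F (fst B)) B (\<epsilon> B) (vH F (fst A) (fst B) \<cdot> name_arr V g)
      = ucomp V Q (vO F (fst A)) A B h (\<epsilon> A)"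
  proof -
    have e: "vH (vfun_comp V Q F U) A B \<cdot> h = vH F (fst A) (fst B) \<cdot> name_arr V g"
      using assms h by (simp add: vfun_comp_def vObj_Q vO_U hom_iff flip: Uh)
    show ?thesis
      using vtransformation_ucomp[OF Q_vcat Q_vcat vfun_comp_vfunctor[OF Q_vcat vself_vcat Q_vcat U_vfunctor F_vfunctor]
          vfun_id_vfunctor[OF Q_vcat] \<epsilon>_nat, of A B h] assms h
      unfolding e by (simp add: vfun_comp_def vfun_id_def vObj_Q vO_U hom_iff)
  qed
  moreover have "und A B h = g"
    using g by (simp add: und_def Uh hom_iff)
  ultimately show ?thesis
    using und_ucomp[of "vO F (fst A)" "vO F (fst B)" B "\<epsilon> B" "vH F (fst A) (fst B) \<cdot> name_arr V g"]
      und_ucomp[of "vO F (fst A)" A B h "\<epsilon> A"] und_F[OF g] F_hom[OF g] assms h \<epsilon>_hom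
    by (simp add: counit_def)
qed

text \<open>Precompose \<open>g\<close> with the identity in the form
  \<open>counit \<cdot> M unit\<close> and move \<open>g\<close> past the counit by naturality.
  Hence a homomorphism out of a free algebra is determined by its restriction along the
  unit.\<close>

lemma ahom_eq_counit:
  assumes "c \<in> Obj V" "A \<in> algs" "ahom (vO F c) A g"
  shows "g = counit A \<cdot> monad_arr V M (g \<cdot> unit_arr V M c)"
proof -
  have [simp]: "g \<in> Arr V" "Dom V g = fst (vO F c)" "Cod V g = fst A" using ahom_hom[OF assms(3)] by (auto simp: hom_iff)
  have m: "counit (vO F c) \<in> Arr V" "Dom V (counit (vO F c)) = fst (vO F (fst (vO F c)))" "Cod V (counit (vO F c)) = fst (vO F c)"
    "counit A \<in> Arr V" "Dom V (counit A) = fst (vO F (fst A))"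
    using counit_hom[of "vO F c"] counit_hom[of A] assms by (auto simp: hom_iff)
  have u: "monad_arr V M (unit_arr V M c) \<in> hom V (fst (vO F c)) (fst (vO F (fst (vO F c))))"
    "monad_arr V M g \<in> hom V (fst (vO F (fst (vO F c)))) (fst (vO F (fst A)))"
    by (intro monad_arr_hom unit_arr_hom assms) (intro monad_arr_hom ahom_hom assms)
  have "g = g \<cdot> (counit (vO F c) \<cdot> monad_arr V M (unit_arr V M c))"
    using assms by (simp add: mult_unit)
  also have "\<dots> = (counit A \<cdot> monad_arr V M g) \<cdot> monad_arr V M (unit_arr V M c)"
    by (rule reassoc) (use assms m u counit_natural[of "vO F c" A g] in \<open>simp_all add: hom_iff\<close>)
  also have "\<dots> = counit A \<cdot> monad_arr V M (g \<cdot> unit_arr V M c)"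
    using m u by (simp add: monad_arr_comp[OF unit_arr_hom[OF assms(1)] ahom_hom[OF assms(3)]] hom_iff)
  finally show ?thesis .
qed

lemma monad_arr_natural_unit:
  assumes "f \<in> hom V a b"
  shows "monad_arr V M f \<cdot> unit_arr V M a = unit_arr V M b \<cdot> f"
proof -
  have o [simp]: "a \<in> Obj V" "b \<in> Obj V" using hom_objs[OF assms] by auto
  have f [simp]: "f \<in> Arr V" "Dom V f = a" "Cod V f = b" using assms by (auto simp: hom_iff)
  have "ucomp V (vself V) a b (fst (vO F b)) (\<eta> b) (name_arr V f)
      = ucomp V (vself V) a (fst (vO F a)) (fst (vO F b)) (vH (mFun M) a b \<cdot> name_arr V f) (\<eta> a)"
    using vtransformation_ucomp[OF vself_vcat vself_vcat vfun_id_vfunctor[OF vself_vcat]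
        vfun_comp_vfunctor[OF vself_vcat Q_vcat vself_vcat F_vfunctor U_vfunctor] \<eta>_nat, of a b "name_arr V f"]
    by (simp add: vfun_comp_def vfun_id_def vO_U hom_iff)
  from arg_cong[OF this, of "unname_arr V a (fst (vO F b))"] show ?thesis
    by (simp add: unname_ucomp unit_arr_def monad_arr_def M_eq vfun_comp_def vO_U)
qed

end

sublocale induced_monad \<subseteq> free_algebra_monad V P T J M "vO F"
proof
  fix c assume c: "c \<in> Obj V"
  show "vO F c \<in> algs" "fst (vO F c) = vO (mFun M) c" "unit_arr V M c \<in> hom V c (vO (mFun M) c)"
    using c unit_arr_hom by auto
  fix A assume A: "A \<in> algs"
  show "g = g'" if "ahom (vO F c) A g" "ahom (vO F c) A g'" "g \<cdot> unit_arr V M c = g' \<cdot> unit_arr V M c" for g g'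
    using ahom_eq_counit[OF c A] that by metis
  fix f assume f: "f \<in> hom V c (fst A)"
  \<comment> \<open>The extension of \<open>f\<close> is \<open>M f\<close> followed by the
    structure map of \<open>A\<close>; it restricts to \<open>f\<close> by naturality of the unit
    and a triangle identity.\<close>
  have "ahom (vO F c) A (counit A \<cdot> monad_arr V M f)"
    using A c f counit_ahom[OF A] underlying_ahom[OF _ _ F_hom[OF f]] und_F[OF f]
    by (intro ahom_comp[of _ "vO F (fst A)"]) (simp_all add: und_def)
  moreover have "(counit A \<cdot> monad_arr V M f) \<cdot> unit_arr V M c = f"
  proof -
    have "(counit A \<cdot> monad_arr V M f) \<cdot> unit_arr V M c = counit A \<cdot> (unit_arr V M (fst A) \<cdot> f)"
      using counit_hom[OF A] monad_arr_hom[OF f] unit_arr_hom[OF c] monad_arr_natural_unit[OF f]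
      by (simp add: hom_iff)
    also have "\<dots> = \<ee> (fst A) \<cdot> f"
      by (rule reassoc) (use counit_hom[OF A] unit_arr_hom[of "fst A"] f A counit_unit in \<open>simp_all add: hom_iff\<close>)
    finally show ?thesis using f by (simp add: hom_iff)
  qed
  ultimately show "\<exists>g. ahom (vO F c) A g \<and> g \<cdot> unit_arr V M c = f" by blast
next
  fix f a b assume f: "f \<in> hom V a b"
  then show "ahom (vO F a) (vO F b) (monad_arr V M f)"
    using underlying_ahom[OF _ _ F_hom[OF f]] und_F[OF f] hom_objs[OF f] by (simp add: und_def)
  show "monad_arr V M f \<cdot> unit_arr V M a = unit_arr V M b \<cdot> f"
    by (rule monad_arr_natural_unit[OF f])
qed

context symmetric_monoidal_closed
begin

lemma discrete_counit:
  assumes "is_unit_copower V (hom V \<I> x) x0 \<iota>" "x \<in> Obj V"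
  shows "discrete_counit V x x0 \<iota> \<in> hom V x0 x"
    and "s \<in> hom V \<I> x \<Longrightarrow> discrete_counit V x x0 \<iota> \<cdot> \<iota> s = s"
proof -
  have "\<exists>!d. d \<in> hom V x0 x \<and> (\<forall>s \<in> hom V \<I> x. d \<cdot> \<iota> s = s)"
    using assms(1)[unfolded is_unit_copower_def] assms(2) by (elim conjE) (drule bspec, assumption, auto)
  from theI'[OF this] show "discrete_counit V x x0 \<iota> \<in> hom V x0 x"
    "s \<in> hom V \<I> x \<Longrightarrow> discrete_counit V x x0 \<iota> \<cdot> \<iota> s = s"
    unfolding discrete_counit_def by auto
qed

end

context induced_monad
begin

lemma counit_simps [simp]:
  "A \<in> algs \<Longrightarrow> counit A \<in> Arr V" "A \<in> algs \<Longrightarrow> Dom V (counit A) = fst (vO F (fst A))"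
  "A \<in> algs \<Longrightarrow> Cod V (counit A) = fst A"
  using counit_hom[of A] by (auto simp: hom_iff)

text \<open>Naturality of the counit on whole hom objects, which is more than its values at global
  elements. It says that \<open>vH U A B\<close> equalizes the pair defining Eilenberg-Moore hom
  objects; at free algebras this lets the action of the monad on hom objects factor through
  them.\<close>

lemma counit_vnatural:
  assumes [simp]: "A \<in> algs" "B \<in> algs"
  defines "a \<equiv> fst A" and "b \<equiv> fst B"
  shows "curry_arr V (ihom a b) (Mo a) b (ev a b \<cdot> (\<ee> (ihom a b) \<odot> counit A)) \<cdot> vH U A B
    = curry_arr V (ihom (Mo a) (Mo b)) (Mo a) b (counit B \<cdot> ev (Mo a) (Mo b)) \<cdot> vH (mFun M) a b \<cdot> vH U A B"
proof -
  have [simp]: "a \<in> Obj V" "b \<in> Obj V" by (simp_all add: a_def b_def)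
  have [simp]: "fst A = a" "fst B = b" by (simp_all add: a_def b_def)
  let ?H = "vHom Q A B" and ?FA = "vO F a" and ?FB = "vO F b"
  have nat: "vComp Q ?FA ?FB B \<cdot> (\<epsilon> B \<odot> (vH F a b \<cdot> vH U A B)) = vComp Q ?FA A B \<cdot> (\<ee> ?H \<odot> \<epsilon> A) \<cdot> \<ss> \<I> ?H"
  proof -
    have "\<forall>A \<in> algs. \<forall>B \<in> algs. vComp Q (vO F (fst A)) (vO F (fst B)) B \<cdot> (\<epsilon> B \<odot> (vH F (fst A) (fst B) \<cdot> vH U A B))
        = vComp Q (vO F (fst A)) A B \<cdot> (\<ee> (vHom Q A B) \<odot> \<epsilon> A) \<cdot> \<ss> \<I> (vHom Q A B)"
      using \<epsilon>_nat by (simp add: vtransformation_def vnatural_family_def vfun_id_def vfun_comp_def vObj_Q vO_U)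
    from bspec[OF bspec[OF this assms(1)] assms(2)] show ?thesis by simp
  qed
  have "icomp (Mo a) (Mo b) b \<cdot> ((vH U ?FB B \<cdot> \<epsilon> B) \<odot> (vH U ?FA ?FB \<cdot> vH F a b \<cdot> vH U A B))
      = (icomp (Mo a) (Mo b) b \<cdot> (vH U ?FB B \<odot> vH U ?FA ?FB)) \<cdot> (\<epsilon> B \<odot> (vH F a b \<cdot> vH U A B))"
    by simp
  also have "icomp (Mo a) (Mo b) b \<cdot> (vH U ?FB B \<odot> vH U ?FA ?FB) = vH U ?FA B \<cdot> vComp Q ?FA ?FB B"
    by (simp add: vfunctor_comp[OF U_vfunctor] vObj_Q vO_U)
  also have "(vH U ?FA B \<cdot> vComp Q ?FA ?FB B) \<cdot> (\<epsilon> B \<odot> (vH F a b \<cdot> vH U A B))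
      = vH U ?FA B \<cdot> (vComp Q ?FA ?FB B \<cdot> (\<epsilon> B \<odot> (vH F a b \<cdot> vH U A B)))"
    by simp
  also have "\<dots> = (vH U ?FA B \<cdot> vComp Q ?FA A B) \<cdot> (\<ee> ?H \<odot> \<epsilon> A) \<cdot> \<ss> \<I> ?H"
    unfolding nat by simp
  also have "vH U ?FA B \<cdot> vComp Q ?FA A B = icomp (Mo a) a b \<cdot> (vH U A B \<odot> vH U ?FA A)"
    by (simp add: vfunctor_comp[OF U_vfunctor] vObj_Q vO_U)
  finally have *: "icomp (Mo a) (Mo b) b \<cdot> ((vH U ?FB B \<cdot> \<epsilon> B) \<odot> (vH U ?FA ?FB \<cdot> vH F a b \<cdot> vH U A B))
      = (icomp (Mo a) a b \<cdot> (vH U A B \<odot> (vH U ?FA A \<cdot> \<epsilon> A))) \<cdot> \<ss> \<I> ?H"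
    by simp
  have u: "unname_arr V (fst ?FA) a (vH U ?FA A \<cdot> \<epsilon> A) = counit A" "unname_arr V (fst ?FB) b (vH U ?FB B \<cdot> \<epsilon> B) = counit B"
    by (simp_all add: counit_def und_def)
  have "curry_arr V ?H (Mo a) b (counit B \<cdot> ev (Mo a) (Mo b) \<cdot> ((vH (mFun M) a b \<cdot> vH U A B) \<odot> \<ee> (Mo a))) \<cdot> \<ll> ?H
      = curry_arr V ?H (Mo a) b (ev a b \<cdot> (vH U A B \<odot> counit A)) \<cdot> \<ll> ?H"
    using * by (simp add: icomp_left_name icomp_right_name u runit_symm)
  then have "curry_arr V ?H (Mo a) b (counit B \<cdot> ev (Mo a) (Mo b) \<cdot> ((vH (mFun M) a b \<cdot> vH U A B) \<odot> \<ee> (Mo a)))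
      = curry_arr V ?H (Mo a) b (ev a b \<cdot> (vH U A B \<odot> counit A))"
    by (rule iso_epic[rotated]) simp_all
  then show ?thesis
    by (simp add: curry_comp)
qed

section \<open>Global elements of Eilenberg-Moore hom objects between free algebras\<close>

context
  fixes E :: "('o \<times> 'm, 'o, 'm) vcat" and W :: "('o \<times> 'm, 'o, 'm) vfun"
  assumes em: "is_eilenberg_moore V M E W"
begin

abbreviation "fr \<equiv> free_alg V M"

lemma E_vcat: "is_vcat V E" and W_vfunctor: "is_vfunctor V E (vself V) W"
  using em by (auto simp: is_eilenberg_moore_def)

text \<open>As the multiplication is the counit at a free algebra, the Eilenberg-Moore axioms are a
  triangle identity and naturality of the counit with respect to itself.\<close>

lemma fr_em [simp]:
  assumes [simp]: "c \<in> Obj V" shows "fr c \<in> vObj E"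
proof -
  have "counit (vO F c) \<cdot> Ma (counit (vO F c)) = counit (vO F c) \<cdot> counit (vO F (Mo c))"
    using counit_natural[of "vO F (Mo c)" "vO F c" "counit (vO F c)"] counit_ahom[of "vO F c"] by simp
  moreover have "counit (vO F c) \<cdot> unit (Mo c) = \<ee> (Mo c)"
    using counit_unit[of "vO F c"] by simp
  ultimately show ?thesis
    using em by (simp add: is_eilenberg_moore_def free_alg_def mult_arr_counit hom_iff)
qed

lemma vO_W [simp]: "c \<in> Obj V \<Longrightarrow> vO W (fr c) = Mo c"
  using em fr_em[of c] by (auto simp: is_eilenberg_moore_def free_alg_def)

lemma W_simps [simp]:
  assumes "x \<in> Obj V" "y \<in> Obj V"
  shows "vH W (fr x) (fr y) \<in> Arr V" "Dom V (vH W (fr x) (fr y)) = vHom E (fr x) (fr y)"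
    "Cod V (vH W (fr x) (fr y)) = ihom (Mo x) (Mo y)" "vHom E (fr x) (fr y) \<in> Obj V"
  using vfunctorD[OF W_vfunctor, of "fr x"] vcatD[OF E_vcat, of "fr x"] fr_em vO_W assms by (simp_all del: M_simps)

text \<open>The parallel pair whose equalizer is the object of homomorphisms between free algebras.\<close>

abbreviation "l_arr x y \<equiv> curry_arr V (ihom (Mo x) (Mo y)) (Mo (Mo x)) (Mo y) (ev (Mo x) (Mo y) \<cdot> (\<ee> (ihom (Mo x) (Mo y)) \<odot> counit (vO F x)))"
abbreviation "r_arr x y \<equiv> curry_arr V (ihom (Mo (Mo x)) (Mo (Mo y))) (Mo (Mo x)) (Mo y) (counit (vO F y) \<cdot> ev (Mo (Mo x)) (Mo (Mo y))) \<cdot> vH (mFun M) (Mo x) (Mo y)"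

lemma em_equalizer:
  assumes "x \<in> Obj V" "y \<in> Obj V"
  shows "is_equalizer V
    (l_arr x y)
    (r_arr x y)
    (vH W (fr x) (fr y))"
proof -
  have "\<forall>(x, a) \<in> vObj E. \<forall>(y, b) \<in> vObj E.
        is_equalizer V
          (curry_arr V (Ihom V x y) (vO (mFun M) x) y (Ev V x y \<cdot> (Id V (Ihom V x y) \<odot> a)))
          (curry_arr V (Ihom V (vO (mFun M) x) (vO (mFun M) y)) (vO (mFun M) x) y
             (b \<cdot> Ev V (vO (mFun M) x) (vO (mFun M) y)) \<cdot> vH (mFun M) x y)
          (vH W (x, a) (y, b))"
    using em unfolding is_eilenberg_moore_def by blast
  from bspec[OF this fr_em[OF assms(1)]] fr_em[OF assms(2)] show ?thesis
    using assms by (auto simp: free_alg_def mult_arr_counit simp del: M_simps)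
qed

lemma em_factor:
  assumes "x \<in> Obj V" "y \<in> Obj V" "Cod V r = ihom (Mo x) (Mo y)" "r \<in> Arr V"
    "l_arr x y \<cdot> r
    = r_arr x y \<cdot> r"
  shows "\<exists>!h. h \<in> hom V (Dom V r) (vHom E (fr x) (fr y)) \<and> vH W (fr x) (fr y) \<cdot> h = r"
proof -
  have "r \<in> hom V (Dom V r) (ihom (Mo x) (Mo y))" using assms by (simp add: hom_iff)
  then show ?thesis
    using em_equalizer[OF assms(1,2)] assms unfolding is_equalizer_def by simp
qed

text \<open>Uncurrying the two composites at the name of \<open>f\<close> gives \<open>f\<close>
  after one multiplication and the other multiplication after \<open>M f\<close>, so the equalizer
  condition is the homomorphism law between free algebras.\<close>

lemma equalizes_iff:
  assumes [simp]: "x \<in> Obj V" "y \<in> Obj V" and f: "f \<in> hom V (Mo x) (Mo y)"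
  shows "l_arr x y \<cdot> name_arr V f
    = r_arr x y \<cdot> name_arr V f
    \<longleftrightarrow> f \<cdot> counit (vO F x) = counit (vO F y) \<cdot> Ma f" (is "?l = ?r \<longleftrightarrow> ?c")
proof -
  have [simp]: "f \<in> Arr V" "Dom V f = fst (vO F x)" "Cod V f = fst (vO F y)" using f by (auto simp: hom_iff)
  have Mf: "Ma f \<in> Arr V" "Dom V (Ma f) = Mo (Mo x)" "Cod V (Ma f) = Mo (Mo y)" using Ma_simps[of f] by auto
  have "?l = curry_arr V \<I> (Mo (Mo x)) (Mo y) (ev (Mo x) (Mo y) \<cdot> (name_arr V f \<odot> \<ee> (Mo x)) \<cdot> (\<ee> \<I> \<odot> counit (vO F x)))"
    by (simp add: curry_comp)
  also have "ev (Mo x) (Mo y) \<cdot> (name_arr V f \<odot> \<ee> (Mo x)) \<cdot> (\<ee> \<I> \<odot> counit (vO F x))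
      = (f \<cdot> \<ll> (Mo x)) \<cdot> (\<ee> \<I> \<odot> counit (vO F x))"
    by (rule reassoc) (simp_all add: ev_unname)
  also have "\<dots> = (f \<cdot> counit (vO F x)) \<cdot> \<ll> (Mo (Mo x))"
    by (simp add: nat_lunit)
  finally have l: "?l = curry_arr V \<I> (Mo (Mo x)) (Mo y) ((f \<cdot> counit (vO F x)) \<cdot> \<ll> (Mo (Mo x)))" .
  have "?r = curry_arr V \<I> (Mo (Mo x)) (Mo y) (counit (vO F y) \<cdot> ev (Mo (Mo x)) (Mo (Mo y)) \<cdot> ((vH (mFun M) (Mo x) (Mo y) \<cdot> name_arr V f) \<odot> \<ee> (Mo (Mo x))))"
    by (simp add: curry_comp)
  also have "ev (Mo (Mo x)) (Mo (Mo y)) \<cdot> ((vH (mFun M) (Mo x) (Mo y) \<cdot> name_arr V f) \<odot> \<ee> (Mo (Mo x))) = Ma f \<cdot> \<ll> (Mo (Mo x))"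
    by (simp add: ev_unname monad_arr_def)
  finally have r: "?r = curry_arr V \<I> (Mo (Mo x)) (Mo y) ((counit (vO F y) \<cdot> Ma f) \<cdot> \<ll> (Mo (Mo x)))"
    using Mf by simp
  show ?thesis
    unfolding l r
  proof
    assume "curry_arr V \<I> (Mo (Mo x)) (Mo y) ((f \<cdot> counit (vO F x)) \<cdot> \<ll> (Mo (Mo x)))
      = curry_arr V \<I> (Mo (Mo x)) (Mo y) ((counit (vO F y) \<cdot> Ma f) \<cdot> \<ll> (Mo (Mo x)))"
    then have "(f \<cdot> counit (vO F x)) \<cdot> \<ll> (Mo (Mo x)) = (counit (vO F y) \<cdot> Ma f) \<cdot> \<ll> (Mo (Mo x))"
      by (rule curry_inject) (use Mf in simp_all)
    then show ?c
      by (rule iso_epic[rotated]) (use Mf in simp_all)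
  qed simp
qed

text \<open>Justifies the \<open>THE\<close> in \<open>induced_theory_functor\<close>. The action of
  \<open>M\<close> on hom objects is that of \<open>U\<close> after that of \<open>F\<close>, and
  the \<open>U\<close> part equalizes the defining pair by \<open>counit_vnatural\<close>.\<close>

lemma induced_functor:
  assumes "x \<in> Obj V" "y \<in> Obj V"
  shows "vH (induced_theory_functor V P M E W) x y \<in> hom V (ihom x y) (vHom E (fr x) (fr y))"
    "vH W (fr x) (fr y) \<cdot> vH (induced_theory_functor V P M E W) x y = vH (mFun M) x y"
proof -
  let ?f1 = "l_arr x y"
  let ?f2 = "curry_arr V (ihom (Mo (Mo x)) (Mo (Mo y))) (Mo (Mo x)) (Mo y) (counit (vO F y) \<cdot> ev (Mo (Mo x)) (Mo (Mo y)))"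
  have "?f1 \<cdot> vH (mFun M) x y = (?f1 \<cdot> vH U (vO F x) (vO F y)) \<cdot> vH F x y"
    using assms by simp
  also have "\<dots> = ?f2 \<cdot> vH (mFun M) (Mo x) (Mo y) \<cdot> vH (mFun M) x y"
    using assms counit_vnatural[of "vO F x" "vO F y"] by (simp del: assoc) simp
  finally have "\<exists>!h. h \<in> hom V (Dom V (vH (mFun M) x y)) (vHom E (fr x) (fr y)) \<and> vH W (fr x) (fr y) \<cdot> h = vH (mFun M) x y"
    using assms by (intro em_factor) simp_all
  from theI'[OF this] show "vH (induced_theory_functor V P M E W) x y \<in> hom V (ihom x y) (vHom E (fr x) (fr y))"
    "vH W (fr x) (fr y) \<cdot> vH (induced_theory_functor V P M E W) x y = vH (mFun M) x y"
    using assms by (simp_all add: induced_theory_functor_def)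
qed

text \<open>The correspondence \<open>EM(M I, M x) = V(I, M x)\<close> given by freeness of
  \<open>M I\<close>: restrict a homomorphism along the unit of the monad.\<close>

definition element :: "'o \<Rightarrow> 'm \<Rightarrow> 'm" where
  "element x h = unname_arr V (Mo \<I>) (Mo x) (vH W (fr \<I>) (fr x) \<cdot> h) \<cdot> unit \<I>"

text \<open>The equalizer property identifies global elements of the hom object with homomorphisms
  out of \<open>M I\<close>, and such a homomorphism is recovered from its restriction
  \<open>e\<close> as the multiplication after \<open>M e\<close>.\<close>

lemma element_bij:
  assumes [simp]: "x \<in> Obj V"
  shows "bij_betw (element x) (hom V \<I> (vHom E (fr \<I>) (fr x))) (hom V \<I> (Mo x))"
proof (rule bij_betwI')
  let ?f = "\<lambda>h. unname_arr V (Mo \<I>) (Mo x) (vH W (fr \<I>) (fr x) \<cdot> h)"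
  have c: "counit (vO F x) \<in> hom V (Mo (Mo x)) (Mo x)" using counit_hom[of "vO F x"] by simp
  \<comment> \<open>The equalizer condition at \<open>h\<close> is the homomorphism law for
    \<open>?f h\<close>. Precomposing it with \<open>M\<close> of the unit and using
    \<open>mult_unit\<close> expresses the arrow through its restriction.\<close>
  have eq: "?f h \<in> hom V (Mo \<I>) (Mo x) \<and> ?f h = counit (vO F x) \<cdot> Ma (element x h)"
    if h: "h \<in> hom V \<I> (vHom E (fr \<I>) (fr x))" for h
  proof -
    have f: "?f h \<in> hom V (Mo \<I>) (Mo x)" using h by (simp add: hom_iff)
    have n: "name_arr V (?f h) = vH W (fr \<I>) (fr x) \<cdot> h" using h by (simp add: hom_iff del: M_simps)
    let ?f1 = "l_arr \<I> x"
    let ?f2 = "r_arr \<I> x"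
    have "(?f1 \<cdot> vH W (fr \<I>) (fr x)) \<cdot> h = (?f2 \<cdot> vH W (fr \<I>) (fr x)) \<cdot> h"
      using em_equalizer[of \<I> x] unfolding is_equalizer_def by simp
    then have "?f h \<cdot> counit (vO F \<I>) = counit (vO F x) \<cdot> Ma (?f h)"
      using h by (subst equalizes_iff[symmetric]) (use f in \<open>simp_all add: n hom_iff\<close>)
    then have "(?f h \<cdot> counit (vO F \<I>)) \<cdot> Ma (unit \<I>) = (counit (vO F x) \<cdot> Ma (?f h)) \<cdot> Ma (unit \<I>)" by simp
    moreover have "Ma (unit \<I>) \<in> hom V (Mo \<I>) (Mo (Mo \<I>))" "Ma (?f h) \<in> hom V (Mo (Mo \<I>)) (Mo (Mo x))"
      by (intro Ma_hom unit_hom f unit_obj)+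
    ultimately have "?f h \<cdot> (counit (vO F \<I>) \<cdot> Ma (unit \<I>)) = counit (vO F x) \<cdot> (Ma (?f h) \<cdot> Ma (unit \<I>))"
      using f c by (simp add: hom_iff)
    moreover have "Ma (?f h) \<cdot> Ma (unit \<I>) = Ma (?f h \<cdot> unit \<I>)"
      using Ma_comp[OF unit_hom[OF unit_obj] f] by simp
    ultimately have "?f h = counit (vO F x) \<cdot> Ma (?f h \<cdot> unit \<I>)"
      using mult_unit[OF unit_obj] f by (simp add: hom_iff)
    then show ?thesis using f by (simp add: element_def)
  qed
  show "element x h \<in> hom V \<I> (Mo x)" if "h \<in> hom V \<I> (vHom E (fr \<I>) (fr x))" for h
    using eq[OF that] unit_hom[OF unit_obj] unfolding element_def by (auto simp: hom_iff)
  show "element x h = element x h' \<longleftrightarrow> h = h'"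
    if h: "h \<in> hom V \<I> (vHom E (fr \<I>) (fr x))" "h' \<in> hom V \<I> (vHom E (fr \<I>) (fr x))" for h h'
  proof
    assume "element x h = element x h'"
    then have "?f h = ?f h'" using eq[OF h(1)] eq[OF h(2)] by simp
    then have Wh: "vH W (fr \<I>) (fr x) \<cdot> h = vH W (fr \<I>) (fr x) \<cdot> h'"
      by (rule unname_inject) (use h in \<open>simp_all add: hom_iff\<close>)
    let ?f1 = "l_arr \<I> x"
    let ?f2 = "r_arr \<I> x"
    have "(?f1 \<cdot> vH W (fr \<I>) (fr x)) \<cdot> h = (?f2 \<cdot> vH W (fr \<I>) (fr x)) \<cdot> h"
      using em_equalizer[of \<I> x] unfolding is_equalizer_def by simp
    then have "\<exists>!k. k \<in> hom V (Dom V (vH W (fr \<I>) (fr x) \<cdot> h)) (vHom E (fr \<I>) (fr x)) \<and> vH W (fr \<I>) (fr x) \<cdot> k = vH W (fr \<I>) (fr x) \<cdot> h"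
      by (intro em_factor) (use h in \<open>simp_all add: hom_iff\<close>)
    moreover have "Dom V (vH W (fr \<I>) (fr x) \<cdot> h) = \<I>" using h by (simp add: hom_iff)
    ultimately show "h = h'" using h Wh by metis
  qed simp
  show "\<exists>h \<in> hom V \<I> (vHom E (fr \<I>) (fr x)). e = element x h" if e: "e \<in> hom V \<I> (Mo x)" for e
  proof -
    define f where "f = counit (vO F x) \<cdot> Ma e"
    have Me: "Ma e \<in> hom V (Mo \<I>) (Mo (Mo x))" by (rule Ma_hom[OF e])
    have f: "f \<in> hom V (Mo \<I>) (Mo x)" using c Me unfolding f_def by (rule comp_hom[rotated])
    have f_ahom: "ahom (vO F \<I>) (vO F x) f"
      unfolding f_def
      by (rule ahom_comp[of _ "vO F (Mo x)"]) (use monad_arr_ahom[OF e] counit_ahom[of "vO F x"] in simp_all)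
    have "f \<cdot> counit (vO F \<I>) = counit (vO F x) \<cdot> Ma f"
      using counit_natural[OF _ _ f_ahom] by simp
    then have "\<exists>!h. h \<in> hom V (Dom V (name_arr V f)) (vHom E (fr \<I>) (fr x)) \<and> vH W (fr \<I>) (fr x) \<cdot> h = name_arr V f"
      by (intro em_factor, simp_all only: equalizes_iff[OF unit_obj assms f]) (use f in \<open>simp_all add: hom_iff\<close>)
    then obtain h where h: "h \<in> hom V \<I> (vHom E (fr \<I>) (fr x))" "vH W (fr \<I>) (fr x) \<cdot> h = name_arr V f"
      using f by (auto simp: hom_iff)
    have "element x h = counit (vO F x) \<cdot> (Ma e \<cdot> unit \<I>)"
      using f h c Me unit_hom[OF unit_obj] by (simp add: element_def hom_iff) (simp add: f_def)
    also have "\<dots> = (counit (vO F x) \<cdot> unit (Mo x)) \<cdot> e"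
      using monad_arr_unit[OF e] c e unit_hom[OF Mo_obj[OF assms]] by (simp add: hom_iff)
    also have "\<dots> = e"
      using counit_unit[of "vO F x"] e by (simp add: hom_iff)
    finally show ?thesis using h by blast
  qed
qed

text \<open>\<open>W\<close> preserves composition and sends the image of \<open>d\<close> in the
  induced theory to the name of \<open>M d\<close>.\<close>

lemma element_ucomp:
  assumes [simp]: "x \<in> Obj V" "y \<in> Obj V" and d: "d \<in> hom V x y" and h: "h \<in> hom V \<I> (vHom E (fr \<I>) (fr x))"
  shows "element y (ucomp V E (fr \<I>) (fr x) (fr y) (vH (induced_theory_functor V P M E W) x y \<cdot> name_arr V d) h)
    = Ma d \<cdot> element x h"
proof -
  let ?J = "vH (induced_theory_functor V P M E W) x y"
  note J = induced_functor[of x y]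
  have Jd: "?J \<cdot> name_arr V d \<in> hom V \<I> (vHom E (fr x) (fr y))"
    using J d by (simp add: hom_iff)
  have "vH W (fr x) (fr y) \<cdot> (?J \<cdot> name_arr V d) = vH (mFun M) x y \<cdot> name_arr V d"
    by (rule reassoc) (use J d in \<open>simp_all add: hom_iff\<close>)
  then have W: "unname_arr V (Mo x) (Mo y) (vH W (fr x) (fr y) \<cdot> (?J \<cdot> name_arr V d)) = Ma d"
    using d by (simp add: monad_arr_def hom_iff)
  have "unname_arr V (Mo \<I>) (Mo y) (vH W (fr \<I>) (fr y) \<cdot> ucomp V E (fr \<I>) (fr x) (fr y) (?J \<cdot> name_arr V d) h)
      = Ma d \<cdot> unname_arr V (Mo \<I>) (Mo x) (vH W (fr \<I>) (fr x) \<cdot> h)"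
    using vfunctor_ucomp_self[OF E_vcat W_vfunctor _ _ _ Jd h] W by (simp del: M_simps)
  moreover have "Ma d \<in> hom V (Mo x) (Mo y)" by (rule Ma_hom[OF d])
  ultimately show ?thesis
    using h unit_hom[OF unit_obj] by (simp add: element_def hom_iff)
qed

text \<open>The isomorphism from \<open>T\<close> to the induced theory followed by
  \<open>element\<close> identifies arrows \<open>J I -> J x\<close> with global elements of
  \<open>M x\<close>, and turns composition with \<open>J d\<close> into composition with
  \<open>M d\<close>.\<close>

lemma discrete_iff:
  assumes iso: "isomorphic_pretheories V P T J (induced_theory V P M E) (induced_theory_functor V P M E W)"
    and unitP [simp]: "\<I> \<in> P"
  shows "is_discrete V P T J \<longleftrightarrow>
    (\<forall>x \<in> P. \<forall>x0 \<in> P. \<forall>\<iota>. is_unit_copower V (hom V \<I> x) x0 \<iota> \<longrightarrow>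
      (\<forall>e \<in> hom V \<I> (Mo x). \<exists>e' \<in> hom V \<I> (Mo x0). e = Ma (discrete_counit V x x0 \<iota>) \<cdot> e'))"
proof -
  let ?T = "induced_theory V P M E" and ?J = "induced_theory_functor V P M E W"
  obtain \<phi> where \<phi>: "is_vfunctor V T ?T \<phi>" and \<phi>O [simp]: "\<And>x. x \<in> P \<Longrightarrow> vO \<phi> x = x"
    and \<phi>_iso: "\<And>x y. x \<in> P \<Longrightarrow> y \<in> P \<Longrightarrow> is_iso V (vH \<phi> x y)"
    and \<phi>J: "\<And>x y. x \<in> P \<Longrightarrow> y \<in> P \<Longrightarrow> vH \<phi> x y \<cdot> vH J x y = vH ?J x y"
    using iso unfolding isomorphic_pretheories_def by blast
  have T' [simp]: "vHom ?T a b = vHom E (fr a) (fr b)" "vComp ?T a b c = vComp E (fr a) (fr b) (fr c)" for a b c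
    by (simp_all add: induced_theory_def)
  have \<phi>_simps [simp]: "vH \<phi> a b \<in> Arr V" "Dom V (vH \<phi> a b) = vHom T a b" "Cod V (vH \<phi> a b) = vHom E (fr a) (fr b)"
    if "a \<in> P" "b \<in> P" for a b
    using vfunctorD[OF \<phi>] that by simp_all
  define K where "K x h = element x (vH \<phi> \<I> x \<cdot> h)" for x h
  have K: "bij_betw (K x) (hom V \<I> (vHom T \<I> x)) (hom V \<I> (Mo x))" if [simp]: "x \<in> P" for x
  proof -
    have "bij_betw (\<lambda>h. vH \<phi> \<I> x \<cdot> h) (hom V \<I> (vHom T \<I> x)) (hom V \<I> (vHom E (fr \<I>) (fr x)))"
      by (rule bij_betw_byWitness[of _ "\<lambda>k. inva (vH \<phi> \<I> x) \<cdot> k"])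
        (use \<phi>_iso[of \<I> x] in \<open>auto simp: hom_iff\<close>)
    from bij_betw_trans[OF this element_bij[of x]] show ?thesis
      by (simp add: K_def[abs_def] comp_def)
  qed
  have KJ: "K x (ucomp V T \<I> x0 x (vH J x0 x \<cdot> name_arr V d) f) = Ma d \<cdot> K x0 f"
    if [simp]: "x \<in> P" "x0 \<in> P" and d: "d \<in> hom V x0 x" and f: "f \<in> hom V \<I> (vHom T \<I> x0)" for x x0 d f
  proof -
    have "vH J x0 x \<cdot> name_arr V d \<in> hom V \<I> (vHom T x0 x)"
      using d by (simp add: hom_iff)
    moreover have "vComp E (fr \<I>) (fr x0) (fr x) \<in> Arr V"
      "Dom V (vComp E (fr \<I>) (fr x0) (fr x)) = vHom E (fr x0) (fr x) \<otimes> vHom E (fr \<I>) (fr x0)"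
      using vcatD[OF E_vcat] by simp_all
    ultimately have "vH \<phi> \<I> x \<cdot> ucomp V T \<I> x0 x (vH J x0 x \<cdot> name_arr V d) f
        = ucomp V ?T \<I> x0 x (vH \<phi> x0 x \<cdot> vH J x0 x \<cdot> name_arr V d) (vH \<phi> \<I> x0 \<cdot> f)"
      using vfunctor_ucomp[OF T_vcat \<phi>, of \<I> x0 x "vH J x0 x \<cdot> name_arr V d" f] f by simp
    also have "vH \<phi> x0 x \<cdot> vH J x0 x \<cdot> name_arr V d = vH ?J x0 x \<cdot> name_arr V d"
      by (rule reassoc) (use d in \<open>simp_all add: \<phi>J hom_iff\<close>)
    also have "ucomp V ?T \<I> x0 x (vH ?J x0 x \<cdot> name_arr V d) (vH \<phi> \<I> x0 \<cdot> f)
        = ucomp V E (fr \<I>) (fr x0) (fr x) (vH ?J x0 x \<cdot> name_arr V d) (vH \<phi> \<I> x0 \<cdot> f)"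
      by (simp add: ucomp_def)
    finally have "K x (ucomp V T \<I> x0 x (vH J x0 x \<cdot> name_arr V d) f)
        = element x (ucomp V E (fr \<I>) (fr x0) (fr x) (vH ?J x0 x \<cdot> name_arr V d) (vH \<phi> \<I> x0 \<cdot> f))"
      unfolding K_def by (rule arg_cong)
    also have "\<dots> = Ma d \<cdot> K x0 f"
      unfolding K_def by (rule element_ucomp) (use d f in \<open>simp_all add: hom_iff\<close>)
    finally show ?thesis .
  qed
  have "(\<forall>g \<in> hom V \<I> (vHom T \<I> x). \<exists>f \<in> hom V \<I> (vHom T \<I> x0). g = ucomp V T \<I> x0 x (vH J x0 x \<cdot> name_arr V d) f)
    \<longleftrightarrow> (\<forall>e \<in> hom V \<I> (Mo x). \<exists>e' \<in> hom V \<I> (Mo x0). e = Ma d \<cdot> e')"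
    if x: "x \<in> P" "x0 \<in> P" and d: "d \<in> hom V x0 x" for x x0 d
  proof -
    have uc: "ucomp V T \<I> x0 x (vH J x0 x \<cdot> name_arr V d) f \<in> hom V \<I> (vHom T \<I> x)"
      if "f \<in> hom V \<I> (vHom T \<I> x0)" for f
      using ucomp_hom[OF T_vcat, of \<I> x0 x "vH J x0 x \<cdot> name_arr V d" f] x d that by (simp add: hom_iff)
    have "g = ucomp V T \<I> x0 x (vH J x0 x \<cdot> name_arr V d) f \<longleftrightarrow> K x g = Ma d \<cdot> K x0 f"
      if "g \<in> hom V \<I> (vHom T \<I> x)" "f \<in> hom V \<I> (vHom T \<I> x0)" for f g
      using KJ[OF x d that(2)] bij_betw_imp_inj_on[OF K[OF x(1)]] uc[OF that(2)] that(1) by (metis inj_onD)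
    then show ?thesis
      unfolding bij_betw_imp_surj_on[OF K[OF x(1)], symmetric] bij_betw_imp_surj_on[OF K[OF x(2)], symmetric]
      by auto
  qed
  then show ?thesis
    unfolding is_discrete_def using discrete_counit(1) P_obj unitP by (auto simp del: M_simps)
qed

end

end

section \<open>Filtered colimits and presentable objects\<close>

lemma regular_finite_less:
  fixes \<kappa> :: "'s rel"
  assumes "small_regular_cardinal \<kappa>" "finite B"
  shows "|B| <o \<kappa>"
proof (rule finite_ordLess_infinite)
  show "Well_order \<kappa>" "\<not> finite (Field \<kappa>)"
    using assms(1) unfolding small_regular_cardinal_def by (blast intro: card_order_on_well_order_on)+
  show "Well_order |B|" by (rule card_of_Well_order)
  show "finite (Field |B| )" using assms(2) by (simp only: Field_card_of)
qed

lemma regular_infinite_type: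
  fixes \<kappa> :: "'s rel"
  assumes "small_regular_cardinal \<kappa>"
  shows "infinite (UNIV :: 's set)"
  using assms unfolding small_regular_cardinal_def by (meson finite_subset top_greatest)

lemma small_finite:
  fixes \<kappa> :: "'s rel"
  assumes "small_regular_cardinal \<kappa>" "finite B"
  shows "small TYPE('s) B"
  unfolding small_def
proof (rule finite_ordLess_infinite)
  show "\<not> finite (Field |UNIV :: 's set| )"
    using regular_infinite_type[OF assms(1)] by (simp add: Field_card_of)
  show "finite (Field |B| )" using assms(2) by (simp only: Field_card_of)
qed (rule card_of_Well_order)+

text \<open>Since \<open>\<kappa>\<close> is infinite, every finite graph in a
  \<open>\<kappa>\<close>-filtered category has a cocone. The shapes used later are a pair of
  objects, a span and a parallel pair.\<close>

lemma filtered_finite: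
  fixes \<kappa> :: "'s rel"
  assumes "small_regular_cardinal \<kappa>" "filtered \<kappa> A" "finite B" "finite E" "B \<subseteq> Obj A" "E \<subseteq> Arr A"
    "\<And>f. f \<in> E \<Longrightarrow> Dom A f \<in> B \<and> Cod A f \<in> B"
  obtains c u where "c \<in> Obj A" "\<And>a. a \<in> B \<Longrightarrow> u a \<in> hom A a c"
    "\<And>f. f \<in> E \<Longrightarrow> u (Cod A f) \<cdot>\<^bsub>A\<^esub> f = u (Dom A f)"
proof -
  have "B \<subseteq> Obj A \<and> |B| <o \<kappa> \<and> E \<subseteq> Arr A \<and> |E| <o \<kappa> \<and> (\<forall>f \<in> E. Dom A f \<in> B \<and> Cod A f \<in> B)"
    using assms(3-7) regular_finite_less[OF assms(1), of B] regular_finite_less[OF assms(1), of E] by simp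
  from assms(2)[unfolded filtered_def, rule_format, OF this] show thesis
    using that by auto
qed

lemma filtered_upper_bound:
  fixes \<kappa> :: "'s rel"
  assumes "small_regular_cardinal \<kappa>" "filtered \<kappa> A" "a \<in> Obj A" "b \<in> Obj A"
  obtains c i j where "c \<in> Obj A" "i \<in> hom A a c" "j \<in> hom A b c"
proof (rule filtered_finite[OF assms(1,2), of "{a, b}" "{}"])
  fix c u assume "c \<in> Obj A" "\<And>x. x \<in> {a, b} \<Longrightarrow> u x \<in> hom A x c"
  then show thesis using that by blast
qed (use assms in auto)

lemma filtered_span:
  fixes \<kappa> :: "'s rel"
  assumes "small_regular_cardinal \<kappa>" "filtered \<kappa> A" "category A" and f: "f \<in> hom A a b" and g: "g \<in> hom A a c"
  obtains l i j where "l \<in> Obj A" "i \<in> hom A b l" "j \<in> hom A c l" "i \<cdot>\<^bsub>A\<^esub> f = j \<cdot>\<^bsub>A\<^esub> g"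
proof -
  have fg: "f \<in> Arr A" "Dom A f = a" "Cod A f = b" "g \<in> Arr A" "Dom A g = a" "Cod A g = c"
    using f g by (auto simp: hom_def)
  have o: "a \<in> Obj A" "b \<in> Obj A" "c \<in> Obj A"
    using category.hom_objs[OF assms(3) f] category.hom_objs[OF assms(3) g] by auto
  show thesis
  proof (rule filtered_finite[OF assms(1,2), of "{a, b, c}" "{f, g}"])
    fix l u assume l: "l \<in> Obj A" and u: "\<And>x. x \<in> {a, b, c} \<Longrightarrow> u x \<in> hom A x l"
      and e: "\<And>h. h \<in> {f, g} \<Longrightarrow> u (Cod A h) \<cdot>\<^bsub>A\<^esub> h = u (Dom A h)"
    have "u b \<cdot>\<^bsub>A\<^esub> f = u c \<cdot>\<^bsub>A\<^esub> g" using e[of f] e[of g] fg by simp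
    then show thesis using that[OF l u u] by blast
  qed (use fg o in auto)
qed

lemma filtered_parallel:
  fixes \<kappa> :: "'s rel"
  assumes "small_regular_cardinal \<kappa>" "filtered \<kappa> A" "category A" and f: "f \<in> hom A a b" and g: "g \<in> hom A a b"
  obtains l i where "l \<in> Obj A" "i \<in> hom A b l" "i \<cdot>\<^bsub>A\<^esub> f = i \<cdot>\<^bsub>A\<^esub> g"
proof -
  have fg: "f \<in> Arr A" "Dom A f = a" "Cod A f = b" "g \<in> Arr A" "Dom A g = a" "Cod A g = b"
    using f g by (auto simp: hom_def)
  have o: "a \<in> Obj A" "b \<in> Obj A"
    using category.hom_objs[OF assms(3) f] by auto
  show thesis
  proof (rule filtered_finite[OF assms(1,2), of "{a, b}" "{f, g}"])
    fix l u assume l: "l \<in> Obj A" and u: "\<And>x. x \<in> {a, b} \<Longrightarrow> u x \<in> hom A x l"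
      and e: "\<And>h. h \<in> {f, g} \<Longrightarrow> u (Cod A h) \<cdot>\<^bsub>A\<^esub> h = u (Dom A h)"
    have "u b \<cdot>\<^bsub>A\<^esub> f = u b \<cdot>\<^bsub>A\<^esub> g" using e[of f] e[of g] fg by simp
    then show thesis using that[OF l u] by blast
  qed (use fg o in auto)
qed

section \<open>The category of small sets\<close>

abbreviation sets :: "(('s + 'm) set, ('s + 'm) set \<times> ('s + 'm \<Rightarrow> 's + 'm) \<times> ('s + 'm) set) cat" where
  "sets \<equiv> set_cat"

lemma set_cat_simps:
  "Obj (sets :: (('s + 'm) set, _) cat) = {A. small TYPE('s) A}"
  "Dom sets (a, \<phi>, b) = a" "Cod sets (a, \<phi>, b) = b"
  "Id sets a = (a, restrict id a, a)" "Comp sets (b', \<psi>, c) (a, \<phi>, b) = (a, compose a \<psi> \<phi>, c)"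
  by (simp_all add: set_cat_def)

lemma set_cat_hom_iff:
  "f \<in> hom (sets :: (('s + 'm) set, _) cat) a b \<longleftrightarrow>
    (\<exists>\<phi>. f = (a, \<phi>, b) \<and> small TYPE('s) a \<and> small TYPE('s) b \<and> \<phi> \<in> a \<rightarrow>\<^sub>E b)"
  by (cases f) (auto simp: set_cat_def hom_def)

lemma set_cat_arrE:
  assumes "f \<in> Arr (sets :: (('s + 'm) set, _) cat)"
  obtains a \<phi> b where "f = (a, \<phi>, b)" "small TYPE('s) a" "small TYPE('s) b" "\<phi> \<in> a \<rightarrow>\<^sub>E b"
  using assms by (cases f) (auto simp: set_cat_def)

text \<open>Allows the general facts about presentable objects to be applied inside the category of
  sets, as is needed for copowers of the unit.\<close>

lemma set_cat_category: "category (sets :: (('s + 'm) set, _) cat)"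
proof
  let ?C = "sets :: (('s + 'm) set, _) cat"
  fix f g h :: "('s + 'm) set \<times> ('s + 'm \<Rightarrow> 's + 'm) \<times> ('s + 'm) set" and a b c d :: "('s + 'm) set"
  show "Dom ?C f \<in> Obj ?C" "Cod ?C f \<in> Obj ?C" if "f \<in> Arr ?C"
    using that by (auto elim!: set_cat_arrE simp: set_cat_simps)
  show "Id ?C a \<in> hom ?C a a" if "a \<in> Obj ?C"
    using that by (auto simp: set_cat_simps set_cat_hom_iff)
  show "Comp ?C g f \<in> hom ?C a c" if "f \<in> hom ?C a b" "g \<in> hom ?C b c"
  proof -
    obtain \<phi> \<psi> where *: "f = (a, \<phi>, b)" "\<phi> \<in> a \<rightarrow>\<^sub>E b" "g = (b, \<psi>, c)" "\<psi> \<in> b \<rightarrow>\<^sub>E c" "small TYPE('s) a" "small TYPE('s) c"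
      using \<open>f \<in> hom ?C a b\<close> \<open>g \<in> hom ?C b c\<close> unfolding set_cat_hom_iff by blast
    have "compose a \<psi> \<phi> \<in> a \<rightarrow>\<^sub>E c"
      using *(2,4) by (auto simp: compose_def PiE_iff)
    then show ?thesis using * by (simp add: set_cat_hom_iff set_cat_simps)
  qed
  show "Comp ?C f (Id ?C a) = f" if f: "f \<in> hom ?C a b"
  proof -
    obtain \<phi> where *: "f = (a, \<phi>, b)" "\<phi> \<in> a \<rightarrow>\<^sub>E b" using f unfolding set_cat_hom_iff by blast
    have "compose a \<phi> (restrict id a) = \<phi>"
      by (rule ext) (simp add: compose_def PiE_arb[OF *(2)])
    then show ?thesis using * by (simp add: set_cat_simps)
  qed
  show "Comp ?C (Id ?C b) f = f" if f: "f \<in> hom ?C a b"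
  proof -
    obtain \<phi> where *: "f = (a, \<phi>, b)" "\<phi> \<in> a \<rightarrow>\<^sub>E b" using f unfolding set_cat_hom_iff by blast
    have "compose a (restrict id b) \<phi> = \<phi>"
      by (rule ext) (use *(2) in \<open>auto simp: compose_def PiE_arb[OF *(2)]\<close>)
    then show ?thesis using * by (simp add: set_cat_simps)
  qed
  show "Comp ?C (Comp ?C h g) f = Comp ?C h (Comp ?C g f)"
    if "f \<in> hom ?C a b" "g \<in> hom ?C b c" "h \<in> hom ?C c d"
  proof -
    obtain \<phi> \<psi> \<chi> where *: "f = (a, \<phi>, b)" "\<phi> \<in> a \<rightarrow>\<^sub>E b" "g = (b, \<psi>, c)" "h = (c, \<chi>, d)"
      using \<open>f \<in> hom ?C a b\<close> \<open>g \<in> hom ?C b c\<close> \<open>h \<in> hom ?C c d\<close> unfolding set_cat_hom_iff by blast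
    have "compose a (compose b \<chi> \<psi>) \<phi> = compose a \<chi> (compose a \<psi> \<phi>)"
      by (rule ext) (use *(2) in \<open>auto simp: compose_def\<close>)
    then show ?thesis using * by (simp add: set_cat_simps)
  qed
qed

section \<open>Presentability as factorization through stages\<close>

context category
begin

lemma cocone_naturality:
  assumes "cocone C A D c u" "f \<in> hom A a b"
  shows "u b \<cdot> fArr D f = u a"
  using assms by (auto simp: cocone_def hom_def)

lemma functor_hom:
  assumes "is_functor A C D" "f \<in> hom A a b"
  shows "fArr D f \<in> hom C (fObj D a) (fObj D b)"
  using assms by (auto simp: is_functor_def hom_def)

lemma functor_comp:
  assumes "is_functor A C D" "f \<in> hom A a b" "g \<in> hom A b c"
  shows "fArr D (g \<cdot>\<^bsub>A\<^esub> f) = fArr D g \<cdot> fArr D f"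
  using assms unfolding is_functor_def by blast

lemma cocone_leg: "cocone C A D c u \<Longrightarrow> a \<in> Obj A \<Longrightarrow> u a \<in> hom C (fObj D a) c"
  by (simp add: cocone_def)

text \<open>A functor on a filtered category sends a colimit cocone to a colimit cocone of sets precisely
  when every element factors through a leg, and equality of elements is decided at some stage.\<close>

definition factors_through :: "'o \<Rightarrow> ('a, 'f, 'z1) cat_scheme \<Rightarrow> ('a, 'f, 'o, 'm) func \<Rightarrow> 'o \<Rightarrow> ('a \<Rightarrow> 'm) \<Rightarrow> bool" where
  "factors_through x A D c u \<longleftrightarrow>
     (\<forall>e \<in> hom C x c. \<exists>a \<in> Obj A. \<exists>e' \<in> hom C x (fObj D a). e = u a \<cdot> e') \<and>
     (\<forall>a \<in> Obj A. \<forall>e \<in> hom C x (fObj D a). \<forall>e' \<in> hom C x (fObj D a). u a \<cdot> e = u a \<cdot> e' \<longrightarrow>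
        (\<exists>b \<in> Obj A. \<exists>f \<in> hom A a b. fArr D f \<cdot> e = fArr D f \<cdot> e'))"

lemma hom_functor_obj:
  "fObj (func_comp (hom_functor C x) D) a = Inr ` hom C x (fObj D a)"
  "fObj (hom_functor C x) c = Inr ` hom C x c"
  by (simp_all add: func_comp_def hom_functor_def hom_set_def)

lemma hom_functor_arr:
  assumes "f \<in> hom C a b"
  shows "fArr (hom_functor C x) f = (Inr ` hom C x a, \<lambda>y \<in> Inr ` hom C x a. Inr (f \<cdot> projr y), Inr ` hom C x b)"
  using assms by (simp add: hom_functor_def hom_set_def hom_iff)

lemma func_comp_arr: "fArr (func_comp G D) f = fArr G (fArr D f)"
  by (simp add: func_comp_def)

lemma hom_functor_hom:
  assumes f: "f \<in> hom C a b"
    and "small TYPE('s) (Inr ` hom C x a :: ('s + 'm) set)" "small TYPE('s) (Inr ` hom C x b :: ('s + 'm) set)"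
  shows "fArr (hom_functor C x) f \<in> hom (sets :: (('s + 'm) set, _) cat) (Inr ` hom C x a) (Inr ` hom C x b)"
proof -
  have "f \<cdot> e \<in> hom C x b" if "e \<in> hom C x a" for e by (rule comp_hom[OF that f])
  then have "(\<lambda>y \<in> Inr ` hom C x a. Inr (f \<cdot> projr y)) \<in> Inr ` hom C x a \<rightarrow>\<^sub>E (Inr ` hom C x b :: ('s + 'm) set)"
    by auto
  then show ?thesis using assms by (simp add: hom_functor_arr[OF f] set_cat_hom_iff)
qed

text \<open>Arrows of \<open>set_cat\<close> are triples around an extensional function; commutation
  with the image of \<open>f\<close> under a hom functor is thereby reduced to a pointwise
  equation.\<close>

lemma hom_functor_comp_iff:
  assumes f: "f \<in> hom C a b" and \<psi>: "\<psi> \<in> extensional (Inr ` hom C x a)"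
  shows "Comp sets (b', \<chi>, d) (fArr (hom_functor C x) f) = (Inr ` hom C x a, \<psi>, d) \<longleftrightarrow>
    (\<forall>e \<in> hom C x a. \<chi> (Inr (f \<cdot> e)) = \<psi> (Inr e))" (is "?l \<longleftrightarrow> ?r")
proof -
  let ?k = "compose (Inr ` hom C x a) \<chi> (\<lambda>y \<in> Inr ` hom C x a. Inr (f \<cdot> projr y))"
  have "?l \<longleftrightarrow> ?k = \<psi>"
    by (simp add: hom_functor_arr[OF f] set_cat_simps)
  also have "\<dots> \<longleftrightarrow> ?r"
  proof
    assume k: "?k = \<psi>"
    show ?r
    proof
      fix e assume "e \<in> hom C x a"
      then show "\<chi> (Inr (f \<cdot> e)) = \<psi> (Inr e)" using fun_cong[OF k, of "Inr e"] by (simp add: compose_def)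
    qed
  next
    assume r: ?r
    show "?k = \<psi>"
    proof (rule extensionalityI)
      show "?k \<in> extensional (Inr ` hom C x a)" by (simp add: compose_def)
      show "?k y = \<psi> y" if "y \<in> Inr ` hom C x a" for y
        using r that by (auto simp: compose_def)
    qed (rule \<psi>)
  qed
  finally show ?thesis .
qed

text \<open>Predicates on the stages that are preserved and reflected by the transition maps form a
  cocone to a two-element set. The colimit property in sets gives exactly one predicate on the
  colimit that restricts to them; existence and uniqueness are both exploited in
  \<open>hom_colimit_factors\<close>.\<close>

lemma hom_colimit_predicate:
  fixes \<kappa> :: "'s rel" and A :: "('s, 's) cat"
  assumes \<kappa>: "small_regular_cardinal \<kappa>" and D: "is_functor A C D" and cc: "cocone C A D c u"
    and colim: "is_colimit (sets :: (('s + 'm) set, _) cat) A (func_comp (hom_functor C x) D)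
      (fObj (hom_functor C x) c) (\<lambda>a. fArr (hom_functor C x) (u a))"
    and compat: "\<And>a b f e. f \<in> hom A a b \<Longrightarrow> e \<in> hom C x (fObj D a) \<Longrightarrow> Q b (fArr D f \<cdot> e) \<longleftrightarrow> Q a e"
  obtains R where "\<And>a e. a \<in> Obj A \<Longrightarrow> e \<in> hom C x (fObj D a) \<Longrightarrow> R (u a \<cdot> e) \<longleftrightarrow> Q a e"
    and "\<And>R'. (\<And>a e. a \<in> Obj A \<Longrightarrow> e \<in> hom C x (fObj D a) \<Longrightarrow> R' (u a \<cdot> e) \<longleftrightarrow> Q a e) \<Longrightarrow>
      \<forall>e \<in> hom C x c. R' e \<longleftrightarrow> R e"
proof -
  let ?S = "sets :: (('s + 'm) set, _) cat" and ?HD = "func_comp (hom_functor C x) D"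
  let ?I = "\<lambda>y. Inr ` hom C x y :: ('s + 'm) set"
  \<comment> \<open>Two truth values inside \<open>'s\<close>, so that the set of them is an object
    of \<open>set_cat\<close>.\<close>
  obtain p q :: 's where pq: "p \<noteq> q"
    using regular_infinite_type[OF \<kappa>] by (metis (full_types) UNIV_eq_I finite.simps singletonI)
  let ?d = "{Inl p, Inl q} :: ('s + 'm) set"
  let ?pr = "\<lambda>y Q. (\<lambda>z \<in> ?I y. if Q (projr z) then Inl p else Inl q) :: 's + 'm \<Rightarrow> 's + 'm"
  have pr: "?pr y Q \<in> ?I y \<rightarrow>\<^sub>E ?d" "?pr y Q \<in> extensional (?I y)" for y Q
    by auto
  have d: "small TYPE('s) ?d" by (rule small_finite[OF \<kappa>]) simp
  have cc': "cocone ?S A ?HD (fObj (hom_functor C x) c) (\<lambda>a. fArr (hom_functor C x) (u a))"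
    using colim by (simp add: is_colimit_def)
  have c_small: "small TYPE('s) (?I c)"
    using cc' by (simp add: cocone_def set_cat_simps hom_functor_obj)
  have D_small: "small TYPE('s) (?I (fObj D a))" if "a \<in> Obj A" for a
  proof -
    have "fArr (hom_functor C x) (u a) \<in> hom ?S (?I (fObj D a)) (?I c)"
      using cc' that by (simp add: cocone_def hom_functor_obj)
    then show ?thesis unfolding set_cat_hom_iff by blast
  qed
  let ?v = "\<lambda>a. (?I (fObj D a), ?pr (fObj D a) (Q a), ?d)"
  have cv: "cocone ?S A ?HD ?d ?v"
    unfolding cocone_def
  proof (intro conjI ballI)
    show "?d \<in> Obj ?S" using d by (simp add: set_cat_simps)
    show "?v a \<in> hom ?S (fObj ?HD a) ?d" if "a \<in> Obj A" for a
      unfolding set_cat_hom_iff hom_functor_obj using d D_small[OF that] pr(1) by blast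
    fix f assume f: "f \<in> Arr A"
    have f': "f \<in> hom A (Dom A f) (Cod A f)" using f by (simp add: hom_def)
    have "?pr (fObj D (Cod A f)) (Q (Cod A f)) (Inr (fArr D f \<cdot> e)) = ?pr (fObj D (Dom A f)) (Q (Dom A f)) (Inr e)"
      if e: "e \<in> hom C x (fObj D (Dom A f))" for e
      using e comp_hom[OF e functor_hom[OF D f']] compat[OF f' e] by simp
    then show "?v (Cod A f) \<cdot>\<^bsub>?S\<^esub> fArr ?HD f = ?v (Dom A f)"
      unfolding func_comp_arr hom_functor_comp_iff[OF functor_hom[OF D f'] pr(2)] by blast
  qed
  have h_iff: "(\<forall>a \<in> Obj A. (?I c, ?pr c R, ?d) \<cdot>\<^bsub>?S\<^esub> fArr (hom_functor C x) (u a) = ?v a)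
    \<longleftrightarrow> (\<forall>a \<in> Obj A. \<forall>e \<in> hom C x (fObj D a). R (u a \<cdot> e) \<longleftrightarrow> Q a e)" for R
  proof (rule ball_cong[OF refl])
    fix a assume a: "a \<in> Obj A"
    have "?pr c R (Inr (u a \<cdot> e)) = ?pr (fObj D a) (Q a) (Inr e) \<longleftrightarrow> (R (u a \<cdot> e) \<longleftrightarrow> Q a e)" if e: "e \<in> hom C x (fObj D a)" for e
      using e comp_hom[OF e cocone_leg[OF cc a]] pq by simp
    then show "(?I c, ?pr c R, ?d) \<cdot>\<^bsub>?S\<^esub> fArr (hom_functor C x) (u a) = ?v a
        \<longleftrightarrow> (\<forall>e \<in> hom C x (fObj D a). R (u a \<cdot> e) \<longleftrightarrow> Q a e)"
      unfolding hom_functor_comp_iff[OF cocone_leg[OF cc a] pr(2)] by blast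
  qed
  have h_hom: "(?I c, ?pr c R, ?d) \<in> hom ?S (fObj (hom_functor C x) c) ?d" for R
    unfolding set_cat_hom_iff hom_functor_obj using d c_small pr(1) by blast
  have ex1: "\<exists>!h. h \<in> hom ?S (fObj (hom_functor C x) c) ?d \<and>
      (\<forall>a \<in> Obj A. h \<cdot>\<^bsub>?S\<^esub> fArr (hom_functor C x) (u a) = ?v a)"
    using colim cv unfolding is_colimit_def by blast
  then have uniq: "k = k'" if "k \<in> hom ?S (fObj (hom_functor C x) c) ?d"
    "\<forall>a \<in> Obj A. k \<cdot>\<^bsub>?S\<^esub> fArr (hom_functor C x) (u a) = ?v a"
    "k' \<in> hom ?S (fObj (hom_functor C x) c) ?d"
    "\<forall>a \<in> Obj A. k' \<cdot>\<^bsub>?S\<^esub> fArr (hom_functor C x) (u a) = ?v a" for k k'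
    using that by blast
  obtain h where h: "h \<in> hom ?S (fObj (hom_functor C x) c) ?d"
    "\<forall>a \<in> Obj A. h \<cdot>\<^bsub>?S\<^esub> fArr (hom_functor C x) (u a) = ?v a" using ex1 by blast
  obtain g where g: "h = (?I c, g, ?d)" "g \<in> ?I c \<rightarrow>\<^sub>E ?d"
    using h(1) unfolding set_cat_hom_iff hom_functor_obj by blast
  define R where "R e \<longleftrightarrow> g (Inr e) = Inl p" for e
  have g': "g = ?pr c R"
  proof (rule PiE_ext[OF g(2) pr(1)])
    fix y assume y: "y \<in> ?I c"
    have "g y \<in> ?d" using g(2) y by (rule PiE_mem)
    then show "g y = ?pr c R y" using y by (auto simp: R_def)
  qed
  have R1: "\<forall>a \<in> Obj A. \<forall>e \<in> hom C x (fObj D a). R (u a \<cdot> e) \<longleftrightarrow> Q a e"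
    by (rule iffD1[OF h_iff]) (rule h(2)[unfolded g(1) g'])
  show thesis
  proof (rule that[of R])
    show "a \<in> Obj A \<Longrightarrow> e \<in> hom C x (fObj D a) \<Longrightarrow> R (u a \<cdot> e) \<longleftrightarrow> Q a e" for a e
      using R1 by blast
    fix R' assume "\<And>a e. a \<in> Obj A \<Longrightarrow> e \<in> hom C x (fObj D a) \<Longrightarrow> R' (u a \<cdot> e) \<longleftrightarrow> Q a e"
    then have "\<forall>a \<in> Obj A. \<forall>e \<in> hom C x (fObj D a). R' (u a \<cdot> e) \<longleftrightarrow> Q a e" by blast
    from iffD2[OF h_iff this] have "(?I c, ?pr c R', ?d) = (?I c, ?pr c R, ?d)"
      by (intro uniq h_hom iffD2[OF h_iff R1])
    then have e: "?pr c R' = ?pr c R" by simp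
    show "\<forall>e \<in> hom C x c. R' e \<longleftrightarrow> R e"
    proof
      fix y assume "y \<in> hom C x c"
      then show "R' y \<longleftrightarrow> R y"
        using fun_cong[OF e, of "Inr y"] pq by (simp split: if_splits)
    qed
  qed
qed

text \<open>The classification of predicates is applied twice: to the constantly true predicate, and
  to eventual equality with a fixed element.\<close>

lemma hom_colimit_factors:
  fixes \<kappa> :: "'s rel" and A :: "('s, 's) cat"
  assumes \<kappa>: "small_regular_cardinal \<kappa>" and D: "is_functor A C D" and A: "category A" "filtered \<kappa> A"
    and cc: "cocone C A D c u"
    and colim: "is_colimit (sets :: (('s + 'm) set, _) cat) A (func_comp (hom_functor C x) D)
      (fObj (hom_functor C x) c) (\<lambda>a. fArr (hom_functor C x) (u a))"
  shows "factors_through x A D c u"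
  unfolding factors_through_def
proof safe
  interpret A: category A by (rule A(1))
  show "\<exists>a \<in> Obj A. \<exists>e' \<in> hom C x (fObj D a). e = u a \<cdot> e'" if e: "e \<in> hom C x c" for e
  proof (rule hom_colimit_predicate[OF \<kappa> D cc colim, of "\<lambda>a e. True"])
    fix R assume *: "\<And>R'. (\<And>a e. a \<in> Obj A \<Longrightarrow> e \<in> hom C x (fObj D a) \<Longrightarrow> R' (u a \<cdot> e) \<longleftrightarrow> True) \<Longrightarrow>
      \<forall>e \<in> hom C x c. R' e \<longleftrightarrow> R e"
    \<comment> \<open>Truth and factoring through some leg both restrict to truth at every stage, so
      by uniqueness they coincide on the colimit.\<close>
    have "R e" using *[of "\<lambda>e. True"] e by auto
    moreover have "(\<exists>a \<in> Obj A. \<exists>e' \<in> hom C x (fObj D a). e = u a \<cdot> e') \<longleftrightarrow> R e"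
      by (rule bspec[OF *[of "\<lambda>e. \<exists>a \<in> Obj A. \<exists>e' \<in> hom C x (fObj D a). e = u a \<cdot> e'"] e]) auto
    ultimately show ?thesis by blast
  qed auto
next
  interpret A: category A by (rule A(1))
  fix a e1 e2 assume a: "a \<in> Obj A" and e1: "e1 \<in> hom C x (fObj D a)" and e2: "e2 \<in> hom C x (fObj D a)"
    and eq: "u a \<cdot> e1 = u a \<cdot> e2"
  \<comment> \<open>\<open>Q b e\<close> says that \<open>e\<close> and \<open>e1\<close> become
    equal at a later stage. Filteredness makes it compatible with the transition maps, so it
    descends to the colimit and cannot separate \<open>e1\<close> from \<open>e2\<close>.\<close>
  define Q where "Q b e \<longleftrightarrow> (\<exists>k. \<exists>i \<in> hom A a k. \<exists>j \<in> hom A b k. fArr D i \<cdot> e1 = fArr D j \<cdot> e)" for b e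
  have Dc: "fArr D (g \<cdot>\<^bsub>A\<^esub> f) \<cdot> e = fArr D g \<cdot> (fArr D f \<cdot> e)"
    if "f \<in> hom A b b'" "g \<in> hom A b' b''" "e \<in> hom C x (fObj D b)" for f g b b' b'' e
    using functor_comp[OF D that(1,2)] functor_hom[OF D that(1)] functor_hom[OF D that(2)] that(3)
    by (simp add: hom_iff)
  have compat: "Q b (fArr D f \<cdot> e) \<longleftrightarrow> Q b' e" if f: "f \<in> hom A b' b" and e: "e \<in> hom C x (fObj D b')" for b b' f e
  proof
    assume "Q b (fArr D f \<cdot> e)"
    then obtain k i j where "i \<in> hom A a k" "j \<in> hom A b k" "fArr D i \<cdot> e1 = fArr D j \<cdot> (fArr D f \<cdot> e)"
      by (auto simp: Q_def)
    then show "Q b' e" using A.comp_hom[OF f] Dc[OF f _ e] unfolding Q_def by metis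
  next
    assume "Q b' e"
    then obtain k i j where ij: "i \<in> hom A a k" "j \<in> hom A b' k" "fArr D i \<cdot> e1 = fArr D j \<cdot> e"
      by (auto simp: Q_def)
    obtain l p q where wh: "p \<in> hom A b l" "q \<in> hom A k l" and wf: "p \<cdot>\<^bsub>A\<^esub> f = q \<cdot>\<^bsub>A\<^esub> j"
      using filtered_span[OF \<kappa> A(2,1) f ij(2)] by blast
    have "fArr D (q \<cdot>\<^bsub>A\<^esub> i) \<cdot> e1 = fArr D q \<cdot> (fArr D j \<cdot> e)"
      by (simp only: Dc[OF ij(1) wh(2) e1] ij(3))
    also have "\<dots> = fArr D p \<cdot> (fArr D f \<cdot> e)"
      by (simp only: Dc[OF ij(2) wh(2) e, symmetric] Dc[OF f wh(1) e, symmetric] wf)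
    finally show "Q b (fArr D f \<cdot> e)"
      using A.comp_hom[OF ij(1) wh(2)] wh(1) unfolding Q_def by blast
  qed
  have "\<exists>R. \<forall>b \<in> Obj A. \<forall>e \<in> hom C x (fObj D b). R (u b \<cdot> e) \<longleftrightarrow> Q b e"
  proof (rule hom_colimit_predicate[OF \<kappa> D cc colim compat])
    fix R assume "\<And>a e. a \<in> Obj A \<Longrightarrow> e \<in> hom C x (fObj D a) \<Longrightarrow> R (u a \<cdot> e) \<longleftrightarrow> Q a e"
    then show ?thesis by blast
  qed
  then obtain R where R: "\<And>b e. b \<in> Obj A \<Longrightarrow> e \<in> hom C x (fObj D b) \<Longrightarrow> R (u b \<cdot> e) \<longleftrightarrow> Q b e"
    by blast
  have "Q a e1" unfolding Q_def using A.id_hom[OF a] by blast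
  then have "Q a e2" using R[OF a e1] R[OF a e2] eq by simp
  then obtain k i j where ij: "i \<in> hom A a k" "j \<in> hom A a k" "fArr D i \<cdot> e1 = fArr D j \<cdot> e2"
    by (auto simp: Q_def)
  \<comment> \<open>The transition maps \<open>i\<close> and \<open>j\<close> from \<open>a\<close>
    to \<open>k\<close> may differ; a further stage identifies them.\<close>
  obtain l w where l: "l \<in> Obj A" and w: "w \<in> hom A k l" and wf: "w \<cdot>\<^bsub>A\<^esub> i = w \<cdot>\<^bsub>A\<^esub> j"
    using filtered_parallel[OF \<kappa> A(2,1) ij(1,2)] by blast
  have "fArr D (w \<cdot>\<^bsub>A\<^esub> i) \<cdot> e1 = fArr D (w \<cdot>\<^bsub>A\<^esub> i) \<cdot> e2"
    by (simp only: Dc[OF ij(1) w e1] ij(3)) (simp only: Dc[OF ij(2) w e2, symmetric] wf)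
  then show "\<exists>b \<in> Obj A. \<exists>f \<in> hom A a b. fArr D f \<cdot> e1 = fArr D f \<cdot> e2"
    using l A.comp_hom[OF ij(1) w] by blast
qed

lemma presentable_factors:
  fixes \<kappa> :: "'s rel" and A :: "('s, 's) cat"
  assumes "small_regular_cardinal \<kappa>" "presentable \<kappa> C x" "is_functor A C D" "small_category A" "filtered \<kappa> A"
    "is_colimit C A D c u"
  shows "factors_through x A D c u"
proof (rule hom_colimit_factors[OF assms(1,3) _ assms(5)])
  show "category A" "cocone C A D c u" using assms by (auto simp: small_category_def is_colimit_def)
  show "is_colimit (sets :: (('s + 'm) set, _) cat) A (func_comp (hom_functor C x) D)
      (fObj (hom_functor C x) c) (\<lambda>a. fArr (hom_functor C x) (u a))"
    using assms unfolding presentable_def by blast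
qed

text \<open>Both elements are moved to a common stage, where the second clause of
  \<open>factors_through\<close> applies.\<close>

lemma factors_through_joint:
  fixes \<kappa> :: "'s rel"
  assumes \<kappa>: "small_regular_cardinal \<kappa>" and D: "is_functor A C D" and A: "category A" "filtered \<kappa> A"
    and cc: "cocone C A D c u" and f: "factors_through x A D c u"
    and a: "a \<in> Obj A" "e \<in> hom C x (fObj D a)" and b: "b \<in> Obj A" "e' \<in> hom C x (fObj D b)"
    and eq: "u a \<cdot> e = u b \<cdot> e'"
  obtains l i j where "l \<in> Obj A" "i \<in> hom A a l" "j \<in> hom A b l" "fArr D i \<cdot> e = fArr D j \<cdot> e'"
proof -
  interpret A: category A by (rule A(1))
  obtain k i j where k: "k \<in> Obj A" and i: "i \<in> hom A a k" and j: "j \<in> hom A b k"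
    by (rule filtered_upper_bound[OF \<kappa> A(2) a(1) b(1)])
  note Di = functor_hom[OF D i] and Dj = functor_hom[OF D j]
  have "u k \<cdot> (fArr D i \<cdot> e) = u a \<cdot> e"
    by (rule reassoc[OF cocone_naturality[OF cc i]])
      (use Di a cocone_leg[OF cc k] in \<open>auto simp: hom_iff\<close>)
  moreover have "u k \<cdot> (fArr D j \<cdot> e') = u b \<cdot> e'"
    by (rule reassoc[OF cocone_naturality[OF cc j]])
      (use Dj b cocone_leg[OF cc k] in \<open>auto simp: hom_iff\<close>)
  ultimately have "u k \<cdot> (fArr D i \<cdot> e) = u k \<cdot> (fArr D j \<cdot> e')" using eq by simp
  moreover have "fArr D i \<cdot> e \<in> hom C x (fObj D k)" "fArr D j \<cdot> e' \<in> hom C x (fObj D k)"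
    using comp_hom[OF a(2) Di] comp_hom[OF b(2) Dj] .
  ultimately obtain l g where l: "l \<in> Obj A" and g: "g \<in> hom A k l"
    and gg: "fArr D g \<cdot> (fArr D i \<cdot> e) = fArr D g \<cdot> (fArr D j \<cdot> e')"
    using f k unfolding factors_through_def by blast
  have "fArr D (g \<cdot>\<^bsub>A\<^esub> i) \<cdot> e = fArr D (g \<cdot>\<^bsub>A\<^esub> j) \<cdot> e'"
    using gg functor_comp[OF D i g] functor_comp[OF D j g] functor_hom[OF D g] Di Dj a b by (simp add: hom_iff)
  then show thesis
    using that[OF l A.comp_hom[OF i g] A.comp_hom[OF j g]] by blast
qed

text \<open>The converse of \<open>presentable_factors\<close>: the first clause of
  \<open>factors_through\<close> forces the values of a map out of the hom set of the colimit, and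
  the second makes them independent of the stage. Local smallness makes the hom sets objects of
  \<open>set_cat\<close>.\<close>

lemma presentableI:
  fixes \<kappa> :: "'s rel"
  assumes \<kappa>: "small_regular_cardinal \<kappa>" and ls: "locally_small TYPE('s) C" and x: "x \<in> Obj C"
    and f: "\<And>(A :: ('s, 's) cat) D c u. small_category A \<Longrightarrow> filtered \<kappa> A \<Longrightarrow> is_functor A C D \<Longrightarrow>
      is_colimit C A D c u \<Longrightarrow> factors_through x A D c u"
  shows "presentable \<kappa> C x"
  unfolding presentable_def
proof (intro conjI allI impI, rule x, elim conjE)
  let ?S = "sets :: (('s + 'm) set, _) cat" and ?HD = "func_comp (hom_functor C x)"
  let ?I = "\<lambda>y. Inr ` hom C x y :: ('s + 'm) set"
  fix A :: "('s, 's) cat" and D c u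
  assume A: "small_category A" "filtered \<kappa> A" and D: "is_functor A C D" and colim: "is_colimit C A D c u"
  note ft = f[OF A D colim]
  have A1: "category A" and cc: "cocone C A D c u" using A colim by (auto simp: small_category_def is_colimit_def)
  have sm: "small TYPE('s) (?I y)" if "y \<in> Obj C" for y
    using ls x that unfolding locally_small_def small_def by (meson card_of_image ordLeq_ordLess_trans)
  have c: "c \<in> Obj C" and Do: "\<And>a. a \<in> Obj A \<Longrightarrow> fObj D a \<in> Obj C"
    using cc D by (auto simp: cocone_def is_functor_def)
  note ua = cocone_leg[OF cc]
  have uin: "u a \<cdot> e \<in> hom C x c" if "a \<in> Obj A" "e \<in> hom C x (fObj D a)" for a e
    by (rule comp_hom[OF that(2) ua[OF that(1)]])
  show "is_colimit ?S A (?HD D) (fObj (hom_functor C x) c) (\<lambda>a. fArr (hom_functor C x) (u a))"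
    unfolding is_colimit_def
  proof (intro conjI allI impI)
    show "cocone ?S A (?HD D) (fObj (hom_functor C x) c) (\<lambda>a. fArr (hom_functor C x) (u a))"
      unfolding cocone_def hom_functor_obj
    proof (intro conjI ballI)
      show "?I c \<in> Obj ?S" using sm[OF c] by (simp add: set_cat_simps)
      show "fArr (hom_functor C x) (u a) \<in> hom ?S (?I (fObj D a)) (?I c)" if "a \<in> Obj A" for a
        by (rule hom_functor_hom[OF ua[OF that] sm[OF Do[OF that]] sm[OF c]])
      fix f assume f: "f \<in> Arr A"
      have f': "f \<in> hom A (Dom A f) (Cod A f)" using f by (simp add: hom_def)
      have dc: "Dom A f \<in> Obj A" "Cod A f \<in> Obj A" using category.hom_objs[OF A1 f'] by auto
      have eq: "u (Cod A f) \<cdot> (fArr D f \<cdot> e) = u (Dom A f) \<cdot> e" if e: "e \<in> hom C x (fObj D (Dom A f))" for e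
        using comp_assoc[OF e functor_hom[OF D f'] ua[OF dc(2)]] cocone_naturality[OF cc f'] by simp
      have "(\<lambda>y \<in> ?I (fObj D (Cod A f)). Inr (u (Cod A f) \<cdot> projr y)) (Inr (fArr D f \<cdot> e))
          = (\<lambda>y \<in> ?I (fObj D (Dom A f)). Inr (u (Dom A f) \<cdot> projr y)) (Inr e)"
        if e: "e \<in> hom C x (fObj D (Dom A f))" for e
        using e comp_hom[OF e functor_hom[OF D f']] eq[OF e] by simp
      then show "fArr (hom_functor C x) (u (Cod A f)) \<cdot>\<^bsub>?S\<^esub> fArr (?HD D) f = fArr (hom_functor C x) (u (Dom A f))"
        unfolding func_comp_arr hom_functor_arr[OF ua[OF dc(1)]] hom_functor_arr[OF ua[OF dc(2)]]
          hom_functor_comp_iff[OF functor_hom[OF D f'] restrict_extensional] by blast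
    qed
    fix d v assume cv: "cocone ?S A (?HD D) d v"
    define w where "w a = fst (snd (v a))" for a
    have v: "v a = (?I (fObj D a), w a, d) \<and> w a \<in> ?I (fObj D a) \<rightarrow>\<^sub>E d" if a: "a \<in> Obj A" for a
    proof -
      have "v a \<in> hom ?S (?I (fObj D a)) d" using cv a by (simp add: cocone_def hom_functor_obj)
      then obtain \<phi> where "v a = (?I (fObj D a), \<phi>, d)" "\<phi> \<in> ?I (fObj D a) \<rightarrow>\<^sub>E d"
        unfolding set_cat_hom_iff by blast
      then show ?thesis by (simp add: w_def)
    qed
    have wext: "w a \<in> extensional (?I (fObj D a))" if "a \<in> Obj A" for a
      using v[OF that] by (simp add: PiE_def)
    have d: "small TYPE('s) d" using cv by (simp add: cocone_def set_cat_simps)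
    have wnat: "w b (Inr (fArr D f \<cdot> e)) = w a (Inr e)" if f: "f \<in> hom A a b" and e: "e \<in> hom C x (fObj D a)" for f a b e
    proof -
      have ab: "a \<in> Obj A" "b \<in> Obj A" using category.hom_objs[OF A1 f] by auto
      have "v b \<cdot>\<^bsub>?S\<^esub> fArr (?HD D) f = v a"
        using cv f by (auto simp: cocone_def hom_def)
      then have "(?I (fObj D b), w b, d) \<cdot>\<^bsub>?S\<^esub> fArr (hom_functor C x) (fArr D f) = (?I (fObj D a), w a, d)"
        using v[OF ab(1)] v[OF ab(2)] by (simp add: func_comp_arr)
      then show ?thesis
        unfolding hom_functor_comp_iff[OF functor_hom[OF D f] wext[OF ab(1)]] using e by blast
    qed
    have wd: "w a (Inr e) = w b (Inr e')" if a: "a \<in> Obj A" "e \<in> hom C x (fObj D a)"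
      and b: "b \<in> Obj A" "e' \<in> hom C x (fObj D b)" and eq: "u a \<cdot> e = u b \<cdot> e'" for a b e e'
    proof -
      obtain l i j where ij: "i \<in> hom A a l" "j \<in> hom A b l" and e: "fArr D i \<cdot> e = fArr D j \<cdot> e'"
        by (rule factors_through_joint[OF \<kappa> D A1 A(2) cc ft a b eq])
      show ?thesis using wnat[OF ij(1) a(2)] wnat[OF ij(2) b(2)] e by simp
    qed
    \<comment> \<open>The value at \<open>u a \<cdot> e\<close> has to be that of the cocone at
      \<open>a\<close>; by \<open>wd\<close> it does not depend on the chosen stage, so the
      description is unique.\<close>
    define g where "g = (\<lambda>y \<in> ?I c. THE z. \<exists>a \<in> Obj A. \<exists>e \<in> hom C x (fObj D a). projr y = u a \<cdot> e \<and> z = w a (Inr e))"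
    have g: "g (Inr (u a \<cdot> e)) = w a (Inr e)" if ae: "a \<in> Obj A" "e \<in> hom C x (fObj D a)" for a e
    proof -
      have "g (Inr (u a \<cdot> e)) = (THE z. \<exists>b \<in> Obj A. \<exists>e' \<in> hom C x (fObj D b). u a \<cdot> e = u b \<cdot> e' \<and> z = w b (Inr e'))"
        using uin[OF ae] by (simp add: g_def)
      also have "\<dots> = w a (Inr e)"
      proof (rule the_equality)
        show "\<exists>b \<in> Obj A. \<exists>e' \<in> hom C x (fObj D b). u a \<cdot> e = u b \<cdot> e' \<and> w a (Inr e) = w b (Inr e')"
          using ae by blast
        show "z = w a (Inr e)" if "\<exists>b \<in> Obj A. \<exists>e' \<in> hom C x (fObj D b). u a \<cdot> e = u b \<cdot> e' \<and> z = w b (Inr e')" for z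
          using that wd[OF ae] by (elim bexE conjE) simp
      qed
      finally show ?thesis .
    qed
    have fac: "\<exists>a \<in> Obj A. \<exists>e' \<in> hom C x (fObj D a). e = u a \<cdot> e'" if "e \<in> hom C x c" for e
      using ft that unfolding factors_through_def by blast
    have gd: "g \<in> ?I c \<rightarrow>\<^sub>E d"
    proof (rule PiE_I)
      fix y assume "y \<in> ?I c"
      then obtain e' where "y = Inr e'" "e' \<in> hom C x c" by blast
      with fac[OF this(2)] obtain a e where a: "a \<in> Obj A" and e: "e \<in> hom C x (fObj D a)" and y: "y = Inr (u a \<cdot> e)" by blast
      have "w a (Inr e) \<in> d" using v[OF a] e by blast
      then show "g y \<in> d" using g[OF a e] y by simp
    qed (simp add: g_def)
    have comp_iff: "(?I c, k, d) \<cdot>\<^bsub>?S\<^esub> fArr (hom_functor C x) (u a) = v a \<longleftrightarrow>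
        (\<forall>e \<in> hom C x (fObj D a). k (Inr (u a \<cdot> e)) = w a (Inr e))" if a: "a \<in> Obj A" for k a
      using hom_functor_comp_iff[OF ua[OF a] wext[OF a]] v[OF a] by simp
    show "\<exists>!h. h \<in> hom ?S (fObj (hom_functor C x) c) d \<and> (\<forall>a \<in> Obj A. h \<cdot>\<^bsub>?S\<^esub> fArr (hom_functor C x) (u a) = v a)"
      unfolding hom_functor_obj
    proof (rule ex1I[of _ "(?I c, g, d)"])
      show "(?I c, g, d) \<in> hom ?S (?I c) d \<and> (\<forall>a \<in> Obj A. (?I c, g, d) \<cdot>\<^bsub>?S\<^esub> fArr (hom_functor C x) (u a) = v a)"
        using g gd d sm[OF c] comp_iff by (simp add: set_cat_hom_iff)
      fix h assume h: "h \<in> hom ?S (?I c) d \<and> (\<forall>a \<in> Obj A. h \<cdot>\<^bsub>?S\<^esub> fArr (hom_functor C x) (u a) = v a)"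
      then obtain k where k: "h = (?I c, k, d)" "k \<in> ?I c \<rightarrow>\<^sub>E d" unfolding set_cat_hom_iff by blast
      have "k = g"
      proof (rule PiE_ext[OF k(2) gd])
        fix y assume "y \<in> ?I c"
        then obtain e' where "y = Inr e'" "e' \<in> hom C x c" by blast
        with fac[OF this(2)] obtain a e where a: "a \<in> Obj A" and e: "e \<in> hom C x (fObj D a)" and y: "y = Inr (u a \<cdot> e)" by blast
        have "(?I c, k, d) \<cdot>\<^bsub>?S\<^esub> fArr (hom_functor C x) (u a) = v a" using h a k(1) by simp
        then have "k (Inr (u a \<cdot> e)) = w a (Inr e)" unfolding comp_iff[OF a] using e by blast
        then show "k y = g y" using g[OF a e] y by simp
      qed
      then show "h = (?I c, g, d)" using k(1) by simp
    qed
  qed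
qed

lemma colimit_cocone: "is_colimit C A D c u \<Longrightarrow> cocone C A D c u"
  by (simp add: is_colimit_def)

lemma colimit_ex1:
  assumes "is_colimit C A D c u" "cocone C A D d v"
  shows "\<exists>!h. h \<in> hom C c d \<and> (\<forall>a \<in> Obj A. h \<cdot> u a = v a)"
  using assms unfolding is_colimit_def by blast

lemma cocone_comp:
  assumes D: "is_functor A C D" and A: "category A" and cc: "cocone C A D c u" and h: "h \<in> hom C c d"
  shows "cocone C A D d (\<lambda>a. h \<cdot> u a)"
  unfolding cocone_def
proof (intro conjI ballI)
  show "d \<in> Obj C" using hom_objs[OF h] by simp
  show "h \<cdot> u a \<in> hom C (fObj D a) d" if "a \<in> Obj A" for a
    by (rule comp_hom[OF cocone_leg[OF cc that] h])
  fix f assume f: "f \<in> Arr A"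
  have f': "f \<in> hom A (Dom A f) (Cod A f)" using f by (simp add: hom_def)
  have "Cod A f \<in> Obj A" using category.hom_objs[OF A f'] by simp
  then show "(h \<cdot> u (Cod A f)) \<cdot> fArr D f = h \<cdot> u (Dom A f)"
    using comp_assoc[OF functor_hom[OF D f'] cocone_leg[OF cc] h] cocone_naturality[OF cc f'] by simp
qed

lemma colimit_eqI:
  assumes colim: "is_colimit C A D c u" and D: "is_functor A C D" and A: "category A"
    and h: "h \<in> hom C c d" "h' \<in> hom C c d" "\<And>a. a \<in> Obj A \<Longrightarrow> h \<cdot> u a = h' \<cdot> u a"
  shows "h = h'"
  using colimit_ex1[OF colim cocone_comp[OF D A colimit_cocone[OF colim] h(1)]] h by metis

lemma colimit_cong:
  assumes A: "category A" and eq: "\<And>a. a \<in> Obj A \<Longrightarrow> u a = u' a" and colim: "is_colimit C A D c u"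
  shows "is_colimit C A D c u'"
proof -
  have "\<forall>f \<in> Arr A. u (Dom A f) = u' (Dom A f) \<and> u (Cod A f) = u' (Cod A f)"
    using eq category.dom_obj[OF A] category.cod_obj[OF A] by blast
  then have "cocone C A D c u'"
    using colimit_cocone[OF colim] eq by (auto simp: cocone_def)
  moreover have "(\<forall>a \<in> Obj A. h \<cdot> u' a = v a) \<longleftrightarrow> (\<forall>a \<in> Obj A. h \<cdot> u a = v a)" for h v
    using eq by simp
  ultimately show ?thesis
    using colim by (simp add: is_colimit_def)
qed

lemma colimit_iso:
  assumes colim: "is_colimit C A D c u" and D: "is_functor A C D" and A: "category A"
    and s: "s \<in> hom C c d" "is_iso C s"
  shows "is_colimit C A D d (\<lambda>a. s \<cdot> u a)"
  unfolding is_colimit_def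
proof (intro conjI allI impI)
  show "cocone C A D d (\<lambda>a. s \<cdot> u a)"
    by (rule cocone_comp[OF D A colimit_cocone[OF colim] s(1)])
  fix e v assume cv: "cocone C A D e v"
  have s' [simp]: "s \<in> Arr C" "Dom C s = c" "Cod C s = d" using s by (auto simp: hom_iff)
  have ua: "u a \<in> Arr C" "Cod C (u a) = c" if "a \<in> Obj A" for a
    using cocone_leg[OF colimit_cocone[OF colim] that] by (auto simp: hom_iff)
  obtain k where k: "k \<in> hom C c e" "\<forall>a \<in> Obj A. k \<cdot> u a = v a"
    and ku: "\<And>k'. k' \<in> hom C c e \<Longrightarrow> \<forall>a \<in> Obj A. k' \<cdot> u a = v a \<Longrightarrow> k' = k"
    using colimit_ex1[OF colim cv] by metis
  show "\<exists>!h. h \<in> hom C d e \<and> (\<forall>a \<in> Obj A. h \<cdot> (s \<cdot> u a) = v a)"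
  proof (rule ex1I[of _ "k \<cdot> inv_arr C s"])
    show "k \<cdot> inv_arr C s \<in> hom C d e \<and> (\<forall>a \<in> Obj A. (k \<cdot> inv_arr C s) \<cdot> (s \<cdot> u a) = v a)"
      using k s ua by (auto simp: hom_iff)
    fix h assume h: "h \<in> hom C d e \<and> (\<forall>a \<in> Obj A. h \<cdot> (s \<cdot> u a) = v a)"
    then have "h \<cdot> s = k"
      using ua by (intro ku) (auto simp: hom_iff)
    then have "(h \<cdot> s) \<cdot> inv_arr C s = k \<cdot> inv_arr C s" by simp
    then show "h = k \<cdot> inv_arr C s"
      using h s by (simp add: hom_iff)
  qed
qed

text \<open>The presentable objects form a strong generator: a map that every presentable object sees as a
  bijection is seen as a bijection by all colimits of these, that is, by all objects.\<close>

lemma strong_generator_iso: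
  fixes \<kappa> :: "'s rel"
  assumes lp: "locally_presentable \<kappa> C" and s: "s \<in> hom C l r"
    and bij: "\<And>z g. presentable \<kappa> C z \<Longrightarrow> g \<in> hom C z r \<Longrightarrow> \<exists>!g'. g' \<in> hom C z l \<and> s \<cdot> g' = g"
  shows "is_iso C s"
proof -
  have s' [simp]: "s \<in> Arr C" "Dom C s = l" "Cod C s = r" and lr [simp]: "l \<in> Obj C" "r \<in> Obj C"
    using s hom_objs[OF s] by (auto simp: hom_iff)
  have all: "\<exists>!g'. g' \<in> hom C w l \<and> s \<cdot> g' = g" if g: "g \<in> hom C w r" for w g
  proof -
    have "w \<in> Obj C" using hom_objs[OF g] by simp
    then obtain G and A :: "('s, 's) cat" and D u where A: "category A" and D: "is_functor A C D"
      and DG: "\<And>a. a \<in> Obj A \<Longrightarrow> presentable \<kappa> C (fObj D a)" and colim: "is_colimit C A D w u"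
      using lp unfolding locally_presentable_def small_category_def by metis
    note u = cocone_leg[OF colimit_cocone[OF colim]]
    have "\<forall>a \<in> Obj A. \<exists>k. k \<in> hom C (fObj D a) l \<and> s \<cdot> k = g \<cdot> u a"
      using bij[OF DG comp_hom[OF u g]] by blast
    then obtain k where k: "\<And>a. a \<in> Obj A \<Longrightarrow> k a \<in> hom C (fObj D a) l" "\<And>a. a \<in> Obj A \<Longrightarrow> s \<cdot> k a = g \<cdot> u a"
      by metis
    have "cocone C A D l k"
      unfolding cocone_def
    proof (intro conjI ballI)
      fix f assume f: "f \<in> Arr A"
      have f': "f \<in> hom A (Dom A f) (Cod A f)" using f by (simp add: hom_def)
      have o: "Dom A f \<in> Obj A" "Cod A f \<in> Obj A" using category.hom_objs[OF A f'] by auto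
      note Df = functor_hom[OF D f']
      have 1: "k (Cod A f) \<cdot> fArr D f \<in> hom C (fObj D (Dom A f)) l" by (rule comp_hom[OF Df k(1)[OF o(2)]])
      have "s \<cdot> (k (Cod A f) \<cdot> fArr D f) = (g \<cdot> u (Cod A f)) \<cdot> fArr D f"
        using comp_assoc[OF Df k(1)[OF o(2)] s] k(2)[OF o(2)] by simp
      also have "\<dots> = g \<cdot> u (Dom A f)"
        using comp_assoc[OF Df u[OF o(2)] g] cocone_naturality[OF colimit_cocone[OF colim] f'] by simp
      finally show "k (Cod A f) \<cdot> fArr D f = k (Dom A f)"
        using bij[OF DG[OF o(1)] comp_hom[OF u[OF o(1)] g]] 1 k[OF o(1)] by blast
    qed (use k in simp_all)
    from colimit_ex1[OF colim this] obtain h where h: "h \<in> hom C w l" "\<And>a. a \<in> Obj A \<Longrightarrow> h \<cdot> u a = k a" by blast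
    have "s \<cdot> h = g"
      by (rule colimit_eqI[OF colim D A comp_hom[OF h(1) s] g])
        (use comp_assoc[OF u h(1) s] h k in simp)
    moreover have "g1 = h" if g1: "g1 \<in> hom C w l" "s \<cdot> g1 = g" for g1
    proof (rule colimit_eqI[OF colim D A g1(1) h(1)])
      fix a assume a: "a \<in> Obj A"
      have "s \<cdot> (g1 \<cdot> u a) = g \<cdot> u a" using comp_assoc[OF u[OF a] g1(1) s] g1(2) by simp
      then show "g1 \<cdot> u a = h \<cdot> u a"
        using bij[OF DG[OF a] comp_hom[OF u[OF a] g]] comp_hom[OF u[OF a] g1(1)] k[OF a] h(2)[OF a] by metis
    qed
    ultimately show ?thesis using h(1) by blast
  qed
  \<comment> \<open>Lifting the identity yields a section \<open>t\<close> of \<open>s\<close>. It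
    is also a retraction, because \<open>t \<cdot> s\<close> and the identity are both lifts of
    \<open>s\<close> through itself.\<close>
  obtain t where t: "t \<in> hom C r l" "s \<cdot> t = Id C r"
    using all[OF id_hom[OF lr(2)]] by blast
  have "s \<cdot> (t \<cdot> s) = s" "s \<cdot> Id C l = s"
    using comp_assoc[OF s t(1) s] t by simp_all
  then have "t \<cdot> s = Id C l"
    using all[OF s] comp_hom[OF s t(1)] id_hom[OF lr(1)] by blast
  then show ?thesis by (rule is_isoI[OF s t(1) _ t(2)])
qed

lemma hom_functor_functor:
  assumes D: "is_functor A C D" and A: "category A"
    and sm: "\<And>a. a \<in> Obj A \<Longrightarrow> small TYPE('s) (Inr ` hom C x (fObj D a) :: ('s + 'm) set)"
  shows "is_functor A (sets :: (('s + 'm) set, _) cat) (func_comp (hom_functor C x) D)"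
  unfolding is_functor_def hom_functor_obj func_comp_arr
proof (intro conjI ballI allI)
  let ?S = "sets :: (('s + 'm) set, _) cat"
  fix a assume a: "a \<in> Obj A"
  show "Inr ` hom C x (fObj D a) \<in> Obj ?S" using sm[OF a] by (simp add: set_cat_simps)
  have Da: "fObj D a \<in> Obj C" "fArr D (Id A a) = Id C (fObj D a)" using D a by (auto simp: is_functor_def)
  have "(\<lambda>y \<in> Inr ` hom C x (fObj D a). Inr (Id C (fObj D a) \<cdot> projr y)) = (restrict id (Inr ` hom C x (fObj D a)) :: 's + 'm \<Rightarrow> _)"
    by (rule restrict_ext) (auto simp: id_comp)
  then show "fArr (hom_functor C x) (fArr D (Id A a)) = Id ?S (Inr ` hom C x (fObj D a))"
    unfolding Da(2) hom_functor_arr[OF id_hom[OF Da(1)]] set_cat_simps by simp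
next
  let ?S = "sets :: (('s + 'm) set, _) cat"
  fix f assume "f \<in> Arr A"
  then have f: "f \<in> hom A (Dom A f) (Cod A f)" by (simp add: hom_def)
  show "fArr (hom_functor C x) (fArr D f) \<in> hom ?S (Inr ` hom C x (fObj D (Dom A f))) (Inr ` hom C x (fObj D (Cod A f)))"
    using category.hom_objs[OF A f] by (intro hom_functor_hom[OF functor_hom[OF D f]] sm) auto
next
  let ?S = "sets :: (('s + 'm) set, _) cat"
  fix a b c f g assume f: "f \<in> hom A a b" and g: "g \<in> hom A b c"
  note Df = functor_hom[OF D f] and Dg = functor_hom[OF D g]
  have "(\<lambda>y \<in> Inr ` hom C x (fObj D b). Inr (fArr D g \<cdot> projr y)) (Inr (fArr D f \<cdot> e))
      = (\<lambda>y \<in> Inr ` hom C x (fObj D a). Inr ((fArr D g \<cdot> fArr D f) \<cdot> projr y)) (Inr e)"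
    if e: "e \<in> hom C x (fObj D a)" for e
    using e comp_hom[OF e Df] comp_assoc[OF e Df Dg] by simp
  then have "fArr (hom_functor C x) (fArr D g) \<cdot>\<^bsub>?S\<^esub> fArr (hom_functor C x) (fArr D f)
      = fArr (hom_functor C x) (fArr D g \<cdot> fArr D f)"
    unfolding hom_functor_arr[OF Dg] hom_functor_arr[OF comp_hom[OF Df Dg]]
      hom_functor_comp_iff[OF Df restrict_extensional] by blast
  then show "fArr (hom_functor C x) (fArr D (g \<cdot>\<^bsub>A\<^esub> f))
      = fArr (hom_functor C x) (fArr D g) \<cdot>\<^bsub>?S\<^esub> fArr (hom_functor C x) (fArr D f)"
    using functor_comp[OF D f g] by simp
qed

end

section \<open>Colimits, tensor products and internal homs\<close>

context symmetric_monoidal_closed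
begin

text \<open>Tensoring with \<open>w\<close> is a left adjoint: the family \<open>v\<close> is
  transposed to a cocone with vertex \<open>[w,d]\<close>. The symmetry enters because evaluation is
  the counit for tensoring on the other side.\<close>

lemma tensor_colimit:
  assumes colim: "is_colimit V A D c u" and D: "is_functor A V D" and A: "category A" and w [simp]: "w \<in> Obj V"
    and v: "\<And>a. a \<in> Obj A \<Longrightarrow> v a \<in> hom V (w \<otimes> fObj D a) d" and d [simp]: "d \<in> Obj V"
    and nat: "\<And>a b f. f \<in> hom A a b \<Longrightarrow> v b \<cdot> (\<ee> w \<odot> fArr D f) = v a"
  shows "\<exists>!h. h \<in> hom V (w \<otimes> c) d \<and> (\<forall>a \<in> Obj A. h \<cdot> (\<ee> w \<odot> u a) = v a)"
proof -
  have c [simp]: "c \<in> Obj V" using colim by (simp add: is_colimit_def cocone_def)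
  have Do [simp]: "fObj D a \<in> Obj V" if "a \<in> Obj A" for a using D that by (simp add: is_functor_def)
  have ua [simp]: "u a \<in> Arr V" "Dom V (u a) = fObj D a" "Cod V (u a) = c" if "a \<in> Obj A" for a
    using cocone_leg[OF colimit_cocone[OF colim] that] by (auto simp: hom_iff)
  have va [simp]: "v a \<in> Arr V" "Dom V (v a) = w \<otimes> fObj D a" "Cod V (v a) = d" if "a \<in> Obj A" for a
    using v[OF that] by (auto simp: hom_iff)
  define k where "k a = curry_arr V (fObj D a) w d (v a \<cdot> \<ss> (fObj D a) w)" for a
  have ka [simp]: "k a \<in> Arr V" "Dom V (k a) = fObj D a" "Cod V (k a) = ihom w d" if "a \<in> Obj A" for a
    using that by (simp_all add: k_def)
  have "cocone V A D (ihom w d) k"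
    unfolding cocone_def
  proof (intro conjI ballI)
    show "ihom w d \<in> Obj V" by simp
    show "k a \<in> hom V (fObj D a) (ihom w d)" if "a \<in> Obj A" for a using that by (simp add: hom_iff)
    fix f assume f: "f \<in> Arr A"
    have f': "f \<in> hom A (Dom A f) (Cod A f)" using f by (simp add: hom_def)
    have o [simp]: "Dom A f \<in> Obj A" "Cod A f \<in> Obj A" using category.hom_objs[OF A f'] by auto
    have Df [simp]: "fArr D f \<in> Arr V" "Dom V (fArr D f) = fObj D (Dom A f)" "Cod V (fArr D f) = fObj D (Cod A f)"
      using functor_hom[OF D f'] by (auto simp: hom_iff)
    have "v (Cod A f) \<cdot> (\<ss> (fObj D (Cod A f)) w \<cdot> (fArr D f \<odot> \<ee> w)) = v (Cod A f) \<cdot> ((\<ee> w \<odot> fArr D f) \<cdot> \<ss> (fObj D (Dom A f)) w)"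
      by (simp add: nat_symm)
    also have "\<dots> = v (Dom A f) \<cdot> \<ss> (fObj D (Dom A f)) w"
      by (rule reassoc[OF nat[OF f']]) simp_all
    finally show "k (Cod A f) \<cdot> fArr D f = k (Dom A f)"
      by (simp add: k_def curry_comp)
  qed
  note ex1 = colimit_ex1[OF colim this]
  then obtain h where h: "h \<in> hom V c (ihom w d)" "\<And>a. a \<in> Obj A \<Longrightarrow> h \<cdot> u a = k a" by blast
  have hu: "h' = h" if "h' \<in> hom V c (ihom w d)" "\<And>a. a \<in> Obj A \<Longrightarrow> h' \<cdot> u a = k a" for h'
    using ex1 h that by blast
  have [simp]: "h \<in> Arr V" "Dom V h = c" "Cod V h = ihom w d" using h by (auto simp: hom_iff)
  show ?thesis
  proof (rule ex1I[of _ "ev w d \<cdot> (h \<odot> \<ee> w) \<cdot> \<ss> w c"])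
    have "(ev w d \<cdot> (h \<odot> \<ee> w) \<cdot> \<ss> w c) \<cdot> (\<ee> w \<odot> u a) = v a" if a [simp]: "a \<in> Obj A" for a
    proof -
      have "(ev w d \<cdot> (h \<odot> \<ee> w) \<cdot> \<ss> w c) \<cdot> (\<ee> w \<odot> u a) = ev w d \<cdot> ((h \<cdot> u a) \<odot> \<ee> w) \<cdot> \<ss> w (fObj D a)"
        by (simp add: nat_symm)
      also have "\<dots> = v a \<cdot> (\<ss> (fObj D a) w \<cdot> \<ss> w (fObj D a))"
        by (simp add: h(2) k_def)
      finally show ?thesis by (simp add: symm_symm)
    qed
    then show "ev w d \<cdot> (h \<odot> \<ee> w) \<cdot> \<ss> w c \<in> hom V (w \<otimes> c) d \<and>
        (\<forall>a \<in> Obj A. (ev w d \<cdot> (h \<odot> \<ee> w) \<cdot> \<ss> w c) \<cdot> (\<ee> w \<odot> u a) = v a)"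
      by (simp add: hom_iff)
    fix g assume g: "g \<in> hom V (w \<otimes> c) d \<and> (\<forall>a \<in> Obj A. g \<cdot> (\<ee> w \<odot> u a) = v a)"
    then have g' [simp]: "g \<in> Arr V" "Dom V g = w \<otimes> c" "Cod V g = d" by (auto simp: hom_iff)
    have "curry_arr V c w d (g \<cdot> \<ss> c w) \<cdot> u a = k a" if a [simp]: "a \<in> Obj A" for a
    proof -
      have "(g \<cdot> \<ss> c w) \<cdot> (u a \<odot> \<ee> w) = (g \<cdot> (\<ee> w \<odot> u a)) \<cdot> \<ss> (fObj D a) w"
        by (simp add: nat_symm)
      then show ?thesis using g by (simp add: curry_comp k_def)
    qed
    then have hc: "curry_arr V c w d (g \<cdot> \<ss> c w) = h"
      by (intro hu) (simp_all add: hom_iff)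
    have "ev w d \<cdot> (h \<odot> \<ee> w) \<cdot> \<ss> w c = g \<cdot> (\<ss> c w \<cdot> \<ss> w c)"
      unfolding hc[symmetric] by simp
    then show "g = ev w d \<cdot> (h \<odot> \<ee> w) \<cdot> \<ss> w c"
      by (simp add: symm_symm)
  qed
qed

definition post_functor :: "'o \<Rightarrow> ('a, 'f, 'o, 'm) func \<Rightarrow> ('a, 'f, 'o, 'm) func" where
  "post_functor x D = \<lparr>fObj = \<lambda>a. ihom x (fObj D a), fArr = \<lambda>f. post x (fArr D f)\<rparr>"

lemma post_hom: "x \<in> Obj V \<Longrightarrow> f \<in> hom V a b \<Longrightarrow> post x f \<in> hom V (ihom x a) (ihom x b)"
  by (simp add: hom_iff)

lemma post_functor_functor:
  assumes D: "is_functor A V D" and x: "x \<in> Obj V"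
  shows "is_functor A V (post_functor x D)"
  unfolding is_functor_def
proof (intro conjI ballI allI)
  fix a assume a: "a \<in> Obj A"
  have Da: "fObj D a \<in> Obj V" "fArr D (Id A a) = \<ee> (fObj D a)" using D a by (auto simp: is_functor_def)
  show "fObj (post_functor x D) a \<in> Obj V" using Da x by (simp add: post_functor_def)
  show "fArr (post_functor x D) (Id A a) = \<ee> (fObj (post_functor x D) a)"
    using Da x by (simp add: post_functor_def post_id)
next
  fix f assume "f \<in> Arr A"
  then have "fArr D f \<in> hom V (fObj D (Dom A f)) (fObj D (Cod A f))" using D by (simp add: is_functor_def)
  then show "fArr (post_functor x D) f \<in> hom V (fObj (post_functor x D) (Dom A f)) (fObj (post_functor x D) (Cod A f))"
    using x by (simp add: post_functor_def post_hom)
next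
  fix a b c f g assume f: "f \<in> hom A a b" and g: "g \<in> hom A b c"
  then show "fArr (post_functor x D) (g \<cdot>\<^bsub>A\<^esub> f) = fArr (post_functor x D) g \<cdot> fArr (post_functor x D) f"
    using functor_comp[OF D f g] functor_hom[OF D f] functor_hom[OF D g] x by (simp add: post_functor_def post_comp hom_iff)
qed

lemma uncurry_post:
  assumes "x \<in> Obj V" "f \<in> hom V a b" "k \<in> hom V z (ihom x a)"
  shows "ev x b \<cdot> ((post x f \<cdot> k) \<odot> \<ee> x) = f \<cdot> (ev x a \<cdot> (k \<odot> \<ee> x))"
  using assms by (subst ev_post) (auto simp: hom_iff)

lemma post_curry:
  assumes "x \<in> Obj V" "z \<in> Obj V" "f \<in> hom V a b" "k \<in> hom V (z \<otimes> x) a"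
  shows "post x f \<cdot> curry_arr V z x a k = curry_arr V z x b (f \<cdot> k)"
proof -
  have [simp]: "a \<in> Obj V" "b \<in> Obj V" using hom_objs[OF assms(3)] by auto
  show ?thesis
    by (rule ihom_eqI[of x b]) (use assms in \<open>simp_all add: uncurry_post hom_iff ev_post\<close>)
qed

text \<open>Maps \<open>z \<rightarrow> [x, -]\<close> are maps \<open>z \<otimes> x \<rightarrow> -\<close>, and \<open>z \<otimes> x\<close> is presentable if \<open>z\<close> and \<open>x\<close> are.\<close>

lemma ihom_colimit:
  fixes \<kappa> :: "'s rel" and A :: "('s, 's) cat"
  assumes \<kappa>: "small_regular_cardinal \<kappa>" and lp: "locally_presentable_smc \<kappa> V" and x: "presentable \<kappa> V x"
    and A: "small_category A" "filtered \<kappa> A" and D: "is_functor A V D" and colim: "is_colimit V A D c u"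
  shows "is_colimit V A (post_functor x D) (ihom x c) (\<lambda>a. post x (u a))"
proof -
  let ?P = "post_functor x D"
  have A1: "category A" using A by (simp add: small_category_def)
  have P_simps: "fObj ?P a = ihom x (fObj D a)" "fArr ?P f = post x (fArr D f)" for a f
    by (simp_all add: post_functor_def)
  have x' [simp]: "x \<in> Obj V" using x by (simp add: presentable_def)
  have c [simp]: "c \<in> Obj V" using colim by (simp add: is_colimit_def cocone_def)
  have Do [simp]: "fObj D a \<in> Obj V" if "a \<in> Obj A" for a using D that by (simp add: is_functor_def)
  note u = cocone_leg[OF colimit_cocone[OF colim]]
  note P = post_functor_functor[OF D x']
  \<comment> \<open>Cocompleteness provides some colimit \<open>l\<close> of the diagram of internal
    homs; the comparison \<open>s\<close> from it to \<open>[x,c]\<close> is shown invertible by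
    testing on presentable objects.\<close>
  obtain l v where lv: "is_colimit V A ?P l v"
    using lp A P unfolding locally_presentable_smc_def locally_presentable_def cocomplete_def by blast
  note v = cocone_leg[OF colimit_cocone[OF lv]]
  have "cocone V A ?P (ihom x c) (\<lambda>a. post x (u a))"
    unfolding cocone_def P_simps
  proof (intro conjI ballI)
    show "post x (u a) \<in> hom V (ihom x (fObj D a)) (ihom x c)" if "a \<in> Obj A" for a
      using post_hom[OF x' u[OF that]] .
    fix f assume f: "f \<in> Arr A"
    have f': "f \<in> hom A (Dom A f) (Cod A f)" using f by (simp add: hom_def)
    have "Cod A f \<in> Obj A" using category.hom_objs[OF A1 f'] by auto
    then have "post x (u (Cod A f)) \<cdot> post x (fArr D f) = post x (u (Cod A f) \<cdot> fArr D f)"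
      using u functor_hom[OF D f'] by (intro post_comp) (auto simp: hom_iff)
    then show "post x (u (Cod A f)) \<cdot> post x (fArr D f) = post x (u (Dom A f))"
      using cocone_naturality[OF colimit_cocone[OF colim] f'] by simp
  qed simp
  from colimit_ex1[OF lv this] obtain s where s: "s \<in> hom V l (ihom x c)"
    and sv: "\<And>a. a \<in> Obj A \<Longrightarrow> s \<cdot> v a = post x (u a)" by blast
  have "is_iso V s"
  proof (rule strong_generator_iso[OF _ s])
    show "locally_presentable \<kappa> V" using lp by (simp add: locally_presentable_smc_def)
    fix z g assume z: "presentable \<kappa> V z" and g: "g \<in> hom V z (ihom x c)"
    have z' [simp]: "z \<in> Obj V" using z by (simp add: presentable_def)
    have zx: "presentable \<kappa> V (z \<otimes> x)" using lp z x by (simp add: locally_presentable_smc_def)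
    have f1: "factors_through (z \<otimes> x) A D c u"
      by (rule presentable_factors[OF \<kappa> zx D A colim])
    have f2: "factors_through z A ?P l v"
      by (rule presentable_factors[OF \<kappa> z P A lv])
    have "ev x c \<cdot> (g \<odot> \<ee> x) \<in> hom V (z \<otimes> x) c" using g by (simp add: hom_iff)
    then obtain a e where a: "a \<in> Obj A" and e: "e \<in> hom V (z \<otimes> x) (fObj D a)"
      and ge: "ev x c \<cdot> (g \<odot> \<ee> x) = u a \<cdot> e"
      using f1 unfolding factors_through_def by blast
    let ?e = "curry_arr V z x (fObj D a) e"
    have e': "?e \<in> hom V z (fObj ?P a)" using e a by (simp add: hom_iff P_simps)
    have "post x (u a) \<cdot> ?e = curry_arr V z x c (u a \<cdot> e)"
      by (rule post_curry[OF x' z' u[OF a] e])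
    also have "\<dots> = g"
      by (rule ihom_eqI[of x c]) (use ge g comp_hom[OF e u[OF a]] in \<open>simp_all add: hom_iff\<close>)
    finally have "s \<cdot> (v a \<cdot> ?e) = g"
      using comp_assoc[OF e' v[OF a] s] sv[OF a] by simp
    \<comment> \<open>Both lifts come from stages. Their transposes agree in \<open>c\<close>, hence
      at a common stage because \<open>z \<otimes> x\<close> is presentable, hence the lifts agree
      in \<open>l\<close>.\<close>
    moreover have "g1 = g2"
      if g12: "g1 \<in> hom V z l" "s \<cdot> g1 = g" "g2 \<in> hom V z l" "s \<cdot> g2 = g" for g1 g2
    proof -
      obtain b1 e1 b2 e2 where b1: "b1 \<in> Obj A" "e1 \<in> hom V z (fObj ?P b1)" "g1 = v b1 \<cdot> e1"
        and b2: "b2 \<in> Obj A" "e2 \<in> hom V z (fObj ?P b2)" "g2 = v b2 \<cdot> e2"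
        using f2 g12 unfolding factors_through_def by metis
      note e1 = b1(2)[unfolded P_simps] and e2 = b2(2)[unfolded P_simps]
      have "post x (u b1) \<cdot> e1 = g" "post x (u b2) \<cdot> e2 = g"
        using comp_assoc[OF b1(2) v[OF b1(1)] s] comp_assoc[OF b2(2) v[OF b2(1)] s] sv b1 b2 g12 by simp_all
      then have eq: "u b1 \<cdot> (ev x (fObj D b1) \<cdot> (e1 \<odot> \<ee> x)) = u b2 \<cdot> (ev x (fObj D b2) \<cdot> (e2 \<odot> \<ee> x))"
        using uncurry_post[OF x' u[OF b1(1)] e1] uncurry_post[OF x' u[OF b2(1)] e2] by simp
      have h: "ev x (fObj D b1) \<cdot> (e1 \<odot> \<ee> x) \<in> hom V (z \<otimes> x) (fObj D b1)"
        "ev x (fObj D b2) \<cdot> (e2 \<odot> \<ee> x) \<in> hom V (z \<otimes> x) (fObj D b2)"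
        using e1 e2 b1(1) b2(1) by (simp_all add: hom_iff)
      obtain k i j where k: "k \<in> Obj A" and i: "i \<in> hom A b1 k" and j: "j \<in> hom A b2 k"
        and ij: "fArr D i \<cdot> (ev x (fObj D b1) \<cdot> (e1 \<odot> \<ee> x)) = fArr D j \<cdot> (ev x (fObj D b2) \<cdot> (e2 \<odot> \<ee> x))"
        by (rule factors_through_joint[OF \<kappa> D A1 A(2) colimit_cocone[OF colim] f1 b1(1) h(1) b2(1) h(2) eq])
      have ij': "post x (fArr D i) \<cdot> e1 = post x (fArr D j) \<cdot> e2"
      proof (rule ihom_eqI[of x "fObj D k"])
        show "ev x (fObj D k) \<cdot> ((post x (fArr D i) \<cdot> e1) \<odot> \<ee> x) = ev x (fObj D k) \<cdot> ((post x (fArr D j) \<cdot> e2) \<odot> \<ee> x)"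
          unfolding uncurry_post[OF x' functor_hom[OF D i] e1] uncurry_post[OF x' functor_hom[OF D j] e2] by (rule ij)
      qed (use functor_hom[OF D i] functor_hom[OF D j] e1 e2 k in \<open>simp_all add: hom_iff\<close>)
      have "g1 = v k \<cdot> (fArr ?P i \<cdot> e1)"
        using comp_assoc[OF b1(2) functor_hom[OF P i] v[OF k]] cocone_naturality[OF colimit_cocone[OF lv] i] b1(3) by simp
      also have "\<dots> = v k \<cdot> (fArr ?P j \<cdot> e2)" using ij' by (simp add: P_simps)
      also have "\<dots> = g2"
        using comp_assoc[OF b2(2) functor_hom[OF P j] v[OF k]] cocone_naturality[OF colimit_cocone[OF lv] j] b2(3) by simp
      finally show ?thesis .
    qed
    ultimately show "\<exists>!g'. g' \<in> hom V z l \<and> s \<cdot> g' = g"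
      using comp_hom[OF e' v[OF a]] by blast
  qed
  from colimit_iso[OF lv P A1 s this] have "is_colimit V A ?P (ihom x c) (\<lambda>a. s \<cdot> v a)" .
  then show ?thesis
    by (rule colimit_cong[OF A1, rotated]) (rule sv)
qed

section \<open>Copowers of the unit\<close>

lemma copowerD:
  assumes "is_unit_copower V S x0 \<iota>"
  shows "x0 \<in> Obj V" "s \<in> S \<Longrightarrow> \<iota> s \<in> hom V \<I> x0"
    "(\<And>s. s \<in> S \<Longrightarrow> g s \<in> hom V \<I> y) \<Longrightarrow> y \<in> Obj V \<Longrightarrow> \<exists>!h. h \<in> hom V x0 y \<and> (\<forall>s \<in> S. h \<cdot> \<iota> s = g s)"
  using assms unfolding is_unit_copower_def by blast+

lemma copower_eqI:
  assumes "is_unit_copower V S x0 \<iota>" "h \<in> hom V x0 y" "h' \<in> hom V x0 y" "\<And>s. s \<in> S \<Longrightarrow> h \<cdot> \<iota> s = h' \<cdot> \<iota> s"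
  shows "h = h'"
proof -
  have "\<exists>!k. k \<in> hom V x0 y \<and> (\<forall>s \<in> S. k \<cdot> \<iota> s = h \<cdot> \<iota> s)"
    by (rule copowerD(3)[OF assms(1)])
      (use comp_hom[OF copowerD(2)[OF assms(1)] assms(2)] hom_objs[OF assms(2)] in auto)
  then show ?thesis using assms(2-4) by metis
qed

text \<open>Cocompleteness covers diagrams indexed by categories inside \<open>'s\<close>, so the
  index set is first injected into \<open>'s\<close> and its image regarded as a discrete
  category.\<close>

lemma copower_exists:
  assumes lp: "locally_presentable (\<kappa> :: 's rel) V" and S: "small TYPE('s) S"
  obtains x0 \<iota> where "is_unit_copower V S x0 \<iota>"
proof -
  obtain k :: "_ \<Rightarrow> 's" where k: "inj_on k S"
    using S card_of_ordLeq[of S "UNIV :: 's set"] ordLess_imp_ordLeq unfolding small_def by blast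
  define A :: "('s, 's) cat" where
    "A = \<lparr>Obj = k ` S, Arr = k ` S, Dom = (\<lambda>a. a), Cod = (\<lambda>a. a), Id = (\<lambda>a. a), Comp = (\<lambda>g f. f)\<rparr>"
  have "category A"
    by unfold_locales (auto simp: A_def hom_def)
  moreover have "small TYPE('s) (k ` S)"
    using S card_of_image ordLeq_ordLess_trans unfolding small_def by blast
  ultimately have A: "small_category A"
    by (simp add: small_category_def A_def)
  define D :: "('s, 's, 'o, 'm) func" where "D = \<lparr>fObj = (\<lambda>_. \<I>), fArr = (\<lambda>_. \<ee> \<I>)\<rparr>"
  have "is_functor A V D"
    by (auto simp: is_functor_def D_def hom_iff)
  then obtain c u where colim: "is_colimit V A D c u"
    using lp A unfolding locally_presentable_def cocomplete_def by blast
  have cocone_iff: "cocone V A D d v \<longleftrightarrow> d \<in> Obj V \<and> (\<forall>s \<in> S. v (k s) \<in> hom V \<I> d)" for d v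
    unfolding cocone_def by (auto simp: A_def D_def hom_iff)
  have "is_unit_copower V S c (\<lambda>s. u (k s))"
    unfolding is_unit_copower_def
  proof (intro conjI ballI allI impI)
    show "c \<in> Obj V" "\<And>s. s \<in> S \<Longrightarrow> u (k s) \<in> hom V \<I> c"
      using colimit_cocone[OF colim] unfolding cocone_iff by auto
    fix y g assume y: "y \<in> Obj V" and g: "\<forall>s \<in> S. g s \<in> hom V \<I> y"
    have "cocone V A D y (\<lambda>a. g (the_inv_into S k a))"
      unfolding cocone_iff using y g by (simp add: the_inv_into_f_f[OF k])
    from colimit_ex1[OF colim this] show "\<exists>!h. h \<in> hom V c y \<and> (\<forall>s \<in> S. h \<cdot> u (k s) = g s)"
      by (simp add: A_def the_inv_into_f_f[OF k])
  qed
  then show thesis by (rule that)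
qed

text \<open>A copower obtained as a colimit need not lie in \<open>P\<close>; this transports its
  universal property to an isomorphic representative that does.\<close>

lemma copower_iso:
  assumes c: "is_unit_copower V S x0 \<iota>" and j: "j \<in> hom V x1 x0" "is_iso V j"
  shows "is_unit_copower V S x1 (\<lambda>s. inva j \<cdot> \<iota> s)"
  unfolding is_unit_copower_def
proof (intro conjI ballI allI impI)
  have j' [simp]: "j \<in> Arr V" "Dom V j = x1" "Cod V j = x0" using j by (auto simp: hom_iff)
  have i [simp]: "\<iota> s \<in> Arr V" "Dom V (\<iota> s) = \<I>" "Cod V (\<iota> s) = x0" if "s \<in> S" for s
    using copowerD(2)[OF c that] by (auto simp: hom_iff)
  show "x1 \<in> Obj V" using hom_objs[OF j(1)] by simp
  show "inva j \<cdot> \<iota> s \<in> hom V \<I> x1" if "s \<in> S" for s using that j by (simp add: hom_iff)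
  fix y g assume y: "y \<in> Obj V" and g: "\<forall>s \<in> S. g s \<in> hom V \<I> y"
  have ex1: "\<exists>!h. h \<in> hom V x0 y \<and> (\<forall>s \<in> S. h \<cdot> \<iota> s = g s)"
    by (rule copowerD(3)[OF c _ y]) (use g in blast)
  then obtain h where h: "h \<in> hom V x0 y" "\<And>s. s \<in> S \<Longrightarrow> h \<cdot> \<iota> s = g s" by blast
  show "\<exists>!h. h \<in> hom V x1 y \<and> (\<forall>s \<in> S. h \<cdot> (inva j \<cdot> \<iota> s) = g s)"
  proof (rule ex1I[of _ "h \<cdot> j"])
    show "h \<cdot> j \<in> hom V x1 y \<and> (\<forall>s \<in> S. (h \<cdot> j) \<cdot> (inva j \<cdot> \<iota> s) = g s)"
      using h j by (auto simp: hom_iff)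
    fix h' assume h': "h' \<in> hom V x1 y \<and> (\<forall>s \<in> S. h' \<cdot> (inva j \<cdot> \<iota> s) = g s)"
    have "h' \<cdot> inva j = h"
      by (rule copower_eqI[OF c, of _ y]) (use h h' j in \<open>auto simp: hom_iff\<close>)
    then have "(h' \<cdot> inva j) \<cdot> j = h \<cdot> j" by simp
    then show "h' = h \<cdot> j" using h' j by (simp add: hom_iff)
  qed
qed

text \<open>Maps out of the copower \<open>S \<cdot> I\<close> are maps of sets out of \<open>S\<close>, and \<open>V(I, -)\<close> preserves filtered
  colimits because \<open>I\<close> is presentable.\<close>

lemma copower_presentable:
  fixes \<kappa> :: "'s rel"
  assumes \<kappa>: "small_regular_cardinal \<kappa>" and lp: "locally_presentable_smc \<kappa> V"
    and S: "presentable \<kappa> (sets :: (('s + 'm) set, _) cat) (Inr ` S)"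
    and cop: "is_unit_copower V S x0 \<iota>"
  shows "presentable \<kappa> V x0"
proof (rule presentableI[OF \<kappa>])
  let ?S = "sets :: (('s + 'm) set, _) cat"
  interpret S: category ?S by (rule set_cat_category)
  show ls: "locally_small TYPE('s) V" using lp by (simp add: locally_presentable_smc_def locally_presentable_def)
  show x0: "x0 \<in> Obj V" by (rule copowerD(1)[OF cop])
  fix A :: "('s, 's) cat" and D c u
  assume A: "small_category A" "filtered \<kappa> A" and D: "is_functor A V D" and colim: "is_colimit V A D c u"
  have A1: "category A" using A by (simp add: small_category_def)
  let ?H = "func_comp (hom_functor V \<I>) D"
  let ?I = "\<lambda>y. Inr ` hom V \<I> y :: ('s + 'm) set"
  note u = cocone_leg[OF colimit_cocone[OF colim]]
  have c: "c \<in> Obj V" and Do: "\<And>a. a \<in> Obj A \<Longrightarrow> fObj D a \<in> Obj V"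
    using colim D by (auto simp: is_colimit_def cocone_def is_functor_def)
  have sm: "small TYPE('s) (?I y)" if "y \<in> Obj V" for y
    using ls unit_obj that unfolding locally_small_def small_def by (meson card_of_image ordLeq_ordLess_trans)
  have smS: "small TYPE('s) (Inr ` S :: ('s + 'm) set)" using S by (simp add: presentable_def set_cat_simps)
  have H: "is_functor A ?S ?H" by (rule hom_functor_functor[OF D A1 sm[OF Do]])
  have "is_colimit ?S A ?H (fObj (hom_functor V \<I>) c) (\<lambda>a. fArr (hom_functor V \<I>) (u a))"
    using lp A D colim unfolding locally_presentable_smc_def presentable_def by blast
  from S.presentable_factors[OF \<kappa> S H A this]
  have ft: "S.factors_through (Inr ` S) A ?H (?I c) (\<lambda>a. fArr (hom_functor V \<I>) (u a))"
    by (simp add: hom_functor_obj)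
  \<comment> \<open>\<open>t y e\<close> is the map of sets from \<open>S\<close> to
    \<open>V(I,y)\<close> corresponding to \<open>e\<close>. By \<open>t_inj\<close>,
    \<open>t_surj\<close> and \<open>t_nat\<close> this is a natural bijection, along which
    factorization is carried over from sets to \<open>V\<close>.\<close>
  define t :: "'o \<Rightarrow> 'm \<Rightarrow> ('s + 'm) set \<times> ('s + 'm \<Rightarrow> 's + 'm) \<times> ('s + 'm) set"
    where "t y e = (Inr ` S, \<lambda>s \<in> Inr ` S. Inr (e \<cdot> \<iota> (projr s)), ?I y)" for y e
  have t_hom: "t y e \<in> hom ?S (Inr ` S) (?I y)" if e: "e \<in> hom V x0 y" for y e
  proof -
    have "(\<lambda>s \<in> Inr ` S. Inr (e \<cdot> \<iota> (projr s))) \<in> (Inr ` S :: ('s + 'm) set) \<rightarrow>\<^sub>E ?I y"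
      using comp_hom[OF copowerD(2)[OF cop] e] by auto
    then show ?thesis using smS sm[of y] hom_objs[OF e] by (simp add: t_def set_cat_hom_iff)
  qed
  have t_inj: "e = e'" if e: "e \<in> hom V x0 y" "e' \<in> hom V x0 y" and eq: "t y e = t y e'" for y e e'
  proof (rule copower_eqI[OF cop e])
    fix s assume s: "s \<in> S"
    have "(\<lambda>s \<in> Inr ` S. Inr (e \<cdot> \<iota> (projr s))) = ((\<lambda>s \<in> Inr ` S. Inr (e' \<cdot> \<iota> (projr s))) :: 's + 'm \<Rightarrow> 's + 'm)"
      using eq by (simp add: t_def)
    from fun_cong[OF this, of "Inr s"] s show "e \<cdot> \<iota> s = e' \<cdot> \<iota> s" by simp
  qed
  have t_surj: "\<exists>e \<in> hom V x0 y. k = t y e" if k: "k \<in> hom ?S (Inr ` S) (?I y)" and y: "y \<in> Obj V" for k y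
  proof -
    obtain \<phi> where \<phi>: "k = (Inr ` S, \<phi>, ?I y)" "\<phi> \<in> Inr ` S \<rightarrow>\<^sub>E ?I y" using k unfolding set_cat_hom_iff by blast
    have in_I: "\<phi> (Inr s) \<in> ?I y" if "s \<in> S" for s by (rule PiE_mem[OF \<phi>(2)]) (use that in simp)
    then have "projr (\<phi> (Inr s)) \<in> hom V \<I> y" if "s \<in> S" for s using that by force
    then have "\<exists>!h. h \<in> hom V x0 y \<and> (\<forall>s \<in> S. h \<cdot> \<iota> s = projr (\<phi> (Inr s)))"
      by (intro copowerD(3)[OF cop _ y])
    then obtain e where e: "e \<in> hom V x0 y" "\<And>s. s \<in> S \<Longrightarrow> e \<cdot> \<iota> s = projr (\<phi> (Inr s))"
      by blast
    have "\<phi> = (\<lambda>s \<in> Inr ` S. Inr (e \<cdot> \<iota> (projr s)))"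
    proof (rule extensionalityI)
      show "\<phi> \<in> extensional (Inr ` S)" using \<phi>(2) by (simp add: PiE_def)
      fix z :: "'s + 'm" assume "z \<in> Inr ` S"
      then obtain s where s: "z = Inr s" "s \<in> S" by blast
      then show "\<phi> z = (\<lambda>s \<in> Inr ` S. Inr (e \<cdot> \<iota> (projr s))) z"
        using e(2)[OF s(2)] in_I[OF s(2)] by force
    qed simp
    then show ?thesis using e(1) \<phi>(1) by (auto simp: t_def)
  qed
  have t_nat: "fArr (hom_functor V \<I>) f \<cdot>\<^bsub>?S\<^esub> t y e = t z (f \<cdot> e)" if f: "f \<in> hom V y z" and e: "e \<in> hom V x0 y" for f y z e
  proof -
    have "compose (Inr ` S) (\<lambda>w \<in> ?I y. Inr (f \<cdot> projr w)) (\<lambda>s \<in> Inr ` S. Inr (e \<cdot> \<iota> (projr s)))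
        = ((\<lambda>s \<in> Inr ` S. Inr ((f \<cdot> e) \<cdot> \<iota> (projr s))) :: 's + 'm \<Rightarrow> 's + 'm)"
    proof (rule extensionalityI)
      fix w :: "'s + 'm" assume "w \<in> Inr ` S"
      then obtain s where s: "w = Inr s" "s \<in> S" by blast
      note \<iota>s = copowerD(2)[OF cop s(2)]
      show "compose (Inr ` S) (\<lambda>w \<in> ?I y. Inr (f \<cdot> projr w)) (\<lambda>s \<in> Inr ` S. Inr (e \<cdot> \<iota> (projr s))) w
        = (\<lambda>s \<in> Inr ` S. Inr ((f \<cdot> e) \<cdot> \<iota> (projr s))) w"
        using s comp_hom[OF \<iota>s e] comp_assoc[OF \<iota>s e f] by (simp add: compose_def)
    qed (simp_all add: compose_def)
    then show ?thesis by (simp add: t_def hom_functor_arr[OF f] set_cat_simps)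
  qed
  show "factors_through x0 A D c u"
    unfolding factors_through_def
  proof (intro conjI ballI impI)
    fix e assume e: "e \<in> hom V x0 c"
    from ft t_hom[OF e] obtain a k where a: "a \<in> Obj A" and k: "k \<in> hom ?S (Inr ` S) (?I (fObj D a))"
      and ek: "t c e = fArr (hom_functor V \<I>) (u a) \<cdot>\<^bsub>?S\<^esub> k"
      unfolding S.factors_through_def hom_functor_obj by blast
    obtain e' where e': "e' \<in> hom V x0 (fObj D a)" "k = t (fObj D a) e'" using t_surj[OF k Do[OF a]] by blast
    have "t c e = t c (u a \<cdot> e')" using ek t_nat[OF u[OF a] e'(1)] e'(2) by simp
    from t_inj[OF e comp_hom[OF e'(1) u[OF a]] this] e'(1) a
    show "\<exists>a \<in> Obj A. \<exists>e' \<in> hom V x0 (fObj D a). e = u a \<cdot> e'" by blast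
  next
    fix a e e' assume a: "a \<in> Obj A" and e: "e \<in> hom V x0 (fObj D a)" "e' \<in> hom V x0 (fObj D a)" and eq: "u a \<cdot> e = u a \<cdot> e'"
    have "fArr (hom_functor V \<I>) (u a) \<cdot>\<^bsub>?S\<^esub> t (fObj D a) e = fArr (hom_functor V \<I>) (u a) \<cdot>\<^bsub>?S\<^esub> t (fObj D a) e'"
      unfolding t_nat[OF u[OF a] e(1)] t_nat[OF u[OF a] e(2)] eq by (rule refl)
    then obtain b f where b: "b \<in> Obj A" and f: "f \<in> hom A a b"
      and fe: "fArr ?H f \<cdot>\<^bsub>?S\<^esub> t (fObj D a) e = fArr ?H f \<cdot>\<^bsub>?S\<^esub> t (fObj D a) e'"
      using ft a t_hom[OF e(1)] t_hom[OF e(2)] unfolding S.factors_through_def hom_functor_obj by blast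
    have "t (fObj D b) (fArr D f \<cdot> e) = t (fObj D b) (fArr D f \<cdot> e')"
      using fe unfolding func_comp_arr t_nat[OF functor_hom[OF D f] e(1)] t_nat[OF functor_hom[OF D f] e(2)] .
    from t_inj[OF comp_hom[OF e(1) functor_hom[OF D f]] comp_hom[OF e(2) functor_hom[OF D f]] this] b f
    show "\<exists>b \<in> Obj A. \<exists>f \<in> hom A a b. fArr D f \<cdot> e = fArr D f \<cdot> e'" by blast
  qed
qed

text \<open>Discreteness quantifies over copowers that lie in \<open>P\<close>. The assumption on
  the hom functor of the unit makes the copower on \<open>V(I,x)\<close> presentable, so a
  representative exists and the condition at \<open>x\<close> is not vacuous.\<close>

lemma discrete_representative:
  fixes \<kappa> :: "'s rel"
  assumes \<kappa>: "small_regular_cardinal \<kappa>" and lp: "locally_presentable_smc \<kappa> V"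
    and pres: "unit_hom_preserves_presentable \<kappa> V" and P: "presentable_representatives \<kappa> V P"
    and x: "x \<in> P"
  obtains x0 \<iota> where "x0 \<in> P" "is_unit_copower V (hom V \<I> x) x0 \<iota>"
proof -
  have px: "presentable \<kappa> V x" using P x by (simp add: presentable_representatives_def)
  then have "x \<in> Obj V" by (simp add: presentable_def)
  then have "small TYPE('s) (hom V \<I> x)"
    using lp by (simp add: locally_presentable_smc_def locally_presentable_def locally_small_def)
  then obtain y \<iota> where y: "is_unit_copower V (hom V \<I> x) y \<iota>"
    using copower_exists[of \<kappa>] lp unfolding locally_presentable_smc_def by metis
  have "presentable \<kappa> (sets :: (('s + 'm) set, _) cat) (Inr ` hom V \<I> x)"
    using pres px by (simp add: unit_hom_preserves_presentable_def hom_functor_obj)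
  then have "presentable \<kappa> V y"
    by (rule copower_presentable[OF \<kappa> lp _ y])
  then obtain x0 j where "x0 \<in> P" "j \<in> hom V x0 y" "is_iso V j"
    using P unfolding presentable_representatives_def by blast
  then show thesis using copower_iso[OF y] that by blast
qed

end

section \<open>Algebra structures presented by actions\<close>

context pretheory
begin

text \<open>Naturality of internal composition in the target object, checked after evaluation; it
  carries the compatibility of actions with \<open>J\<close> along maps of carriers.\<close>

lemma icomp_post:
  assumes [simp]: "x \<in> Obj V" "z \<in> Obj V" and f: "f \<in> hom V a b"
  shows "icomp x z b \<cdot> (post z f \<odot> \<ee> (ihom x z)) = post x f \<cdot> icomp x z a"
proof -
  have [simp]: "f \<in> Arr V" "Dom V f = a" "Cod V f = b" "a \<in> Obj V" "b \<in> Obj V"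
    using f hom_objs[OF f] by (auto simp: hom_iff)
  show ?thesis
  proof (rule ihom_eqI[of x b])
    have "ev x b \<cdot> ((icomp x z b \<cdot> (post z f \<odot> \<ee> (ihom x z))) \<odot> \<ee> x)
        = (ev z b \<cdot> ((post z f \<cdot> \<ee> (ihom z a)) \<odot> \<ee> z)) \<cdot> (\<ee> (ihom z a) \<odot> ev x z) \<cdot> \<alpha> (ihom z a) (ihom x z) x"
      by (simp add: ev_icomp_ten)
    also have "\<dots> = f \<cdot> (ev z a \<cdot> (\<ee> (ihom z a) \<odot> ev x z) \<cdot> \<alpha> (ihom z a) (ihom x z) x)"
      by (subst ev_post) simp_all
    also have "\<dots> = ev x b \<cdot> ((post x f \<cdot> icomp x z a) \<odot> \<ee> x)"
      using ev_icomp[of x z a "\<ee> (ihom z a \<otimes> ihom x z)" "\<ee> x"] by (simp add: ev_post)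
    finally show "ev x b \<cdot> ((icomp x z b \<cdot> (post z f \<odot> \<ee> (ihom x z))) \<odot> \<ee> x) = ev x b \<cdot> ((post x f \<cdot> icomp x z a) \<odot> \<ee> x)" .
  qed simp_all
qed

lemma alg_J:
  assumes A: "(a, S) \<in> algs" and [simp]: "x \<in> P" "z \<in> P"
  shows "vH S z x \<cdot> vH J x z = curry_arr V (ihom x z) (ihom z a) (ihom x a) (icomp x z a \<cdot> \<ss> (ihom x z) (ihom z a))"
proof -
  have "vrep V P a = vfun_comp V (vop V (vfull (vself V) P)) S (vfun_op J)"
    using A by (simp add: algs_def)
  then have "vH (vrep V P a) z x = vH (vfun_comp V (vop V (vfull (vself V) P)) S (vfun_op J)) z x"
    by simp
  then show ?thesis
    by (simp add: vrep_def vfun_comp_def vfun_op_def)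
qed

text \<open>Arrows in the image of \<open>J\<close> act by precomposition, because the functor of an
  algebra restricts along \<open>J\<close> to a representable one.\<close>

lemma act_J:
  assumes "A \<in> algs" and [simp]: "x \<in> P" "z \<in> P"
  shows "act A z x \<cdot> (vH J x z \<odot> \<ee> (ihom z (fst A))) = icomp x z (fst A) \<cdot> \<ss> (ihom x z) (ihom z (fst A))"
proof -
  obtain a S where A: "A = (a, S)" by (cases A)
  note [simp] = alg_vH[OF assms(1)[unfolded A]]
  have [simp]: "a \<in> Obj V" using alg_obj[OF assms(1)] A by simp
  show ?thesis by (simp add: A act_def alg_J[OF assms(1)[unfolded A]])
qed

text \<open>Functoriality of the algebra in uncurried form; the symmetry stems from composition in
  the opposite category.\<close>

lemma act_comp:
  assumes "A \<in> algs" and [simp]: "x \<in> P" "y \<in> P" "z \<in> P"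
  shows "act A x z \<cdot> ((vComp T z y x \<cdot> \<ss> (vHom T z y) (vHom T y x)) \<odot> \<ee> (ihom x (fst A)))
    = act A y z \<cdot> (\<ee> (vHom T z y) \<odot> act A x y) \<cdot> \<alpha> (vHom T z y) (vHom T y x) (ihom x (fst A))"
proof -
  obtain a S where A: "A = (a, S)" by (cases A)
  note alg = assms(1)[unfolded A]
  note [simp] = alg_vH[OF alg] alg_vO[OF alg]
  have [simp]: "a \<in> Obj V" using alg_obj[OF alg] by simp
  have S: "is_vfunctor V (vop V T) (vself V) S" using alg by (simp add: algs_def)
  have "vH S x z \<cdot> (vComp T z y x \<cdot> \<ss> (vHom T z y) (vHom T y x))
      = icomp (ihom x a) (ihom y a) (ihom z a) \<cdot> (vH S y z \<odot> vH S x y)"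
    using vfunctor_comp[OF S, of x y z] by (simp add: vop_def)
  from arg_cong[OF this, of "\<lambda>k. ev (ihom x a) (ihom z a) \<cdot> (k \<odot> \<ee> (ihom x a))"] show ?thesis
    by (simp add: A act_def ev_icomp_ten)
qed

text \<open>The laws of \<open>act_J\<close> and \<open>act_comp\<close> suffice to build an
  algebra: identities of \<open>T\<close> are images of identities under \<open>J\<close>, so their
  preservation follows from the first law.\<close>

lemma algI:
  assumes c [simp]: "c \<in> Obj V"
    and k: "\<And>x z. x \<in> P \<Longrightarrow> z \<in> P \<Longrightarrow> k z x \<in> hom V (vHom T x z \<otimes> ihom z c) (ihom x c)"
    and kJ: "\<And>x z. x \<in> P \<Longrightarrow> z \<in> P \<Longrightarrow>
      k z x \<cdot> (vH J x z \<odot> \<ee> (ihom z c)) = icomp x z c \<cdot> \<ss> (ihom x z) (ihom z c)"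
    and kc: "\<And>x y z. x \<in> P \<Longrightarrow> y \<in> P \<Longrightarrow> z \<in> P \<Longrightarrow>
      k x z \<cdot> ((vComp T z y x \<cdot> \<ss> (vHom T z y) (vHom T y x)) \<odot> \<ee> (ihom x c))
      = k y z \<cdot> (\<ee> (vHom T z y) \<odot> k x y) \<cdot> \<alpha> (vHom T z y) (vHom T y x) (ihom x c)"
  obtains S where "(c, S) \<in> algs" "\<And>x z. x \<in> P \<Longrightarrow> z \<in> P \<Longrightarrow> act (c, S) z x = k z x"
proof -
  have k' [simp]: "k z x \<in> Arr V" "Dom V (k z x) = vHom T x z \<otimes> ihom z c" "Cod V (k z x) = ihom x c"
    if "x \<in> P" "z \<in> P" for x z
    using k[OF that] by (auto simp: hom_iff)
  define S :: "('o, 'o, 'm) vfun" where "S = \<lparr>vO = \<lambda>x \<in> P. ihom x c,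
    vH = \<lambda>z \<in> P. \<lambda>x \<in> P. curry_arr V (vHom T x z) (ihom z c) (ihom x c) (k z x)\<rparr>"
  have SO [simp]: "vO S x = ihom x c" if "x \<in> P" for x using that by (simp add: S_def)
  have SH [simp]: "vH S z x = curry_arr V (vHom T x z) (ihom z c) (ihom x c) (k z x)" if "x \<in> P" "z \<in> P" for x z
    using that by (simp add: S_def)
  have SJ: "vH S z x \<cdot> vH J x z = curry_arr V (ihom x z) (ihom z c) (ihom x c) (icomp x z c \<cdot> \<ss> (ihom x z) (ihom z c))"
    if "x \<in> P" "z \<in> P" for x z
    using that by (simp add: curry_comp kJ)
  have "is_vfunctor V (vop V T) (vself V) S"
    unfolding is_vfunctor_def vop_simps vself_simps
  proof (intro conjI ballI)
    fix x assume x [simp]: "x \<in> P"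
    have vJ: "vId (vop V T) x = vH J x x \<cdot> vId (vself V) x"
      using vfunctor_id[OF J_vfunctor, of x] by (simp add: vfull_def vop_def)
    have vi: "vId (vself V) x \<in> Arr V" "Dom V (vId (vself V) x) = \<I>" "Cod V (vId (vself V) x) = ihom x x"
      by simp_all
    have "vH S x x \<cdot> vId (vop V T) x = (vH S x x \<cdot> vH J x x) \<cdot> vId (vself V) x"
      unfolding vJ using vi by (simp del: vself_simps(3))
    also have "\<dots> = curry_arr V \<I> (ihom x c) (ihom x c)
        (icomp x x c \<cdot> (\<ss> (ihom x x) (ihom x c) \<cdot> (vId (vself V) x \<odot> \<ee> (ihom x c))))"
      unfolding SJ[OF x x] using vi by (simp add: curry_comp del: vself_simps)
    also have "\<ss> (ihom x x) (ihom x c) \<cdot> (vId (vself V) x \<odot> \<ee> (ihom x c))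
        = (\<ee> (ihom x c) \<odot> vId (vself V) x) \<cdot> \<ss> \<I> (ihom x c)"
      using vi by (simp add: nat_symm del: vself_simps)
    also have "icomp x x c \<cdot> \<dots> = \<rr> (ihom x c) \<cdot> \<ss> \<I> (ihom x c)"
      by (rule reassoc) (use vi vcat_unit(1)[OF vself_vcat, of x c] in \<open>simp_all del: vself_simps(3)\<close>)
    finally show "vH S x x \<cdot> vId (vop V T) x = curry_arr V \<I> (vO S x) (vO S x) (\<ll> (vO S x))"
      by (simp add: runit_symm)
  next
    fix x y z assume [simp]: "x \<in> P" "y \<in> P" "z \<in> P"
    let ?v = "vComp T z y x \<cdot> \<ss> (vHom T z y) (vHom T y x)"
    have "vH S x z \<cdot> ?v = icomp (ihom x c) (ihom y c) (ihom z c) \<cdot> (vH S y z \<odot> vH S x y)"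
    proof (rule ihom_eqI[of "ihom x c" "ihom z c"])
      show "ev (ihom x c) (ihom z c) \<cdot> ((vH S x z \<cdot> ?v) \<odot> \<ee> (ihom x c))
          = ev (ihom x c) (ihom z c) \<cdot> ((icomp (ihom x c) (ihom y c) (ihom z c) \<cdot> (vH S y z \<odot> vH S x y)) \<odot> \<ee> (ihom x c))"
        by (simp add: ev_icomp_ten kc)
    qed simp_all
    then show "vH S x z \<cdot> vComp (vop V T) x y z = icomp (vO S x) (vO S y) (vO S z) \<cdot> (vH S y z \<odot> vH S x y)"
      by (simp add: vop_def)
  qed (auto simp: hom_iff)
  moreover have "vfun_ext (vop V T) S"
    by (simp add: vfun_ext_def S_def)
  moreover have "vrep V P c = vfun_comp V (vop V (vfull (vself V) P)) S (vfun_op J)"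
  proof -
    have O: "vO (vrep V P c) = (\<lambda>x \<in> P. vO S (vO J x))"
      by (rule extensionalityI[of _ P]) (simp_all add: vrep_def)
    have H: "vH (vrep V P c) = (\<lambda>z \<in> P. \<lambda>x \<in> P. vH S (vO J z) (vO J x) \<cdot> vH J x z)"
    proof (rule extensionalityI[of _ P])
      fix z assume z: "z \<in> P"
      show "vH (vrep V P c) z = (\<lambda>z \<in> P. \<lambda>x \<in> P. vH S (vO J z) (vO J x) \<cdot> vH J x z) z"
        by (rule extensionalityI[of _ P]) (use z in \<open>simp_all add: vrep_def SJ del: SH\<close>)
    qed (simp_all add: vrep_def)
    show ?thesis
      unfolding vfun_comp_def vfun_op_def vop_simps
      by (rule vfun.equality) (simp_all only: O H vfun.simps, simp)
  qed
  ultimately have "(c, S) \<in> algs" by (simp add: algs_def)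
  moreover have "act (c, S) z x = k z x" if "x \<in> P" "z \<in> P" for x z
    using that by (simp add: act_def)
  ultimately show thesis by (rule that)
qed

end

section \<open>Preservation of filtered colimits and surjections\<close>

context free_algebra_monad
begin

text \<open>Every global element of \<open>M\<close> of a filtered colimit already lives at a stage: the colimit of the
  free algebras on the diagram is an algebra, so the free algebra on the colimit maps to it.\<close>

lemma element_factors:
  fixes \<kappa> :: "'s rel" and A :: "('s, 's) cat"
  assumes \<kappa>: "small_regular_cardinal \<kappa>" and lp: "locally_presentable_smc \<kappa> V"
    and P: "\<And>x. x \<in> P \<Longrightarrow> presentable \<kappa> V x"
    and A: "small_category A" "filtered \<kappa> A" and D: "is_functor A V D" and colim: "is_colimit V A D y u"
    and e: "e \<in> hom V \<I> (Mo y)"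
  obtains a e' where "a \<in> Obj A" "e' \<in> hom V \<I> (Mo (fObj D a))" "e = Ma (u a) \<cdot> e'"
proof -
  have A1: "category A" using A by (simp add: small_category_def)
  have y [simp]: "y \<in> Obj V" using colim by (simp add: is_colimit_def cocone_def)
  have Do [simp]: "fObj D a \<in> Obj V" if "a \<in> Obj A" for a using D that by (simp add: is_functor_def)
  note u = cocone_leg[OF colimit_cocone[OF colim]]
  define H where "H = \<lparr>fObj = \<lambda>a. Mo (fObj D a), fArr = \<lambda>f. Ma (fArr D f)\<rparr>"
  have H_simps [simp]: "fObj H a = Mo (fObj D a)" "fArr H f = Ma (fArr D f)" for a f
    by (simp_all add: H_def)
  have H: "is_functor A V H"
    unfolding is_functor_def H_simps
  proof (intro conjI ballI allI)
    fix a assume a: "a \<in> Obj A"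
    have "fArr D (Id A a) = \<ee> (fObj D a)" using D a by (auto simp: is_functor_def)
    then show "Mo (fObj D a) \<in> Obj V" "Ma (fArr D (Id A a)) = \<ee> (Mo (fObj D a))" using a by (simp_all add: Ma_id)
  next
    fix f assume "f \<in> Arr A"
    then have "fArr D f \<in> hom V (fObj D (Dom A f)) (fObj D (Cod A f))" using D by (simp add: is_functor_def)
    then show "Ma (fArr D f) \<in> hom V (Mo (fObj D (Dom A f))) (Mo (fObj D (Cod A f)))" by (rule Ma_hom)
  next
    fix a b c f g assume f: "f \<in> hom A a b" and g: "g \<in> hom A b c"
    show "Ma (fArr D (g \<cdot>\<^bsub>A\<^esub> f)) = Ma (fArr D g) \<cdot> Ma (fArr D f)"
      using functor_comp[OF D f g] Ma_comp[OF functor_hom[OF D f] functor_hom[OF D g]] by simp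
  qed
  \<comment> \<open>The colimit of the carriers is taken in \<open>V\<close>; what follows equips it
    with an action that is compatible with the legs.\<close>
  obtain c v where cv: "is_colimit V A H c v"
    using lp A H unfolding locally_presentable_smc_def locally_presentable_def cocomplete_def by blast
  have c [simp]: "c \<in> Obj V" using cv by (simp add: is_colimit_def cocone_def)
  have v: "v a \<in> hom V (Mo (fObj D a)) c" if "a \<in> Obj A" for a
    using cocone_leg[OF colimit_cocone[OF cv] that] by simp
  have v' [simp]: "v a \<in> Arr V" "Dom V (v a) = Mo (fObj D a)" "Cod V (v a) = c" if "a \<in> Obj A" for a
    using v[OF that] by (auto simp: hom_iff)
  let ?F = "\<lambda>a. free (fObj D a)"
  have fr: "?F a \<in> algs" "fst (?F a) = Mo (fObj D a)" if "a \<in> Obj A" for a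
    using that by (simp_all add: free_alg fst_free)
  have act_s [simp]: "act (?F a) z x \<in> Arr V" "Dom V (act (?F a) z x) = vHom T x z \<otimes> ihom z (Mo (fObj D a))"
    "Cod V (act (?F a) z x) = ihom x (Mo (fObj D a))" if "x \<in> P" "z \<in> P" "a \<in> Obj A" for x z a
    using act_simps[OF fr(1)[OF that(3)] that(1,2)] fr(2)[OF that(3)] by simp_all
  have pc: "is_colimit V A (post_functor z H) (ihom z c) (\<lambda>a. post z (v a))" if "z \<in> P" for z
    by (rule ihom_colimit[OF \<kappa> lp P[OF that] A H cv])
  have pf: "is_functor A V (post_functor z H)" if "z \<in> P" for z
    by (rule post_functor_functor[OF H]) (use that in simp)
  have pf_simps [simp]: "fObj (post_functor z H) a = ihom z (Mo (fObj D a))" "fArr (post_functor z H) f = post z (Ma (fArr D f))" for z a f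
    by (simp_all add: post_functor_def)
  \<comment> \<open>Both \<open>[z,-]\<close> with \<open>z\<close> in \<open>P\<close> and
    tensoring with \<open>w\<close> preserve the colimit, so arrows out of
    \<open>w \<otimes> [z,c]\<close> are determined by their restrictions to the stages. The algebra
    laws on \<open>c\<close> and the homomorphism law for \<open>q\<close> are verified in this
    way.\<close>
  have joint_epi: "h = h'" if z: "z \<in> P" and w: "w \<in> Obj V" and h: "h \<in> hom V (w \<otimes> ihom z c) d" "h' \<in> hom V (w \<otimes> ihom z c) d"
    and eq: "\<And>a. a \<in> Obj A \<Longrightarrow> h \<cdot> (\<ee> w \<odot> post z (v a)) = h' \<cdot> (\<ee> w \<odot> post z (v a))" for h h' w z d
  proof -
    have "\<exists>!k. k \<in> hom V (w \<otimes> ihom z c) d \<and> (\<forall>a \<in> Obj A. k \<cdot> (\<ee> w \<odot> post z (v a)) = h \<cdot> (\<ee> w \<odot> post z (v a)))"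
    proof (rule tensor_colimit[OF pc[OF z] pf[OF z] A1 w])
      show "d \<in> Obj V" using hom_objs[OF h(1)] by simp
      show "h \<cdot> (\<ee> w \<odot> post z (v a)) \<in> hom V (w \<otimes> fObj (post_functor z H) a) d" if "a \<in> Obj A" for a
        using h that z w by (simp add: hom_iff)
      fix a b f assume f: "f \<in> hom A a b"
      have ab: "a \<in> Obj A" "b \<in> Obj A" using category.hom_objs[OF A1 f] by auto
      have "post z (v b) \<cdot> post z (Ma (fArr D f)) = post z (v a)"
        using cocone_naturality[OF colimit_cocone[OF pc[OF z]] f] by simp
      then show "(h \<cdot> (\<ee> w \<odot> post z (v b))) \<cdot> (\<ee> w \<odot> fArr (post_functor z H) f) = h \<cdot> (\<ee> w \<odot> post z (v a))"
        using h ab z w functor_hom[OF H f] by (simp add: hom_iff)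
    qed
    then show ?thesis using h eq by metis
  qed
  \<comment> \<open>Transition maps of the diagram are homomorphisms of free algebras, so the
    actions at the stages are compatible and induce an action on \<open>c\<close>.\<close>
  have k_ex: "\<exists>k. k \<in> hom V (vHom T x z \<otimes> ihom z c) (ihom x c) \<and>
      (\<forall>a \<in> Obj A. k \<cdot> (\<ee> (vHom T x z) \<odot> post z (v a)) = post x (v a) \<cdot> act (?F a) z x)"
    if x: "x \<in> P" and z: "z \<in> P" for x z
  proof -
    have "\<exists>!k. k \<in> hom V (vHom T x z \<otimes> ihom z c) (ihom x c) \<and>
      (\<forall>a \<in> Obj A. k \<cdot> (\<ee> (vHom T x z) \<odot> post z (v a)) = post x (v a) \<cdot> act (?F a) z x)"
    proof (rule tensor_colimit[OF pc[OF z] pf[OF z] A1])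
      show "vHom T x z \<in> Obj V" "ihom x c \<in> Obj V" using x z by simp_all
      show "post x (v a) \<cdot> act (?F a) z x \<in> hom V (vHom T x z \<otimes> fObj (post_functor z H) a) (ihom x c)" if "a \<in> Obj A" for a
        using x z that by (simp add: hom_iff)
      fix a b f assume f: "f \<in> hom A a b"
      have ab [simp]: "a \<in> Obj A" "b \<in> Obj A" using category.hom_objs[OF A1 f] by auto
      note Df = functor_hom[OF D f]
      have MD: "Ma (fArr D f) \<in> Arr V" "Dom V (Ma (fArr D f)) = Mo (fObj D a)" "Cod V (Ma (fArr D f)) = Mo (fObj D b)"
        using Ma_hom[OF Df] by (auto simp: hom_iff)
      have "act (?F b) z x \<cdot> (\<ee> (vHom T x z) \<odot> post z (Ma (fArr D f))) = post x (Ma (fArr D f)) \<cdot> act (?F a) z x"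
        using monad_arr_ahom[OF Df] x z by (simp add: ahom_def)
      then have "(post x (v b) \<cdot> act (?F b) z x) \<cdot> (\<ee> (vHom T x z) \<odot> post z (Ma (fArr D f)))
          = post x (v b) \<cdot> (post x (Ma (fArr D f)) \<cdot> act (?F a) z x)"
        using x z MD by simp
      also have "\<dots> = post x (v a) \<cdot> act (?F a) z x"
        by (rule reassoc) (use x z MD cocone_naturality[OF colimit_cocone[OF pc[OF x]] f] in simp_all)
      finally show "(post x (v b) \<cdot> act (?F b) z x) \<cdot> (\<ee> (vHom T x z) \<odot> fArr (post_functor z H) f) = post x (v a) \<cdot> act (?F a) z x"
        by simp
    qed
    then show ?thesis by blast
  qed
  define k where "k z x = (SOME k. k \<in> hom V (vHom T x z \<otimes> ihom z c) (ihom x c) \<and>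
      (\<forall>a \<in> Obj A. k \<cdot> (\<ee> (vHom T x z) \<odot> post z (v a)) = post x (v a) \<cdot> act (?F a) z x))" for z x
  have k: "k z x \<in> hom V (vHom T x z \<otimes> ihom z c) (ihom x c)"
    and kv: "a \<in> Obj A \<Longrightarrow> k z x \<cdot> (\<ee> (vHom T x z) \<odot> post z (v a)) = post x (v a) \<cdot> act (?F a) z x"
    if "x \<in> P" "z \<in> P" for x z a
    using someI_ex[OF k_ex[OF that], folded k_def] by blast+
  have k' [simp]: "k z x \<in> Arr V" "Dom V (k z x) = vHom T x z \<otimes> ihom z c" "Cod V (k z x) = ihom x c"
    if "x \<in> P" "z \<in> P" for x z
    using k[OF that] by (auto simp: hom_iff)
  have "\<exists>S. (c, S) \<in> algs \<and> (\<forall>x \<in> P. \<forall>z \<in> P. act (c, S) z x = k z x)"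
  proof (rule algI[OF c k])
    fix x z assume x [simp]: "x \<in> P" and z [simp]: "z \<in> P"
    show "k z x \<cdot> (vH J x z \<odot> \<ee> (ihom z c)) = icomp x z c \<cdot> \<ss> (ihom x z) (ihom z c)"
    proof (rule joint_epi[OF z, of "ihom x z"])
      fix a assume a [simp]: "a \<in> Obj A"
      let ?m = "Mo (fObj D a)"
      have "(k z x \<cdot> (vH J x z \<odot> \<ee> (ihom z c))) \<cdot> (\<ee> (ihom x z) \<odot> post z (v a))
          = k z x \<cdot> ((\<ee> (vHom T x z) \<odot> post z (v a)) \<cdot> (vH J x z \<odot> \<ee> (ihom z ?m)))"
        by simp
      also have "\<dots> = (post x (v a) \<cdot> act (?F a) z x) \<cdot> (vH J x z \<odot> \<ee> (ihom z ?m))"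
        by (rule reassoc[OF kv[OF x z a]]) simp_all
      also have "\<dots> = post x (v a) \<cdot> (icomp x z ?m \<cdot> \<ss> (ihom x z) (ihom z ?m))"
        using act_J[OF fr(1)[OF a] x z] fr(2)[OF a] by simp
      also have "\<dots> = (icomp x z c \<cdot> (post z (v a) \<odot> \<ee> (ihom x z))) \<cdot> \<ss> (ihom x z) (ihom z ?m)"
        by (rule reassoc[OF icomp_post[symmetric, OF _ _ v[OF a]]]) simp_all
      also have "\<dots> = (icomp x z c \<cdot> \<ss> (ihom x z) (ihom z c)) \<cdot> (\<ee> (ihom x z) \<odot> post z (v a))"
        by (simp add: nat_symm)
      finally show "(k z x \<cdot> (vH J x z \<odot> \<ee> (ihom z c))) \<cdot> (\<ee> (ihom x z) \<odot> post z (v a))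
          = (icomp x z c \<cdot> \<ss> (ihom x z) (ihom z c)) \<cdot> (\<ee> (ihom x z) \<odot> post z (v a))" .
    qed (simp_all add: hom_iff)
  next
    fix x y z assume x [simp]: "x \<in> P" and y [simp]: "y \<in> P" and z [simp]: "z \<in> P"
    let ?V = "vComp T z y x \<cdot> \<ss> (vHom T z y) (vHom T y x)"
    show "k x z \<cdot> (?V \<odot> \<ee> (ihom x c)) = k y z \<cdot> (\<ee> (vHom T z y) \<odot> k x y) \<cdot> \<alpha> (vHom T z y) (vHom T y x) (ihom x c)"
    proof (rule joint_epi[OF x, of "vHom T z y \<otimes> vHom T y x"])
      fix a assume a [simp]: "a \<in> Obj A"
      let ?m = "Mo (fObj D a)" and ?W = "vHom T z y \<otimes> vHom T y x"
      have "(k x z \<cdot> (?V \<odot> \<ee> (ihom x c))) \<cdot> (\<ee> ?W \<odot> post x (v a))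
          = k x z \<cdot> ((\<ee> (vHom T z x) \<odot> post x (v a)) \<cdot> (?V \<odot> \<ee> (ihom x ?m)))"
        by simp
      also have "\<dots> = (post z (v a) \<cdot> act (?F a) x z) \<cdot> (?V \<odot> \<ee> (ihom x ?m))"
        by (rule reassoc[OF kv[OF z x a]]) simp_all
      also have "\<dots> = post z (v a) \<cdot> (act (?F a) y z \<cdot> (\<ee> (vHom T z y) \<odot> act (?F a) x y) \<cdot> \<alpha> (vHom T z y) (vHom T y x) (ihom x ?m))"
        using act_comp[OF fr(1)[OF a] x y z] fr(2)[OF a] by simp
      also have "\<dots> = (post z (v a) \<cdot> act (?F a) y z) \<cdot> (\<ee> (vHom T z y) \<odot> act (?F a) x y) \<cdot> \<alpha> (vHom T z y) (vHom T y x) (ihom x ?m)"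
        by simp
      also have "post z (v a) \<cdot> act (?F a) y z = k y z \<cdot> (\<ee> (vHom T z y) \<odot> post y (v a))"
        by (rule kv[OF z y a, symmetric])
      also have "(k y z \<cdot> (\<ee> (vHom T z y) \<odot> post y (v a))) \<cdot> (\<ee> (vHom T z y) \<odot> act (?F a) x y) \<cdot> \<alpha> (vHom T z y) (vHom T y x) (ihom x ?m)
          = k y z \<cdot> (\<ee> (vHom T z y) \<odot> (post y (v a) \<cdot> act (?F a) x y)) \<cdot> \<alpha> (vHom T z y) (vHom T y x) (ihom x ?m)"
        by simp
      also have "post y (v a) \<cdot> act (?F a) x y = k x y \<cdot> (\<ee> (vHom T y x) \<odot> post x (v a))"
        by (rule kv[OF y x a, symmetric])
      also have "k y z \<cdot> (\<ee> (vHom T z y) \<odot> (k x y \<cdot> (\<ee> (vHom T y x) \<odot> post x (v a)))) \<cdot> \<alpha> (vHom T z y) (vHom T y x) (ihom x ?m)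
          = k y z \<cdot> (\<ee> (vHom T z y) \<odot> k x y) \<cdot> ((\<ee> (vHom T z y) \<odot> (\<ee> (vHom T y x) \<odot> post x (v a))) \<cdot> \<alpha> (vHom T z y) (vHom T y x) (ihom x ?m))"
        by simp
      also have "(\<ee> (vHom T z y) \<odot> (\<ee> (vHom T y x) \<odot> post x (v a))) \<cdot> \<alpha> (vHom T z y) (vHom T y x) (ihom x ?m)
          = \<alpha> (vHom T z y) (vHom T y x) (ihom x c) \<cdot> (\<ee> ?W \<odot> post x (v a))"
        using nat_assoc[of "\<ee> (vHom T z y)" "\<ee> (vHom T y x)" "post x (v a)"] by simp
      finally show "(k x z \<cdot> (?V \<odot> \<ee> (ihom x c))) \<cdot> (\<ee> ?W \<odot> post x (v a))
          = (k y z \<cdot> (\<ee> (vHom T z y) \<odot> k x y) \<cdot> \<alpha> (vHom T z y) (vHom T y x) (ihom x c)) \<cdot> (\<ee> ?W \<odot> post x (v a))"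
        by simp
    qed (simp_all add: hom_iff)
  next
    fix S assume "(c, S) \<in> algs" "\<And>x z. x \<in> P \<Longrightarrow> z \<in> P \<Longrightarrow> act (c, S) z x = k z x"
    then show ?thesis by blast
  qed
  then obtain S where S: "(c, S) \<in> algs" and actS: "\<And>x z. x \<in> P \<Longrightarrow> z \<in> P \<Longrightarrow> act (c, S) z x = k z x"
    by blast
  \<comment> \<open>The units followed by the legs induce a map \<open>s\<close> from
    \<open>y\<close> to \<open>c\<close>, whose extension \<open>g\<close> to the free algebra on
    \<open>y\<close> is the comparison in one direction. The map \<open>q\<close> in the other
    direction is induced by the arrows \<open>M (u a)\<close>.\<close>
  have "cocone V A D c (\<lambda>a. v a \<cdot> unit (fObj D a))"
    unfolding cocone_def
  proof (intro conjI ballI)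
    fix f assume f: "f \<in> Arr A"
    have f': "f \<in> hom A (Dom A f) (Cod A f)" using f by (simp add: hom_def)
    have o [simp]: "Dom A f \<in> Obj A" "Cod A f \<in> Obj A" using category.hom_objs[OF A1 f'] by auto
    note Df = functor_hom[OF D f']
    have Df' [simp]: "fArr D f \<in> Arr V" "Dom V (fArr D f) = fObj D (Dom A f)" "Cod V (fArr D f) = fObj D (Cod A f)"
      using Df by (auto simp: hom_iff)
    have MDf: "Ma (fArr D f) \<in> Arr V" "Dom V (Ma (fArr D f)) = Mo (fObj D (Dom A f))" "Cod V (Ma (fArr D f)) = Mo (fObj D (Cod A f))"
      using Ma_simps[of "fArr D f"] by simp_all
    have "(v (Cod A f) \<cdot> unit (fObj D (Cod A f))) \<cdot> fArr D f = v (Cod A f) \<cdot> (Ma (fArr D f) \<cdot> unit (fObj D (Dom A f)))"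
      using monad_arr_unit[OF Df] by simp
    also have "\<dots> = v (Dom A f) \<cdot> unit (fObj D (Dom A f))"
      by (rule reassoc) (use cocone_naturality[OF colimit_cocone[OF cv] f'] MDf in simp_all)
    finally show "(v (Cod A f) \<cdot> unit (fObj D (Cod A f))) \<cdot> fArr D f = v (Dom A f) \<cdot> unit (fObj D (Dom A f))" .
  qed (simp_all add: hom_iff)
  from colimit_ex1[OF colim this] obtain s where s: "s \<in> hom V y c"
    and su: "\<And>a. a \<in> Obj A \<Longrightarrow> s \<cdot> u a = v a \<cdot> unit (fObj D a)" by blast
  obtain g where g: "ahom (free y) (c, S) g" and gs: "g \<cdot> unit y = s"
    using free_ext[OF y S, of s] s by auto
  have g_hom: "g \<in> hom V (Mo y) c" using ahom_hom[OF g] by (simp add: fst_free)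
  have "cocone V A H (Mo y) (\<lambda>a. Ma (u a))"
    unfolding cocone_def H_simps
  proof (intro conjI ballI)
    show "Ma (u a) \<in> hom V (Mo (fObj D a)) (Mo y)" if "a \<in> Obj A" for a by (rule Ma_hom[OF u[OF that]])
    fix f assume f: "f \<in> Arr A"
    have f': "f \<in> hom A (Dom A f) (Cod A f)" using f by (simp add: hom_def)
    have "Cod A f \<in> Obj A" using category.hom_objs[OF A1 f'] by auto
    then show "Ma (u (Cod A f)) \<cdot> Ma (fArr D f) = Ma (u (Dom A f))"
      using Ma_comp[OF functor_hom[OF D f'] u] cocone_naturality[OF colimit_cocone[OF colim] f'] by simp
  qed simp
  from colimit_ex1[OF cv this] obtain q where q: "q \<in> hom V c (Mo y)"
    and qv: "\<And>a. a \<in> Obj A \<Longrightarrow> q \<cdot> v a = Ma (u a)" by blast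
  have q' [simp]: "q \<in> Arr V" "Dom V q = c" "Cod V q = Mo y" using q by (auto simp: hom_iff)
  have fy: "free y \<in> algs" "fst (free y) = Mo y" by (simp_all add: free_alg fst_free)
  have q_ahom: "ahom (c, S) (free y) q"
    unfolding ahom_def fy fst_conv
  proof (intro conjI ballI q)
    fix z x assume z [simp]: "z \<in> P" and x [simp]: "x \<in> P"
    have act_y [simp]: "act (free y) z x \<in> Arr V" "Dom V (act (free y) z x) = vHom T x z \<otimes> ihom z (Mo y)"
      "Cod V (act (free y) z x) = ihom x (Mo y)"
      using act_simps[OF fy(1) x z] fy(2) by simp_all
    have "post x q \<cdot> k z x = act (free y) z x \<cdot> (\<ee> (vHom T x z) \<odot> post z q)"
    proof (rule joint_epi[OF z, of "vHom T x z"])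
      fix a assume a [simp]: "a \<in> Obj A"
      have Mu: "ahom (?F a) (free y) (q \<cdot> v a)" using monad_arr_ahom[OF u[OF a]] qv[OF a] by simp
      have "(post x q \<cdot> k z x) \<cdot> (\<ee> (vHom T x z) \<odot> post z (v a)) = post x q \<cdot> (post x (v a) \<cdot> act (?F a) z x)"
        by (simp add: kv)
      also have "\<dots> = post x (q \<cdot> v a) \<cdot> act (?F a) z x"
        by (rule reassoc) (simp_all add: post_comp)
      also have "\<dots> = act (free y) z x \<cdot> (\<ee> (vHom T x z) \<odot> post z (q \<cdot> v a))"
        using Mu by (simp add: ahom_def)
      also have "\<dots> = (act (free y) z x \<cdot> (\<ee> (vHom T x z) \<odot> post z q)) \<cdot> (\<ee> (vHom T x z) \<odot> post z (v a))"
        by (simp add: post_comp)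
      finally show "(post x q \<cdot> k z x) \<cdot> (\<ee> (vHom T x z) \<odot> post z (v a))
          = (act (free y) z x \<cdot> (\<ee> (vHom T x z) \<odot> post z q)) \<cdot> (\<ee> (vHom T x z) \<odot> post z (v a))" .
    qed (simp_all add: hom_iff)
    then show "post x q \<cdot> act (c, S) z x = act (free y) z x \<cdot> (\<ee> (vHom T x z) \<odot> post z q)"
      by (simp add: actS)
  qed
  \<comment> \<open>By uniqueness of extensions this makes \<open>q\<close> a retraction of
    \<open>g\<close>. Presentability of the unit then factors \<open>g \<cdot> e\<close> through a
    leg, and \<open>q\<close> brings the factorization back to \<open>M y\<close>.\<close>
  have "q \<cdot> s = unit y"
  proof (rule colimit_eqI[OF colim D A1 comp_hom[OF s q] unit_hom[OF y]])
    fix a assume a: "a \<in> Obj A"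
    have "(q \<cdot> s) \<cdot> u a = q \<cdot> (v a \<cdot> unit (fObj D a))" using comp_assoc[OF u[OF a] s q] su[OF a] by simp
    also have "\<dots> = Ma (u a) \<cdot> unit (fObj D a)" by (rule reassoc[OF qv[OF a]]) (use a in simp_all)
    finally show "(q \<cdot> s) \<cdot> u a = unit y \<cdot> u a" using monad_arr_unit[OF u[OF a]] by simp
  qed
  then have "(q \<cdot> g) \<cdot> unit y = \<ee> (Mo y) \<cdot> unit y"
    using comp_assoc[OF unit_hom[OF y] g_hom q] gs by simp
  then have "q \<cdot> g = \<ee> (Mo y)"
    by (rule free_unique[OF y fy(1) ahom_comp[OF g q_ahom fy(1) S fy(1)] ahom_id[OF fy(1), unfolded fy(2)]])
  then have e_eq: "e = q \<cdot> (g \<cdot> e)"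
    using comp_assoc[OF e g_hom q] id_comp[OF e] by simp
  have "presentable \<kappa> V \<I>" using lp by (simp add: locally_presentable_smc_def)
  from presentable_factors[OF \<kappa> this H A cv] comp_hom[OF e g_hom]
  obtain a e' where a: "a \<in> Obj A" and e': "e' \<in> hom V \<I> (Mo (fObj D a))" and ge: "g \<cdot> e = v a \<cdot> e'"
    unfolding factors_through_def H_simps by blast
  have "q \<cdot> (v a \<cdot> e') = Ma (u a) \<cdot> e'"
    using comp_assoc[OF e' v[OF a] q] qv[OF a] by simp
  then have "e = Ma (u a) \<cdot> e'"
    by (subst e_eq) (simp only: ge)
  then show thesis using that a e' by blast
qed

end

section \<open>Surjections and copowers of the unit\<close>

context symmetric_monoidal_closed
begin

lemma surjection_iff:
  assumes f: "f \<in> hom V a b"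
  shows "surjection V f \<longleftrightarrow> (\<forall>e \<in> hom V \<I> b. \<exists>e' \<in> hom V \<I> a. e = f \<cdot> e')"
proof -
  have f': "f \<in> Arr V" "Dom V f = a" "Cod V f = b" using f by (auto simp: hom_iff)
  show ?thesis
    unfolding surjection_def f' using f'(1) comp_hom[OF _ f] by blast
qed

text \<open>An element \<open>s\<close> of \<open>x\<close> is the image of the injection indexed by
  \<open>s\<close>.\<close>

lemma discrete_counit_surjection:
  assumes cop: "is_unit_copower V (hom V \<I> x) x0 \<iota>" and x: "x \<in> Obj V"
  shows "surjection V (discrete_counit V x x0 \<iota>)"
  unfolding surjection_iff[OF discrete_counit(1)[OF cop x]]
  using discrete_counit(2)[OF cop x] copowerD(2)[OF cop] by metis

text \<open>Copowers of the unit are projective with respect to surjections: choose a preimage for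
  each injection and assemble these by the universal property.\<close>

lemma copower_lift:
  assumes cop: "is_unit_copower V S x0 \<iota>" and f: "f \<in> hom V a b" "surjection V f" and g: "g \<in> hom V x0 b"
  obtains k where "k \<in> hom V x0 a" "f \<cdot> k = g"
proof -
  have "\<exists>l. \<forall>s \<in> S. l s \<in> hom V \<I> a \<and> g \<cdot> \<iota> s = f \<cdot> l s"
    using f(2)[unfolded surjection_iff[OF f(1)]] comp_hom[OF copowerD(2)[OF cop] g] by (intro bchoice) blast
  then obtain l where l: "\<And>s. s \<in> S \<Longrightarrow> l s \<in> hom V \<I> a" "\<And>s. s \<in> S \<Longrightarrow> g \<cdot> \<iota> s = f \<cdot> l s" by blast
  have "\<exists>!k. k \<in> hom V x0 a \<and> (\<forall>s \<in> S. k \<cdot> \<iota> s = l s)"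
    by (rule copowerD(3)[OF cop l(1)]) (use hom_objs[OF f(1)] in auto)
  then obtain k where k: "k \<in> hom V x0 a" "\<And>s. s \<in> S \<Longrightarrow> k \<cdot> \<iota> s = l s" by blast
  have "f \<cdot> k = g"
  proof (rule copower_eqI[OF cop comp_hom[OF k(1) f(1)] g])
    fix s assume s: "s \<in> S"
    show "(f \<cdot> k) \<cdot> \<iota> s = g \<cdot> \<iota> s"
      using comp_assoc[OF copowerD(2)[OF cop s] k(1) f(1)] k(2)[OF s] l(2)[OF s] by simp
  qed
  with k(1) show thesis by (rule that)
qed

end

context free_algebra_monad
begin

lemma preserves_surjections_iff:
  fixes \<kappa> :: "'s rel"
  assumes \<kappa>: "small_regular_cardinal \<kappa>" and lp: "locally_presentable_smc \<kappa> V"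
    and pres: "unit_hom_preserves_presentable \<kappa> V" and P: "presentable_representatives \<kappa> V P"
  shows "preserves_surjections V M \<longleftrightarrow>
    (\<forall>x \<in> P. \<forall>x0 \<in> P. \<forall>\<iota>. is_unit_copower V (hom V \<I> x) x0 \<iota> \<longrightarrow> surjection V (Ma (discrete_counit V x x0 \<iota>)))"
    (is "?l \<longleftrightarrow> ?r")
proof
  assume ?l
  then show ?r
    using discrete_counit_surjection P_obj unfolding preserves_surjections_def by blast
next
  assume r: ?r
  have PP: "\<And>x. x \<in> P \<Longrightarrow> presentable \<kappa> V x" using P by (simp add: presentable_representatives_def)
  show ?l
    unfolding preserves_surjections_def
  proof (intro allI impI)
    fix f assume sf: "surjection V f"
    obtain a y where f: "f \<in> hom V a y" using sf by (auto simp: surjection_def hom_iff)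
    have y: "y \<in> Obj V" using hom_objs[OF f] by simp
    obtain G and A :: "('s, 's) cat" and D u where G: "\<forall>g \<in> G. presentable \<kappa> V g"
      and A: "small_category A" "filtered \<kappa> A" and D: "is_functor A V D"
      and DG: "\<forall>i \<in> Obj A. fObj D i \<in> G" and colim: "is_colimit V A D y u"
      using lp y unfolding locally_presentable_smc_def locally_presentable_def by metis
    show "surjection V (Ma f)"
      unfolding surjection_iff[OF Ma_hom[OF f]]
    proof
      fix e assume "e \<in> hom V \<I> (Mo y)"
      then obtain i e1 where i: "i \<in> Obj A" and e1: "e1 \<in> hom V \<I> (Mo (fObj D i))" and e: "e = Ma (u i) \<cdot> e1"
        using element_factors[OF \<kappa> lp PP A D colim] by metis
      note u = cocone_leg[OF colimit_cocone[OF colim] i]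
      \<comment> \<open>The stage is presentable but need not itself belong to \<open>P\<close>; the
        isomorphism \<open>j\<close> moves the element to a representative and back.\<close>
      obtain x j where x: "x \<in> P" and j: "j \<in> hom V x (fObj D i)" "is_iso V j"
        using P G DG i unfolding presentable_representatives_def by blast
      have j': "inva j \<in> hom V (fObj D i) x" using j by (auto simp: hom_iff)
      obtain x0 \<iota> where x0: "x0 \<in> P" and cop: "is_unit_copower V (hom V \<I> x) x0 \<iota>"
        by (rule discrete_representative[OF \<kappa> lp pres P x])
      let ?d = "discrete_counit V x x0 \<iota>"
      have d: "?d \<in> hom V x0 x" by (rule discrete_counit(1)[OF cop P_obj[OF x]])
      have "surjection V (Ma ?d)" using r x x0 cop by blast
      then obtain e2 where e2: "e2 \<in> hom V \<I> (Mo x0)" and e12: "Ma (inva j) \<cdot> e1 = Ma ?d \<cdot> e2"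
        using comp_hom[OF e1 Ma_hom[OF j']] unfolding surjection_iff[OF Ma_hom[OF d]] by blast
      have "Ma j \<cdot> (Ma (inva j) \<cdot> e1) = (Ma j \<cdot> Ma (inva j)) \<cdot> e1"
        by (rule comp_assoc[OF e1 Ma_hom[OF j'] Ma_hom[OF j(1)], symmetric])
      also have "Ma j \<cdot> Ma (inva j) = \<ee> (Mo (fObj D i))"
        using Ma_comp[OF j' j(1)] j hom_objs[OF j(1)] by (simp add: Ma_id hom_iff)
      finally have "e1 = Ma j \<cdot> (Ma ?d \<cdot> e2)"
        using e12 id_comp[OF e1] by simp
      then have "e = Ma (u i) \<cdot> (Ma j \<cdot> (Ma ?d \<cdot> e2))"
        using e by simp
      also have "\<dots> = Ma (u i \<cdot> (j \<cdot> ?d)) \<cdot> e2"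
        using Ma_comp[OF d j(1)] Ma_comp[OF comp_hom[OF d j(1)] u]
          comp_assoc[OF e2 Ma_hom[OF d] Ma_hom[OF j(1)]]
          comp_assoc[OF e2 Ma_hom[OF comp_hom[OF d j(1)]] Ma_hom[OF u]] by simp
      also obtain k where k: "k \<in> hom V x0 a" and fk: "f \<cdot> k = u i \<cdot> (j \<cdot> ?d)"
        by (rule copower_lift[OF cop f sf comp_hom[OF comp_hom[OF d j(1)] u]])
      have "Ma (u i \<cdot> (j \<cdot> ?d)) \<cdot> e2 = Ma f \<cdot> (Ma k \<cdot> e2)"
        unfolding fk[symmetric] Ma_comp[OF k f] by (rule comp_assoc[OF e2 Ma_hom[OF k] Ma_hom[OF f]])
      finally show "\<exists>e' \<in> hom V \<I> (Mo a). e = Ma f \<cdot> e'"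
        using comp_hom[OF e2 Ma_hom[OF k]] by blast
    qed
  qed
qed

text \<open>Both monads have free algebras of the same pretheory on the same objects, so each unit
  extends to a canonical homomorphism between them.\<close>

lemma comparison:
  assumes M': "free_algebra_monad V P T J M' free'"
  obtains \<theta> where "\<And>c. c \<in> Obj V \<Longrightarrow> ahom (free c) (free' c) (\<theta> c)"
    and "\<And>c. c \<in> Obj V \<Longrightarrow> \<theta> c \<cdot> unit c = unit_arr V M' c"
proof -
  interpret M': free_algebra_monad V P T J M' free' by (rule M')
  have "\<exists>g. ahom (free c) (free' c) g \<and> g \<cdot> unit c = unit_arr V M' c" if "c \<in> Obj V" for c
    using that by (intro free_ext M'.free_alg) (simp_all add: M'.fst_free M'.unit_hom)
  then have "\<exists>\<theta>. \<forall>c \<in> Obj V. ahom (free c) (free' c) (\<theta> c) \<and> \<theta> c \<cdot> unit c = unit_arr V M' c"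
    by (intro bchoice) blast
  then show thesis using that by blast
qed

text \<open>The comparison \<open>\<theta>\<close> is natural and has \<open>\<zeta>\<close> as a
  section, both by uniqueness of extensions. An element of the second monad at \<open>b\<close> is
  carried to the first, lifted along \<open>M f\<close> there, and carried back.\<close>

lemma surjection_transfer:
  assumes M': "free_algebra_monad V P T J M' free'" and f: "f \<in> hom V a b" and s: "surjection V (Ma f)"
  shows "surjection V (monad_arr V M' f)"
proof -
  interpret M': free_algebra_monad V P T J M' free' by (rule M')
  obtain \<theta> where \<theta>: "\<And>c. c \<in> Obj V \<Longrightarrow> ahom (free c) (free' c) (\<theta> c)"
    "\<And>c. c \<in> Obj V \<Longrightarrow> \<theta> c \<cdot> unit c = unit_arr V M' c"
    using comparison[OF M'] by blast
  obtain \<zeta> where \<zeta>: "\<And>c. c \<in> Obj V \<Longrightarrow> ahom (free' c) (free c) (\<zeta> c)"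
    "\<And>c. c \<in> Obj V \<Longrightarrow> \<zeta> c \<cdot> unit_arr V M' c = unit c"
    using M'.comparison[OF free_algebra_monad_axioms] by blast
  have \<theta>h: "\<theta> c \<in> hom V (Mo c) (M'.Mo c)" and \<zeta>h: "\<zeta> c \<in> hom V (M'.Mo c) (Mo c)" if "c \<in> Obj V" for c
    using ahom_hom[OF \<theta>(1)[OF that]] ahom_hom[OF \<zeta>(1)[OF that]] that by (simp_all add: fst_free M'.fst_free)
  have ab: "a \<in> Obj V" "b \<in> Obj V" using hom_objs[OF f] by auto
  have \<theta>\<zeta>: "\<theta> b \<cdot> \<zeta> b = \<ee> (M'.Mo b)"
  proof (rule M'.free_unique[OF ab(2) M'.free_alg[OF ab(2)]])
    show "ahom (free' b) (free' b) (\<theta> b \<cdot> \<zeta> b)"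
      by (rule ahom_comp[OF \<zeta>(1) \<theta>(1)]) (use ab in \<open>simp_all add: free_alg M'.free_alg\<close>)
    show "ahom (free' b) (free' b) (\<ee> (M'.Mo b))"
      using ahom_id[OF M'.free_alg[OF ab(2)]] ab by (simp add: M'.fst_free)
    show "(\<theta> b \<cdot> \<zeta> b) \<cdot> M'.unit b = \<ee> (M'.Mo b) \<cdot> M'.unit b"
      using comp_assoc[OF M'.unit_hom[OF ab(2)] \<zeta>h[OF ab(2)] \<theta>h[OF ab(2)]] \<theta>(2)[OF ab(2)] \<zeta>(2)[OF ab(2)] ab by simp
  qed
  have nat: "\<theta> b \<cdot> Ma f = M'.Ma f \<cdot> \<theta> a"
  proof (rule free_unique[OF ab(1) M'.free_alg[OF ab(2)]])
    show "ahom (free a) (free' b) (\<theta> b \<cdot> Ma f)"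
      by (rule ahom_comp[OF monad_arr_ahom[OF f] \<theta>(1)]) (use ab in \<open>simp_all add: free_alg M'.free_alg\<close>)
    show "ahom (free a) (free' b) (M'.Ma f \<cdot> \<theta> a)"
      by (rule ahom_comp[OF \<theta>(1) M'.monad_arr_ahom[OF f]]) (use ab in \<open>simp_all add: free_alg M'.free_alg\<close>)
    have "(\<theta> b \<cdot> Ma f) \<cdot> unit a = \<theta> b \<cdot> (unit b \<cdot> f)"
      using comp_assoc[OF unit_hom[OF ab(1)] Ma_hom[OF f] \<theta>h[OF ab(2)]] monad_arr_unit[OF f] by simp
    also have "\<dots> = M'.unit b \<cdot> f"
      using comp_assoc[OF f unit_hom[OF ab(2)] \<theta>h[OF ab(2)]] \<theta>(2)[OF ab(2)] by simp
    also have "\<dots> = (M'.Ma f \<cdot> \<theta> a) \<cdot> unit a"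
      using comp_assoc[OF unit_hom[OF ab(1)] \<theta>h[OF ab(1)] M'.Ma_hom[OF f]] \<theta>(2)[OF ab(1)] M'.monad_arr_unit[OF f] by simp
    finally show "(\<theta> b \<cdot> Ma f) \<cdot> unit a = (M'.Ma f \<cdot> \<theta> a) \<cdot> unit a" .
  qed
  show ?thesis
    unfolding surjection_iff[OF M'.Ma_hom[OF f]]
  proof
    fix e assume e: "e \<in> hom V \<I> (M'.Mo b)"
    obtain e1 where e1: "e1 \<in> hom V \<I> (Mo a)" "\<zeta> b \<cdot> e = Ma f \<cdot> e1"
      using s[unfolded surjection_iff[OF Ma_hom[OF f]]] comp_hom[OF e \<zeta>h[OF ab(2)]] by blast
    have "e = (\<theta> b \<cdot> \<zeta> b) \<cdot> e" unfolding \<theta>\<zeta> by (rule id_comp[OF e, symmetric])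
    also have "\<dots> = \<theta> b \<cdot> (Ma f \<cdot> e1)"
      using comp_assoc[OF e \<zeta>h[OF ab(2)] \<theta>h[OF ab(2)]] e1(2) by simp
    also have "\<dots> = (\<theta> b \<cdot> Ma f) \<cdot> e1"
      by (rule comp_assoc[OF e1(1) Ma_hom[OF f] \<theta>h[OF ab(2)], symmetric])
    also have "\<dots> = M'.Ma f \<cdot> (\<theta> a \<cdot> e1)"
      unfolding nat by (rule comp_assoc[OF e1(1) \<theta>h[OF ab(1)] M'.Ma_hom[OF f]])
    finally show "\<exists>e' \<in> hom V \<I> (M'.Mo a). e = M'.Ma f \<cdot> e'"
      using comp_hom[OF e1(1) \<theta>h[OF ab(1)]] by blast
  qed
qed

end

theorem theorem4p5:
  fixes \<kappa> :: "'s rel"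
    and V :: "('o, 'm) smcat"
    and P :: "'o set"
    and T :: "('o, 'o, 'm) vcat"
    and J :: "('o, 'o, 'm) vfun"
    and M :: "('o, 'm) vmonad"
  assumes "small_regular_cardinal \<kappa>"
    and "locally_presentable_smc \<kappa> V"
    and "unit_hom_preserves_presentable \<kappa> V"
    and "presentable_representatives \<kappa> V P"
    and "is_theory V P T J"
    and "is_induced_monad V P T J M"
  shows "is_discrete V P T J \<longleftrightarrow> preserves_surjections V M"
proof -
  interpret symmetric_monoidal_closed V
    using assms(2) by (simp add: locally_presentable_smc_def)
  interpret pretheory V P T J
    using assms(4,5) by unfold_locales (auto simp: is_theory_def presentable_representatives_def presentable_def)
  have induced: "\<exists>Q U F \<eta> \<epsilon>. induced_monad V P T J Q U F \<eta> \<epsilon> N" if "is_induced_monad V P T J N" for N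
    using that unfolding is_induced_monad_def
    by (elim exE conjE) (intro exI induced_monad.intro algebra_category.intro pretheory_axioms
        algebra_category_axioms.intro induced_monad_axioms.intro)
  \<comment> \<open>\<open>N\<close> is the monad witnessing that \<open>T\<close> is a theory. It
    may differ from \<open>M\<close>, but both satisfy \<open>free_algebra_monad\<close> over the
    same pretheory, which is what \<open>surjection_transfer\<close> needs in either
    direction.\<close>
  obtain N E W where N: "is_induced_monad V P T J N" and em: "is_eilenberg_moore V N E W"
    and iso: "isomorphic_pretheories V P T J (induced_theory V P N E) (induced_theory_functor V P N E W)"
    using assms(5) unfolding is_theory_def by blast
  obtain Q U F \<eta> \<epsilon> where "induced_monad V P T J Q U F \<eta> \<epsilon> N" using induced[OF N] by blast
  then interpret N: induced_monad V P T J Q U F \<eta> \<epsilon> N .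
  obtain Q' U' F' \<eta>' \<epsilon>' where "induced_monad V P T J Q' U' F' \<eta>' \<epsilon>' M" using induced[OF assms(6)] by blast
  then interpret M: induced_monad V P T J Q' U' F' \<eta>' \<epsilon>' M .
  have "\<I> \<in> P" using assms(4) by (simp add: presentable_representatives_def)
  from N.discrete_iff[OF em iso this]
  have "is_discrete V P T J \<longleftrightarrow> (\<forall>x \<in> P. \<forall>x0 \<in> P. \<forall>\<iota>. is_unit_copower V (hom V \<I> x) x0 \<iota> \<longrightarrow>
      surjection V (monad_arr V N (discrete_counit V x x0 \<iota>)))"
    using surjection_iff[OF N.Ma_hom[OF discrete_counit(1)]] P_obj by (simp del: N.M_simps)
  also have "\<dots> \<longleftrightarrow> (\<forall>x \<in> P. \<forall>x0 \<in> P. \<forall>\<iota>. is_unit_copower V (hom V \<I> x) x0 \<iota> \<longrightarrow>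
      surjection V (monad_arr V M (discrete_counit V x x0 \<iota>)))"
    using N.surjection_transfer[OF M.free_algebra_monad_axioms discrete_counit(1)]
      M.surjection_transfer[OF N.free_algebra_monad_axioms discrete_counit(1)] P_obj by blast
  also have "\<dots> \<longleftrightarrow> preserves_surjections V M"
    by (rule M.preserves_surjections_iff[OF assms(1-4), symmetric])
  finally show ?thesis .
qed

end
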